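(* Let $T$ be a consistent primitive recursively axiomatized $\mathcal{L}_A$-theory containing $\mathsf{PA}$. Then there exists a $\Sigma_1$ provability predicate $\mathrm{Pr}_T(x)$ of $T$ such that (1) for any modal formula $A$ and any arithmetical interpretation $f$ based on $\mathrm{Pr}_T(x)$, if $\mathbf{K}\vdash A$, then $\mathsf{PA}\vdash f(A)$; and (2) there exists an arithmetical interpretation $f$ based on $\mathrm{Pr}_T(x)$ such that for any modal formula $A$, $\mathbf{K}\vdash A$ if and only if $T\vdash f(A)$.
   Context: $\mathcal{L}_A$ is the language of first-order arithmetic. An $\mathcal{L}_A$-formula $\mathrm{Pr}_T(x)$ is a provability predicate of $T$ if for every $\mathcal{L}_A$-formula $\varphi$, $T\vdash\varphi$ iff $\mathsf{PA}\vdash\mathrm{Pr}_T(\ulcorner\varphi\urcorner)$. Modal formulas are built from propositional variables and $\bot$ using $\neg,\land,\lor,\to$ and $\Box$. An arithmetical interpretation based on $\mathrm{Pr}_T(x)$ is a map $f$ from modal formulas to $\mathcal{L}_A$-sentences with $f(p)$ arbitrary for variables, $f(\bot)$ being $0=1$, $f$ commuting with Boolean connectives, and $f(\Box A)$ being $\mathrm{Pr}_T(\ulcorner f(A)\urcorner)$. $\mathbf{K}$ is the standard minimal normal modal logic (tautologies, $\Box(A\to B)\to(\Box A\to\Box B)$, Modus Ponens, Necessitation). *)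

theory Defs
  imports Main "HOL-Library.Nat_Bijection"
begin

section \<open>First-order arithmetic\<close>

text \<open>The language has the symbols 0, S, +, \<open>\<times>\<close>, <, =; variables are de Bruijn indices.\<close>

datatype tm = Var nat | Zero | Succ tm | Add tm tm | Mult tm tm

datatype fm =
    Eq tm tm
  | Less tm tm
  | Neg fm
  | And fm fm
  | Or fm fm
  | Imp fm fm
  | Forall fm
  | Exists fm

primrec fvt :: "tm \<Rightarrow> nat set" where
  "fvt (Var i) = {i}"
| "fvt Zero = {}"
| "fvt (Succ t) = fvt t"
| "fvt (Add s t) = fvt s \<union> fvt t"
| "fvt (Mult s t) = fvt s \<union> fvt t"

primrec fv :: "fm \<Rightarrow> nat set" where
  "fv (Eq s t) = fvt s \<union> fvt t"
| "fv (Less s t) = fvt s \<union> fvt t"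
| "fv (Neg p) = fv p"
| "fv (And p q) = fv p \<union> fv q"
| "fv (Or p q) = fv p \<union> fv q"
| "fv (Imp p q) = fv p \<union> fv q"
| "fv (Forall p) = {i. Suc i \<in> fv p}"
| "fv (Exists p) = {i. Suc i \<in> fv p}"

definition sentence :: "fm \<Rightarrow> bool" where
  "sentence p \<longleftrightarrow> fv p = {}"

text \<open>\<open>liftt t k\<close> and \<open>lift p k\<close> make room for a new variable with index \<open>k\<close>;
  \<open>substt t s k\<close> and \<open>subst p s k\<close> replace the variable \<open>k\<close> by \<open>s\<close> and close the gap, that is,
  they lower the indices above \<open>k\<close> by one.\<close>

primrec liftt :: "tm \<Rightarrow> nat \<Rightarrow> tm" where
  "liftt (Var i) k = (if i < k then Var i else Var (Suc i))"
| "liftt Zero k = Zero"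
| "liftt (Succ t) k = Succ (liftt t k)"
| "liftt (Add s t) k = Add (liftt s k) (liftt t k)"
| "liftt (Mult s t) k = Mult (liftt s k) (liftt t k)"

primrec lift :: "fm \<Rightarrow> nat \<Rightarrow> fm" where
  "lift (Eq s t) k = Eq (liftt s k) (liftt t k)"
| "lift (Less s t) k = Less (liftt s k) (liftt t k)"
| "lift (Neg p) k = Neg (lift p k)"
| "lift (And p q) k = And (lift p k) (lift q k)"
| "lift (Or p q) k = Or (lift p k) (lift q k)"
| "lift (Imp p q) k = Imp (lift p k) (lift q k)"
| "lift (Forall p) k = Forall (lift p (Suc k))"
| "lift (Exists p) k = Exists (lift p (Suc k))"

primrec substt :: "tm \<Rightarrow> tm \<Rightarrow> nat \<Rightarrow> tm" where
  "substt (Var i) s k = (if i < k then Var i else if i = k then s else Var (i - 1))"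
| "substt Zero s k = Zero"
| "substt (Succ t) s k = Succ (substt t s k)"
| "substt (Add t u) s k = Add (substt t s k) (substt u s k)"
| "substt (Mult t u) s k = Mult (substt t s k) (substt u s k)"

primrec subst :: "fm \<Rightarrow> tm \<Rightarrow> nat \<Rightarrow> fm" where
  "subst (Eq t u) s k = Eq (substt t s k) (substt u s k)"
| "subst (Less t u) s k = Less (substt t s k) (substt u s k)"
| "subst (Neg p) s k = Neg (subst p s k)"
| "subst (And p q) s k = And (subst p s k) (subst q s k)"
| "subst (Or p q) s k = Or (subst p s k) (subst q s k)"
| "subst (Imp p q) s k = Imp (subst p s k) (subst q s k)"
| "subst (Forall p) s k = Forall (subst p (liftt s 0) (Suc k))"
| "subst (Exists p) s k = Exists (subst p (liftt s 0) (Suc k))"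

definition Iff :: "fm \<Rightarrow> fm \<Rightarrow> fm" where
  "Iff p q = And (Imp p q) (Imp q p)"

text \<open>Hilbert-style classical predicate calculus with equality. Generalization applies to the
  non-logical axioms \<open>T\<close> too, so that an open formula is provable iff its universal closure is.\<close>

inductive prv :: "fm set \<Rightarrow> fm \<Rightarrow> bool" (infix "\<turnstile>" 50) for T :: "fm set" where
  Ax: "p \<in> T \<Longrightarrow> T \<turnstile> p"
| MP: "T \<turnstile> Imp p q \<Longrightarrow> T \<turnstile> p \<Longrightarrow> T \<turnstile> q"
| Gen: "T \<turnstile> p \<Longrightarrow> T \<turnstile> Forall p"
| ImpK: "T \<turnstile> Imp p (Imp q p)"
| ImpS: "T \<turnstile> Imp (Imp p (Imp q r)) (Imp (Imp p q) (Imp p r))"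
| AndI: "T \<turnstile> Imp p (Imp q (And p q))"
| AndE1: "T \<turnstile> Imp (And p q) p"
| AndE2: "T \<turnstile> Imp (And p q) q"
| OrI1: "T \<turnstile> Imp p (Or p q)"
| OrI2: "T \<turnstile> Imp q (Or p q)"
| OrE: "T \<turnstile> Imp (Imp p r) (Imp (Imp q r) (Imp (Or p q) r))"
| NegI: "T \<turnstile> Imp (Imp p q) (Imp (Imp p (Neg q)) (Neg p))"
| NegE: "T \<turnstile> Imp (Neg (Neg p)) p"
| ForallE: "T \<turnstile> Imp (Forall p) (subst p t 0)"
| ForallI: "T \<turnstile> Imp (Forall (Imp (lift p 0) q)) (Imp p (Forall q))"
| ExistsI: "T \<turnstile> Imp (subst p t 0) (Exists p)"
| ExistsE: "T \<turnstile> Imp (Forall (Imp p (lift q 0))) (Imp (Exists p) q)"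
| EqRefl: "T \<turnstile> Eq t t"
| EqSubst: "T \<turnstile> Imp (Eq s t) (Imp (subst p s 0) (subst p t 0))"

definition consistent :: "fm set \<Rightarrow> bool" where
  "consistent T \<longleftrightarrow> \<not> (\<exists>p. T \<turnstile> p \<and> T \<turnstile> Neg p)"


section \<open>Peano arithmetic\<close>

text \<open>In \<open>ind p\<close>, variable 0 of \<open>p\<close> is the induction variable, the others are parameters.
  Substituting in \<open>lift p 1\<close> keeps the indices of the parameters, so that the term
  \<open>subst (lift p 1) (Succ (Var 0)) 0\<close> is \<open>p\<close> with variable 0 replaced by its successor.\<close>

definition ind :: "fm \<Rightarrow> fm" where
  "ind p = Imp (And (subst p Zero 0) (Forall (Imp p (subst (lift p 1) (Succ (Var 0)) 0))))
               (Forall p)"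

definition PA :: "fm set" where
  "PA =
    {Forall (Neg (Eq (Succ (Var 0)) Zero)),
     Forall (Forall (Imp (Eq (Succ (Var 1)) (Succ (Var 0))) (Eq (Var 1) (Var 0)))),
     Forall (Eq (Add (Var 0) Zero) (Var 0)),
     Forall (Forall (Eq (Add (Var 1) (Succ (Var 0))) (Succ (Add (Var 1) (Var 0))))),
     Forall (Eq (Mult (Var 0) Zero) Zero),
     Forall (Forall (Eq (Mult (Var 1) (Succ (Var 0))) (Add (Mult (Var 1) (Var 0)) (Var 1)))),
     Forall (Neg (Less (Var 0) Zero)),
     Forall (Forall (Iff (Less (Var 1) (Succ (Var 0)))
                         (Or (Less (Var 1) (Var 0)) (Eq (Var 1) (Var 0)))))}
    \<union> {(Forall ^^ n) (ind p) | n p. sentence ((Forall ^^ n) (ind p))}"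


section \<open>Bounded and \<open>\<Sigma>\<^sub>1\<close> formulas\<close>

text \<open>The bound \<open>t\<close> is lifted because the quantified variable must not occur in it.\<close>

inductive delta0 :: "fm \<Rightarrow> bool" where
  "delta0 (Eq s t)"
| "delta0 (Less s t)"
| "delta0 p \<Longrightarrow> delta0 (Neg p)"
| "delta0 p \<Longrightarrow> delta0 q \<Longrightarrow> delta0 (And p q)"
| "delta0 p \<Longrightarrow> delta0 q \<Longrightarrow> delta0 (Or p q)"
| "delta0 p \<Longrightarrow> delta0 q \<Longrightarrow> delta0 (Imp p q)"
| "delta0 p \<Longrightarrow> delta0 (Forall (Imp (Less (Var 0) (liftt t 0)) p))"
| "delta0 p \<Longrightarrow> delta0 (Exists (And (Less (Var 0) (liftt t 0)) p))"

inductive sigma1 :: "fm \<Rightarrow> bool" where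
  "delta0 p \<Longrightarrow> sigma1 p"
| "sigma1 p \<Longrightarrow> sigma1 (Exists p)"


section \<open>Goedel numbers and primitive recursive axiomatizations\<close>

primrec gnt :: "tm \<Rightarrow> nat" where
  "gnt (Var i) = prod_encode (0, i)"
| "gnt Zero = prod_encode (1, 0)"
| "gnt (Succ t) = prod_encode (2, gnt t)"
| "gnt (Add s t) = prod_encode (3, prod_encode (gnt s, gnt t))"
| "gnt (Mult s t) = prod_encode (4, prod_encode (gnt s, gnt t))"

primrec gn :: "fm \<Rightarrow> nat" where
  "gn (Eq s t) = prod_encode (0, prod_encode (gnt s, gnt t))"
| "gn (Less s t) = prod_encode (1, prod_encode (gnt s, gnt t))"
| "gn (Neg p) = prod_encode (2, gn p)"
| "gn (And p q) = prod_encode (3, prod_encode (gn p, gn q))"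
| "gn (Or p q) = prod_encode (4, prod_encode (gn p, gn q))"
| "gn (Imp p q) = prod_encode (5, prod_encode (gn p, gn q))"
| "gn (Forall p) = prod_encode (6, gn p)"
| "gn (Exists p) = prod_encode (7, gn p)"

lemma gnt_inject: "gnt s = gnt t \<longleftrightarrow> s = t"
proof (induction s arbitrary: t)
qed (case_tac t; simp)+

lemma gn_inject: "gn p = gn q \<longleftrightarrow> p = q"
proof (induction p arbitrary: q)
qed (case_tac q; simp add: gnt_inject)+

definition num :: "nat \<Rightarrow> tm" where
  "num n = (Succ ^^ n) Zero"

text \<open>\<open>prim_rec n f\<close>: \<open>f\<close> is an \<open>n\<close>-ary primitive recursive function. Its arguments form a list,
  and only the values on lists of length \<open>n\<close> are meaningful.\<close>

inductive prim_rec :: "nat \<Rightarrow> (nat list \<Rightarrow> nat) \<Rightarrow> bool" where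
  zero: "prim_rec n (\<lambda>xs. 0)"
| succ: "prim_rec 1 (\<lambda>xs. Suc (xs ! 0))"
| proj: "i < n \<Longrightarrow> prim_rec n (\<lambda>xs. xs ! i)"
| comp: "prim_rec (length gs) f \<Longrightarrow> \<forall>g \<in> set gs. prim_rec n g \<Longrightarrow>
    prim_rec n (\<lambda>xs. f (map (\<lambda>g. g xs) gs))"
| rec: "prim_rec n f \<Longrightarrow> prim_rec (n + 2) g \<Longrightarrow>
    prim_rec (Suc n) (\<lambda>xs. rec_nat (f (tl xs)) (\<lambda>k r. g (k # r # tl xs)) (hd xs))"

definition prim_rec_set :: "nat set \<Rightarrow> bool" where
  "prim_rec_set A \<longleftrightarrow> (\<exists>f. prim_rec 1 f \<and> (\<forall>n. f [n] = (if n \<in> A then 1 else 0)))"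

text \<open>A primitive recursively axiomatized theory is given by its set of axioms.\<close>

definition prim_rec_theory :: "fm set \<Rightarrow> bool" where
  "prim_rec_theory T \<longleftrightarrow> (\<forall>p \<in> T. sentence p) \<and> prim_rec_set (gn ` T)"


section \<open>Provability predicates\<close>

text \<open>\<open>P\<close> with the numeral of the Goedel number of \<open>p\<close> in place of variable 0.\<close>

definition at_code :: "fm \<Rightarrow> fm \<Rightarrow> fm" where
  "at_code P p = subst P (num (gn p)) 0"

definition provability_predicate :: "fm set \<Rightarrow> fm \<Rightarrow> bool" where
  "provability_predicate T P \<longleftrightarrow> fv P \<subseteq> {0} \<and> (\<forall>p. T \<turnstile> p \<longleftrightarrow> PA \<turnstile> at_code P p)"


section \<open>Modal logic and arithmetical interpretations\<close>

datatype modal =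
    MVar nat
  | MBot
  | MNeg modal
  | MAnd modal modal
  | MOr modal modal
  | MImp modal modal
  | MBox modal

text \<open>Propositional truth; \<open>v\<close> is only used at variables and boxed formulas.\<close>

primrec mval :: "(modal \<Rightarrow> bool) \<Rightarrow> modal \<Rightarrow> bool" where
  "mval v (MVar i) = v (MVar i)"
| "mval v MBot = False"
| "mval v (MNeg A) = (\<not> mval v A)"
| "mval v (MAnd A B) = (mval v A \<and> mval v B)"
| "mval v (MOr A B) = (mval v A \<or> mval v B)"
| "mval v (MImp A B) = (mval v A \<longrightarrow> mval v B)"
| "mval v (MBox A) = v (MBox A)"

definition tautology :: "modal \<Rightarrow> bool" where
  "tautology A \<longleftrightarrow> (\<forall>v. mval v A)"

inductive K_prv :: "modal \<Rightarrow> bool" where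
  Taut: "tautology A \<Longrightarrow> K_prv A"
| Dist: "K_prv (MImp (MBox (MImp A B)) (MImp (MBox A) (MBox B)))"
| MP: "K_prv (MImp A B) \<Longrightarrow> K_prv A \<Longrightarrow> K_prv B"
| Nec: "K_prv A \<Longrightarrow> K_prv (MBox A)"

definition arith_interp :: "fm \<Rightarrow> (modal \<Rightarrow> fm) \<Rightarrow> bool" where
  "arith_interp P f \<longleftrightarrow>
    (\<forall>A. sentence (f A)) \<and>
    f MBot = Eq Zero (Succ Zero) \<and>
    (\<forall>A. f (MNeg A) = Neg (f A)) \<and>
    (\<forall>A B. f (MAnd A B) = And (f A) (f B)) \<and>
    (\<forall>A B. f (MOr A B) = Or (f A) (f B)) \<and>
    (\<forall>A B. f (MImp A B) = Imp (f A) (f B)) \<and>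
    (\<forall>A. f (MBox A) = at_code P (f A))"

end

theory Submission
  imports Defs "HOL-Library.Countable_Set"
begin

text \<open>
  By the completeness theorem, provability in PA and in \<open>T\<close> can be studied in countable models. The
  predicate \<open>Pr\<close> is a \<open>\<Sigma>\<^sub>1\<close> formula that refers to its own code and runs a race over stages \<open>w\<close>.
  Normally it enumerates the modus ponens closure of the theorems of \<open>T\<close> found so far. But if at
  some stage \<open>T\<close> is seen to refute ``\<open>Pr\<close> agrees with the finite set \<open>s\<close> below \<open>k\<close>'', where \<open>s\<close> extends to
  a finite set \<open>e\<close> that contains the theorems found so far and is closed under modus ponens, then
  \<open>Pr\<close> stops and defines \<open>e\<close>. Such a refutation would be false in every model of PA, so it does not
  exist, and in the standard model \<open>Pr\<close> defines the theorems of \<open>T\<close>. Moreover, for every set \<open>X\<close> of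
  numbers that contains the theorems of \<open>T\<close> and is closed under modus ponens, \<open>T\<close> has a model in which
  the standard part of \<open>Pr\<close> is \<open>X\<close>.

  Closure of \<open>Pr\<close> under modus ponens must be provable in PA. It needs no arithmetic in PA: the only
  combinatorial fact involved (finite sets have small codes) has a bounded counterexample if it
  fails, and \<open>Pr\<close> is made to hold of everything as soon as such a counterexample shows up, which
  never happens in the standard model.

  For completeness, interpret variables by \<open>Pr\<close> at numbers that code no formula. Induction on the
  modal depth then yields, for every world of the canonical model of K, a model of \<open>T\<close> with the same
  true formulas: for \<open>X\<close> take the formulas that hold in the models belonging to all successors.
\<close>

section \<open>Simultaneous substitution\<close>

text \<open>The flexibility argument is of Rosser type: a refutation in \<open>T\<close> of the
  agreement of \<open>Pr\<close> with \<open>s\<close> below \<open>k\<close> would trigger the very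
  stop that makes this agreement true. No diagonal lemma is needed, since the code of the formula is
  a parameter of the race that is filled in at the end. The obstacle is that a stop may occur at
  nonstandard stages, and distribution has to hold there too. So the stopped set must be closed
  under modus ponens, and no earlier stage may have accepted a number outside it. To get the latter,
  a stage accepts only what lies in all good sets coded below it; the stopped set, restricted to an
  earlier stage, has a code there unless the clause for failure applies. Distribution is a schema,
  so closure matters only at standard codes, and these are small at every nonstandard stage. Each
  notion of the race is a HOL predicate on models together with one bounded formula that defines it
  in all of them. Truth at standard arguments is then absolute; beyond that, nonstandard models
  contribute only their order and the least number principle.\<close>

primrec psubstt :: "(nat \<Rightarrow> tm) \<Rightarrow> tm \<Rightarrow> tm" where
  "psubstt \<sigma> (Var i) = \<sigma> i"
| "psubstt \<sigma> Zero = Zero"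
| "psubstt \<sigma> (Succ t) = Succ (psubstt \<sigma> t)"
| "psubstt \<sigma> (Add s t) = Add (psubstt \<sigma> s) (psubstt \<sigma> t)"
| "psubstt \<sigma> (Mult s t) = Mult (psubstt \<sigma> s) (psubstt \<sigma> t)"

definition up :: "(nat \<Rightarrow> tm) \<Rightarrow> nat \<Rightarrow> tm" where
  "up \<sigma> = case_nat (Var 0) (\<lambda>i. liftt (\<sigma> i) 0)"

primrec psubst :: "(nat \<Rightarrow> tm) \<Rightarrow> fm \<Rightarrow> fm" where
  "psubst \<sigma> (Eq s t) = Eq (psubstt \<sigma> s) (psubstt \<sigma> t)"
| "psubst \<sigma> (Less s t) = Less (psubstt \<sigma> s) (psubstt \<sigma> t)"
| "psubst \<sigma> (Neg p) = Neg (psubst \<sigma> p)"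
| "psubst \<sigma> (And p q) = And (psubst \<sigma> p) (psubst \<sigma> q)"
| "psubst \<sigma> (Or p q) = Or (psubst \<sigma> p) (psubst \<sigma> q)"
| "psubst \<sigma> (Imp p q) = Imp (psubst \<sigma> p) (psubst \<sigma> q)"
| "psubst \<sigma> (Forall p) = Forall (psubst (up \<sigma>) p)"
| "psubst \<sigma> (Exists p) = Exists (psubst (up \<sigma>) p)"

text \<open>\<open>lift\<close> and \<open>subst\<close> become instances of \<open>psubst\<close>;
  their commutation laws then reduce to composing maps and comparing them pointwise.\<close>

definition lift_map :: "nat \<Rightarrow> nat \<Rightarrow> tm" where
  "lift_map k i = (if i < k then Var i else Var (Suc i))"

definition subst_map :: "tm \<Rightarrow> nat \<Rightarrow> nat \<Rightarrow> tm" where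
  "subst_map s k i = (if i < k then Var i else if i = k then s else Var (i - 1))"

lemma liftt_eq: "liftt t k = psubstt (lift_map k) t"
  by (induction t) (auto simp: lift_map_def)

lemma substt_eq: "substt t s k = psubstt (subst_map s k) t"
  by (induction t) (auto simp: subst_map_def)

lemma up_lift_map: "up (lift_map k) = lift_map (Suc k)"
  by (rule ext) (auto simp: up_def lift_map_def split: nat.split)

lemma up_subst_map: "up (subst_map s k) = subst_map (liftt s 0) (Suc k)"
  by (rule ext) (auto simp: up_def subst_map_def split: nat.split)

lemma lift_eq: "lift p k = psubst (lift_map k) p"
  by (induction p arbitrary: k) (auto simp: liftt_eq up_lift_map)

lemma subst_eq: "subst p s k = psubst (subst_map s k) p"
  by (induction p arbitrary: s k) (auto simp: substt_eq up_subst_map)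

lemma psubstt_psubstt: "psubstt \<sigma> (psubstt \<tau> t) = psubstt (\<lambda>i. psubstt \<sigma> (\<tau> i)) t"
  by (induction t) auto

lemma psubstt_up_liftt: "psubstt (up \<sigma>) (liftt t 0) = liftt (psubstt \<sigma> t) 0"
  by (induction t) (auto simp: up_def)

lemma up_comp: "up (\<lambda>i. psubstt \<sigma> (\<tau> i)) = (\<lambda>i. psubstt (up \<sigma>) (up \<tau> i))"
proof
  fix i
  show "up (\<lambda>i. psubstt \<sigma> (\<tau> i)) i = psubstt (up \<sigma>) (up \<tau> i)"
  proof (cases i)
    case (Suc j)
    have "up \<tau> i = liftt (\<tau> j) 0" by (simp add: Suc up_def)
    then have "psubstt (up \<sigma>) (up \<tau> i) = liftt (psubstt \<sigma> (\<tau> j)) 0" by (simp add: psubstt_up_liftt)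
    then show ?thesis by (simp add: Suc up_def)
  qed (simp add: up_def)
qed

lemma psubst_psubst: "psubst \<sigma> (psubst \<tau> p) = psubst (\<lambda>i. psubstt \<sigma> (\<tau> i)) p"
  by (induction p arbitrary: \<sigma> \<tau>) (auto simp: psubstt_psubstt up_comp)

lemma psubstt_cong: "(\<And>i. i \<in> fvt t \<Longrightarrow> \<sigma> i = \<tau> i) \<Longrightarrow> psubstt \<sigma> t = psubstt \<tau> t"
  by (induction t) auto

lemma psubst_cong: "(\<And>i. i \<in> fv p \<Longrightarrow> \<sigma> i = \<tau> i) \<Longrightarrow> psubst \<sigma> p = psubst \<tau> p"
proof (induction p arbitrary: \<sigma> \<tau>)
  case (Forall p)
  have "psubst (up \<sigma>) p = psubst (up \<tau>) p"
    by (rule Forall.IH) (use Forall.prems in \<open>auto simp: up_def split: nat.split\<close>)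
  then show ?case by simp
next
  case (Exists p)
  have "psubst (up \<sigma>) p = psubst (up \<tau>) p"
    by (rule Exists.IH) (use Exists.prems in \<open>auto simp: up_def split: nat.split\<close>)
  then show ?case by simp
next
  case (Neg p)
  show ?case using Neg.IH[of \<sigma> \<tau>] Neg.prems by simp
next
  case (And p q)
  show ?case using And.IH[of \<sigma> \<tau>] And.prems by simp
next
  case (Or p q)
  show ?case using Or.IH[of \<sigma> \<tau>] Or.prems by simp
next
  case (Imp p q)
  show ?case using Imp.IH[of \<sigma> \<tau>] Imp.prems by simp
next
  case (Eq s t)
  then show ?case by (auto intro!: psubstt_cong)
next
  case (Less s t)
  then show ?case by (auto intro!: psubstt_cong)
qed

lemma psubstt_Var [simp]: "psubstt Var t = t"
  by (induction t) auto

lemma up_Var [simp]: "up Var = Var"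
  by (rule ext) (auto simp: up_def split: nat.split)

lemma psubst_Var [simp]: "psubst Var p = p"
  by (induction p) auto

lemma psubst_sentence: "sentence p \<Longrightarrow> psubst \<sigma> p = p"
  using psubst_cong[of p \<sigma> Var] by (simp add: sentence_def)

lemma psubst_subst: "psubst \<sigma> (subst p t 0) = subst (psubst (up \<sigma>) p) (psubstt \<sigma> t) 0"
proof -
  have "(\<lambda>i. psubstt \<sigma> (subst_map t 0 i)) = (\<lambda>i. psubstt (subst_map (psubstt \<sigma> t) 0) (up \<sigma> i))"
  proof
    fix i
    show "psubstt \<sigma> (subst_map t 0 i) = psubstt (subst_map (psubstt \<sigma> t) 0) (up \<sigma> i)"
    proof (cases i)
      case (Suc j)
      have "psubstt (subst_map (psubstt \<sigma> t) 0) (liftt (\<sigma> j) 0) = psubstt Var (\<sigma> j)"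
        unfolding liftt_eq psubstt_psubstt by (auto intro!: psubstt_cong simp: lift_map_def subst_map_def)
      then show ?thesis by (simp add: Suc up_def subst_map_def)
    qed (simp add: up_def subst_map_def)
  qed
  then show ?thesis by (simp add: subst_eq psubst_psubst)
qed

lemma psubst_lift: "psubst (up \<sigma>) (lift p 0) = lift (psubst \<sigma> p) 0"
proof -
  have "(\<lambda>i. psubstt (up \<sigma>) (lift_map 0 i)) = (\<lambda>i. psubstt (lift_map 0) (\<sigma> i))"
    by (simp add: lift_map_def up_def liftt_eq[symmetric])
  then show ?thesis by (simp add: lift_eq psubst_psubst)
qed

lemma substt_liftt [simp]: "substt (liftt t 0) s 0 = t"
  using psubstt_cong[of t "\<lambda>i. psubstt (subst_map s 0) (lift_map 0 i)" Var]
  by (simp add: liftt_eq substt_eq psubstt_psubstt lift_map_def subst_map_def)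

lemma subst_lift_Suc_Var [simp]: "subst (lift p (Suc 0)) (Var 0) 0 = p"
  using psubst_cong[of p "\<lambda>i. psubstt (subst_map (Var 0) 0) (lift_map (Suc 0) i)" Var]
  by (simp add: lift_eq subst_eq psubst_psubst lift_map_def subst_map_def)

lemma size_psubst [simp]: "size (psubst \<sigma> p) = size p"
  by (induction p arbitrary: \<sigma>) auto

lemma fvt_psubstt: "fvt (psubstt \<sigma> t) = (\<Union>i\<in>fvt t. fvt (\<sigma> i))"
  by (induction t) auto

lemma fvt_liftt: "fvt (liftt t 0) = Suc ` fvt t"
  by (induction t) auto

lemma fv_psubst: "fv (psubst \<sigma> p) = (\<Union>i\<in>fv p. fvt (\<sigma> i))"
proof (induction p arbitrary: \<sigma>)
  case (Forall p)
  have "Suc i \<in> fvt (up \<sigma> j) \<longleftrightarrow> (\<exists>k. j = Suc k \<and> i \<in> fvt (\<sigma> k))" for i j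
    by (auto simp: up_def fvt_liftt split: nat.split)
  then show ?case by (auto simp: Forall.IH)
next
  case (Exists p)
  have "Suc i \<in> fvt (up \<sigma> j) \<longleftrightarrow> (\<exists>k. j = Suc k \<and> i \<in> fvt (\<sigma> k))" for i j
    by (auto simp: up_def fvt_liftt split: nat.split)
  then show ?case by (auto simp: Exists.IH)
qed (auto simp: fvt_psubstt)

lemma finite_fvt [simp]: "finite (fvt t)"
  by (induction t) auto

lemma finite_fv [simp]: "finite (fv p)"
proof (induction p)
  case (Forall p)
  have "{i. Suc i \<in> fv p} = Suc -` fv p" by auto
  then show ?case using Forall by (simp add: finite_vimageI)
next
  case (Exists p)
  have "{i. Suc i \<in> fv p} = Suc -` fv p" by auto
  then show ?case using Exists by (simp add: finite_vimageI)
qed auto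

lemma fvt_num [simp]: "fvt (num n) = {}"
  by (induction n) (auto simp: num_def)

text \<open>Axioms of \<open>T\<close> are sentences, hence fixed by \<open>\<sigma>\<close>, and
  each logical schema is closed under substitution. The lemma serves to rename the fresh variable of
  a Henkin witness.\<close>

lemma prv_psubst:
  assumes "\<forall>p\<in>T. sentence p" and "T \<turnstile> p"
  shows "T \<turnstile> psubst \<sigma> p"
  using assms(2)
proof (induction arbitrary: \<sigma>)
  case (Ax p)
  then show ?case using assms(1) by (simp add: psubst_sentence prv.Ax)
next
  case (MP p q)
  have "T \<turnstile> Imp (psubst \<sigma> p) (psubst \<sigma> q)" using MP.IH(1)[of \<sigma>] by simp
  then show ?case by (rule prv.MP) (rule MP.IH)
next
  case (EqSubst s t p)
  then show ?case by (simp add: psubst_subst prv.EqSubst)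
qed (simp_all add: psubst_subst psubst_lift prv.intros(3-18))

section \<open>Semantics\<close>

text \<open>All models needed are countably infinite, so their domain can be taken to be the type of
  natural numbers; the order and the operations are arbitrary.\<close>

datatype model = Model (zr: nat) (su: "nat \<Rightarrow> nat") (ad: "nat \<Rightarrow> nat \<Rightarrow> nat") (mu: "nat \<Rightarrow> nat \<Rightarrow> nat")
  (ls: "nat \<Rightarrow> nat \<Rightarrow> bool")

primrec evt :: "model \<Rightarrow> (nat \<Rightarrow> nat) \<Rightarrow> tm \<Rightarrow> nat" where
  "evt M e (Var i) = e i"
| "evt M e Zero = zr M"
| "evt M e (Succ t) = su M (evt M e t)"
| "evt M e (Add s t) = ad M (evt M e s) (evt M e t)"
| "evt M e (Mult s t) = mu M (evt M e s) (evt M e t)"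

primrec sat :: "model \<Rightarrow> (nat \<Rightarrow> nat) \<Rightarrow> fm \<Rightarrow> bool" where
  "sat M e (Eq s t) = (evt M e s = evt M e t)"
| "sat M e (Less s t) = ls M (evt M e s) (evt M e t)"
| "sat M e (Neg p) = (\<not> sat M e p)"
| "sat M e (And p q) = (sat M e p \<and> sat M e q)"
| "sat M e (Or p q) = (sat M e p \<or> sat M e q)"
| "sat M e (Imp p q) = (sat M e p \<longrightarrow> sat M e q)"
| "sat M e (Forall p) = (\<forall>x. sat M (case_nat x e) p)"
| "sat M e (Exists p) = (\<exists>x. sat M (case_nat x e) p)"

definition models :: "model \<Rightarrow> fm set \<Rightarrow> bool" where
  "models M T \<longleftrightarrow> (\<forall>p\<in>T. \<forall>e. sat M e p)"

lemma evt_cong: "(\<And>i. i \<in> fvt t \<Longrightarrow> e i = e' i) \<Longrightarrow> evt M e t = evt M e' t"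
  by (induction t) auto

lemma sat_cong: "(\<And>i. i \<in> fv p \<Longrightarrow> e i = e' i) \<Longrightarrow> sat M e p = sat M e' p"
proof (induction p arbitrary: e e')
  case (Forall p)
  have "sat M (case_nat x e) p = sat M (case_nat x e') p" for x
    by (rule Forall.IH) (use Forall.prems in \<open>auto split: nat.split\<close>)
  then show ?case by simp
next
  case (Exists p)
  have "sat M (case_nat x e) p = sat M (case_nat x e') p" for x
    by (rule Exists.IH) (use Exists.prems in \<open>auto split: nat.split\<close>)
  then show ?case by simp
next
  case (Neg p)
  show ?case using Neg.IH[of e e'] Neg.prems by simp
next
  case (And p q)
  show ?case using And.IH[of e e'] And.prems by simp
next
  case (Or p q)
  show ?case using Or.IH[of e e'] Or.prems by simp
next
  case (Imp p q)
  show ?case using Imp.IH[of e e'] Imp.prems by simp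
next
  case (Eq s t)
  then show ?case using evt_cong[of s e e'] evt_cong[of t e e'] by simp
next
  case (Less s t)
  then show ?case using evt_cong[of s e e'] evt_cong[of t e e'] by simp
qed

lemma sat_sentence: "sentence p \<Longrightarrow> sat M e p = sat M e' p"
  by (rule sat_cong) (simp add: sentence_def)

lemma evt_psubstt: "evt M e (psubstt \<sigma> t) = evt M (\<lambda>i. evt M e (\<sigma> i)) t"
  by (induction t) auto

lemma evt_liftt: "evt M (case_nat x e) (liftt t 0) = evt M e t"
  by (induction t) auto

lemma sat_psubst: "sat M e (psubst \<sigma> p) = sat M (\<lambda>i. evt M e (\<sigma> i)) p"
proof (induction p arbitrary: e \<sigma>)
  case (Forall p)
  have "(\<lambda>i. evt M (case_nat x e) (up \<sigma> i)) = case_nat x (\<lambda>i. evt M e (\<sigma> i))" for x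
    by (rule ext) (simp add: up_def evt_liftt split: nat.split)
  then show ?case by (simp add: Forall.IH)
next
  case (Exists p)
  have "(\<lambda>i. evt M (case_nat x e) (up \<sigma> i)) = case_nat x (\<lambda>i. evt M e (\<sigma> i))" for x
    by (rule ext) (simp add: up_def evt_liftt split: nat.split)
  then show ?case by (simp add: Exists.IH)
qed (auto simp: evt_psubstt)

lemma sat_subst: "sat M e (subst p t 0) = sat M (case_nat (evt M e t) e) p"
proof -
  have "(\<lambda>i. evt M e (subst_map t 0 i)) = case_nat (evt M e t) e"
    by (rule ext) (simp add: subst_map_def split: nat.split)
  then show ?thesis by (simp add: subst_eq sat_psubst)
qed

lemma sat_lift: "sat M (case_nat x e) (lift p 0) = sat M e p"
  by (simp add: lift_eq sat_psubst lift_map_def)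

lemma soundness:
  assumes "T \<turnstile> p" and "models M T"
  shows "sat M e p"
  using assms(1)
  by (induction arbitrary: e) (use assms(2) in \<open>auto simp: sat_subst sat_lift models_def\<close>)

section \<open>The completeness theorem\<close>

text \<open>Derivability from hypotheses whose free variables are treated as constants.\<close>

inductive ded :: "fm set \<Rightarrow> fm set \<Rightarrow> fm \<Rightarrow> bool" for T \<Gamma> where
  base: "T \<turnstile> p \<Longrightarrow> ded T \<Gamma> p"
| hyp: "p \<in> \<Gamma> \<Longrightarrow> ded T \<Gamma> p"
| mp: "ded T \<Gamma> (Imp p q) \<Longrightarrow> ded T \<Gamma> p \<Longrightarrow> ded T \<Gamma> q"

lemma ded_mono: "ded T \<Gamma> p \<Longrightarrow> \<Gamma> \<subseteq> \<Delta> \<Longrightarrow> ded T \<Delta> p"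
  by (induction rule: ded.induct) (auto intro: ded.intros)

lemma ded_Imp_refl: "ded T \<Gamma> (Imp p p)"
  using ded.mp[OF ded.mp[OF ded.base[OF prv.ImpS] ded.base[OF prv.ImpK]] ded.base[OF prv.ImpK]] .

lemma ded_weaken: "ded T \<Gamma> p \<Longrightarrow> ded T \<Gamma> (Imp q p)"
  using ded.mp[OF ded.base[OF prv.ImpK]] .

lemma deduction: "ded T (insert q \<Gamma>) p \<Longrightarrow> ded T \<Gamma> (Imp q p)"
proof (induction rule: ded.induct)
  case (base p)
  then show ?case by (intro ded_weaken ded.base)
next
  case (hyp p)
  then show ?case by (auto intro: ded_weaken ded.hyp ded_Imp_refl)
next
  case (mp p r)
  show ?case by (rule ded.mp[OF ded.mp[OF ded.base[OF prv.ImpS] mp.IH(1)] mp.IH(2)])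
qed

lemma ded_finite: "ded T \<Gamma> p \<Longrightarrow> \<exists>F\<subseteq>\<Gamma>. finite F \<and> ded T F p"
proof (induction rule: ded.induct)
  case (base p)
  then show ?case using ded.base by blast
next
  case (hyp p)
  then show ?case by (intro exI[of _ "{p}"]) (auto intro: ded.hyp)
next
  case (mp p q)
  then obtain F G where "F \<subseteq> \<Gamma>" "finite F" "ded T F (Imp p q)" "G \<subseteq> \<Gamma>" "finite G" "ded T G p"
    by blast
  then show ?case
    by (intro exI[of _ "F \<union> G"]) (auto intro: ded.mp ded_mono)
qed

lemma ded_empty: "ded T {} p \<Longrightarrow> T \<turnstile> p"
  by (induction rule: ded.induct) (auto intro: prv.MP)

definition Ff :: fm where "Ff = Neg (Eq Zero Zero)"

definition con :: "fm set \<Rightarrow> fm set \<Rightarrow> bool" where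
  "con T \<Gamma> \<longleftrightarrow> \<not> ded T \<Gamma> Ff"

lemma ded_NegI: "ded T \<Gamma> (Imp p q) \<Longrightarrow> ded T \<Gamma> (Imp p (Neg q)) \<Longrightarrow> ded T \<Gamma> (Neg p)"
  by (rule ded.mp[OF ded.mp[OF ded.base[OF prv.NegI]]])

lemma ded_ex_falso:
  assumes "ded T \<Gamma> p" "ded T \<Gamma> (Neg p)"
  shows "ded T \<Gamma> q"
proof -
  have "ded T \<Gamma> (Neg (Neg q))" using assms[THEN ded_weaken] by (rule ded_NegI)
  then show ?thesis by (rule ded.mp[OF ded.base[OF prv.NegE]])
qed

lemma ded_Ff: "ded T \<Gamma> Ff \<Longrightarrow> ded T \<Gamma> q"
  using ded_ex_falso[OF ded.base[OF prv.EqRefl]] by (simp add: Ff_def)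

lemma ded_Neg: "ded T (insert p \<Gamma>) Ff \<Longrightarrow> ded T \<Gamma> (Neg p)"
  by (rule ded_NegI[of _ _ _ Ff]) (auto intro: deduction ded_Ff)

lemma ded_contr: "ded T (insert (Neg p) \<Gamma>) Ff \<Longrightarrow> ded T \<Gamma> p"
  by (rule ded.mp[OF ded.base[OF prv.NegE]]) (rule ded_Neg)

lemma ded_Forall_Var: "ded T \<Gamma> (lift (Forall p) 0) \<Longrightarrow> ded T \<Gamma> p"
  using ded.mp[OF ded.base[OF prv.ForallE[of T "lift p (Suc 0)" "Var 0"]], of \<Gamma>] by simp

lemma ded_Forall_mp: "T \<turnstile> Imp (And (Forall (Imp p q)) (Forall p)) (Forall q)"
proof -
  let ?c = "And (Forall (Imp p q)) (Forall p)"
  let ?G = "{lift ?c 0}"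
  have c: "ded T ?G (And (lift (Forall (Imp p q)) 0) (lift (Forall p) 0))" by (auto intro: ded.hyp)
  have "ded T ?G (lift (Forall (Imp p q)) 0)" "ded T ?G (lift (Forall p) 0)"
    using ded.mp[OF ded.base[OF prv.AndE1] c] ded.mp[OF ded.base[OF prv.AndE2] c] by auto
  then have "ded T ?G (Imp p q)" "ded T ?G p"
    using ded_Forall_Var by blast+
  then have "ded T ?G q" by (rule ded.mp)
  then have "T \<turnstile> Imp (lift ?c 0) q" by (intro ded_empty deduction)
  then show ?thesis by (intro prv.MP[OF prv.ForallI] prv.Gen)
qed

text \<open>Variable 0 does not occur in lifted hypotheses. A hypothesis \<open>lift q 0\<close> is
  handled by the theorem \<open>Imp q (Forall (lift q 0))\<close>, modus ponens by distributing
  \<open>Forall\<close> over \<open>Imp\<close>.\<close>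

lemma ded_gen: "ded T ((\<lambda>p. lift p 0) ` \<Gamma>) p \<Longrightarrow> ded T \<Gamma> (Forall p)"
proof (induction rule: ded.induct)
  case (base p)
  then show ?case by (intro ded.base prv.Gen)
next
  case (hyp p)
  then obtain q where q: "q \<in> \<Gamma>" "p = lift q 0" by blast
  have "T \<turnstile> Forall (Imp (lift q 0) (lift q 0))"
    by (intro prv.Gen ded_empty ded_Imp_refl)
  then have "T \<turnstile> Imp q (Forall p)" unfolding q by (rule prv.MP[OF prv.ForallI])
  then show ?case by (rule ded.mp[OF ded.base]) (rule ded.hyp[OF q(1)])
next
  case (mp p q)
  show ?case
    by (rule ded.mp[OF ded.base[OF ded_Forall_mp] ded.mp[OF ded.mp[OF ded.base[OF prv.AndI] mp.IH(1)] mp.IH(2)]])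
qed

lemma ded_psubst:
  assumes "\<forall>p\<in>T. sentence p" "ded T \<Gamma> p"
  shows "ded T (psubst \<sigma> ` \<Gamma>) (psubst \<sigma> p)"
  using assms(2)
proof (induction rule: ded.induct)
  case (base p)
  then show ?case using assms(1) by (intro ded.base prv_psubst)
next
  case (hyp p)
  then show ?case by (intro ded.hyp) auto
next
  case (mp p q)
  show ?case by (rule ded.mp[OF mp.IH[simplified]])
qed

text \<open>A fresh free variable serves as Henkin constant, so the language need not be
  extended.\<close>

lemma con_witness:
  assumes T: "\<forall>p\<in>T. sentence p" and con: "con T \<Gamma>" and ex: "Exists r \<in> \<Gamma>"
    and y: "\<And>p. p \<in> \<Gamma> \<Longrightarrow> y \<notin> fv p"
  shows "con T (insert (subst r (Var y) 0) \<Gamma>)"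
proof (rule ccontr)
  \<comment> \<open>On formulas without \<open>y\<close> this map is lifting, and it sends the
    instance of \<open>r\<close> at \<open>y\<close> back to \<open>r\<close>; an inconsistency can
    then be generalized over variable 0.\<close>
  let ?\<sigma> = "\<lambda>i. if i = y then Var 0 else Var (Suc i)"
  assume "\<not> ?thesis"
  then have "ded T \<Gamma> (Imp (subst r (Var y) 0) Ff)" by (simp add: con_def deduction)
  then have "ded T (psubst ?\<sigma> ` \<Gamma>) (psubst ?\<sigma> (Imp (subst r (Var y) 0) Ff))"
    by (rule ded_psubst[OF T])
  moreover have "psubst ?\<sigma> p = lift p 0" if "p \<in> \<Gamma>" for p
    unfolding lift_eq by (rule psubst_cong) (use y[OF that] in \<open>auto simp: lift_map_def\<close>)
  then have "psubst ?\<sigma> ` \<Gamma> = (\<lambda>p. lift p 0) ` \<Gamma>" by auto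
  moreover have "psubst ?\<sigma> (subst r (Var y) 0) = psubst Var r"
    unfolding subst_eq psubst_psubst
    by (rule psubst_cong) (use y[OF ex] in \<open>auto simp: subst_map_def gr0_conv_Suc\<close>)
  ultimately have "ded T ((\<lambda>p. lift p 0) ` \<Gamma>) (Imp r (lift Ff 0))"
    by (simp add: Ff_def)
  then have "ded T \<Gamma> (Forall (Imp r (lift Ff 0)))" by (rule ded_gen)
  then have "ded T \<Gamma> Ff"
    by (rule ded.mp[OF ded.mp[OF ded.base[OF prv.ExistsE]] ded.hyp[OF ex]])
  then show False using con by (simp add: con_def)
qed

definition henkin :: "fm set \<Rightarrow> fm set \<Rightarrow> bool" where
  "henkin T \<Gamma> \<longleftrightarrow> (\<forall>p. ded T \<Gamma> p \<longrightarrow> p \<in> \<Gamma>) \<and> (\<forall>p. Neg p \<in> \<Gamma> \<longleftrightarrow> p \<notin> \<Gamma>) \<and>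
    (\<forall>r. Exists r \<in> \<Gamma> \<longrightarrow> (\<exists>t. subst r t 0 \<in> \<Gamma>))"

definition fresh :: "fm set \<Rightarrow> nat" where
  "fresh \<Gamma> = (SOME y. \<forall>p\<in>\<Gamma>. y \<notin> fv p)"

definition hstep :: "fm set \<Rightarrow> fm set \<Rightarrow> fm \<Rightarrow> fm set" where
  "hstep T \<Gamma> q = (if con T (insert q \<Gamma>) then insert q \<Gamma> \<union>
      {subst r (Var (fresh (insert q \<Gamma>))) 0 | r. q = Exists r} else \<Gamma>)"

lemma fresh: "finite \<Gamma> \<Longrightarrow> p \<in> \<Gamma> \<Longrightarrow> fresh \<Gamma> \<notin> fv p"
proof -
  assume fin: "finite \<Gamma>" and p: "p \<in> \<Gamma>"
  then have "finite (\<Union>(fv ` \<Gamma>))" by simp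
  then obtain y where "y \<notin> \<Union>(fv ` \<Gamma>)" using ex_new_if_finite[OF infinite_UNIV_nat] by blast
  then have "\<exists>y. \<forall>p\<in>\<Gamma>. y \<notin> fv p" by blast
  then have "\<forall>p\<in>\<Gamma>. fresh \<Gamma> \<notin> fv p" unfolding fresh_def by (rule someI_ex)
  then show ?thesis using p by blast
qed

lemma hstep:
  assumes T: "\<forall>p\<in>T. sentence p" and fin: "finite \<Gamma>" and con: "con T \<Gamma>"
  shows "finite (hstep T \<Gamma> q)" "con T (hstep T \<Gamma> q)" "\<Gamma> \<subseteq> hstep T \<Gamma> q"
    "q \<in> hstep T \<Gamma> q \<or> ded T \<Gamma> (Neg q)"
proof -
  have S: "{subst r (Var y) 0 | r. q = Exists r} = (case q of Exists r \<Rightarrow> {subst r (Var y) 0} | _ \<Rightarrow> {})"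
    for y by (auto split: fm.splits)
  show "finite (hstep T \<Gamma> q)" using fin by (auto simp: hstep_def S split: fm.splits)
  show "\<Gamma> \<subseteq> hstep T \<Gamma> q" by (auto simp: hstep_def)
  show "q \<in> hstep T \<Gamma> q \<or> ded T \<Gamma> (Neg q)"
    by (auto simp: hstep_def con_def intro: ded_Neg)
  show "con T (hstep T \<Gamma> q)"
  proof (cases "con T (insert q \<Gamma>) \<and> (\<exists>r. q = Exists r)")
    case True
    then obtain r where r: "q = Exists r" by blast
    have "con T (insert (subst r (Var (fresh (insert q \<Gamma>))) 0) (insert q \<Gamma>))"
      by (rule con_witness[OF T]) (use True r fin in \<open>auto simp: fresh\<close>)
    then show ?thesis using True r by (simp add: hstep_def insert_commute)
  next
    case False
    then show ?thesis using con by (auto simp: hstep_def S split: fm.splits)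
  qed
qed

lemma henkin_exists:
  assumes T: "\<forall>p\<in>T. sentence p" and fin: "finite \<Gamma>0" and con: "con T \<Gamma>0"
  obtains \<Gamma> where "\<Gamma>0 \<subseteq> \<Gamma>" "henkin T \<Gamma>"
proof -
  \<comment> \<open>The formula \<open>q\<close> is treated at step \<open>gn q\<close>. At a number
    that is no code, \<open>inv gn\<close> gives some formula, which does no harm.\<close>
  define G where "G = rec_nat \<Gamma>0 (\<lambda>n \<Gamma>. hstep T \<Gamma> (inv gn n))"
  have G0: "G 0 = \<Gamma>0" and GS: "G (Suc n) = hstep T (G n) (inv gn n)" for n
    by (simp_all add: G_def)
  have inv: "finite (G n) \<and> con T (G n)" for n
    by (induction n) (use fin con hstep[OF T] in \<open>auto simp: G0 GS\<close>)
  have sub: "G n \<subseteq> G (Suc n)" for n using hstep(3)[OF T] inv by (simp add: GS)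
  have mono: "m \<le> n \<Longrightarrow> G m \<subseteq> G n" for m n using sub by (rule lift_Suc_mono_le)
  define \<Gamma> where "\<Gamma> = (\<Union>n. G n)"
  have dedG: "\<exists>n. ded T (G n) p" if d: "ded T \<Gamma> p" for p
  proof -
    obtain F where F: "F \<subseteq> \<Gamma>" "finite F" "ded T F p" using ded_finite[OF d] by blast
    from F(2,1) have "\<exists>n. F \<subseteq> G n"
    proof (induction rule: finite_induct)
      case (insert x F)
      then obtain m n where "F \<subseteq> G m" "x \<in> G n" by (auto simp: \<Gamma>_def)
      then have "insert x F \<subseteq> G (max m n)" using mono[of m "max m n"] mono[of n "max m n"] by auto
      then show ?case by blast
    qed simp
    then show ?thesis using F ded_mono by blast
  qed
  have conG: "\<not> ded T \<Gamma> Ff" using dedG inv by (auto simp: con_def)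
  have decide: "q \<in> \<Gamma> \<or> ded T \<Gamma> (Neg q)" for q
  proof -
    have "inv gn (gn q) = q" by (rule inv_f_f) (simp add: inj_def gn_inject)
    then have "q \<in> G (Suc (gn q)) \<or> ded T (G (gn q)) (Neg q)"
      using hstep(4)[OF T, of "G (gn q)" q] inv by (simp add: GS)
    then show ?thesis by (auto simp: \<Gamma>_def intro: ded_mono)
  qed
  have closed: "p \<in> \<Gamma>" if "ded T \<Gamma> p" for p
    using decide[of p] that conG ded_ex_falso by blast
  have "Neg p \<in> \<Gamma> \<longleftrightarrow> p \<notin> \<Gamma>" for p
    using decide[of p] closed conG ded_ex_falso ded.hyp by blast
  moreover have "\<exists>t. subst r t 0 \<in> \<Gamma>" if ex: "Exists r \<in> \<Gamma>" for r
  proof -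
    let ?q = "Exists r"
    have q: "inv gn (gn ?q) = ?q" by (rule inv_f_f) (simp add: inj_def gn_inject)
    have "insert ?q (G (gn ?q)) \<subseteq> \<Gamma>" using ex by (auto simp: \<Gamma>_def)
    then have "con T (insert ?q (G (gn ?q)))" using conG ded_mono by (auto simp: con_def)
    then have "subst r (Var (fresh (insert ?q (G (gn ?q))))) 0 \<in> G (Suc (gn ?q))"
      unfolding GS q by (auto simp: hstep_def)
    then show ?thesis by (auto simp: \<Gamma>_def)
  qed
  ultimately have "henkin T \<Gamma>" using closed by (simp add: henkin_def)
  moreover have "\<Gamma>0 \<subseteq> \<Gamma>" using G0 by (auto simp: \<Gamma>_def)
  ultimately show ?thesis using that by blast
qed

section \<open>The term model of a Henkin set\<close>

locale henkin_set =
  fixes T \<Gamma> :: "fm set"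
  assumes henkin: "henkin T \<Gamma>" and PA: "\<And>p. p \<in> PA \<Longrightarrow> T \<turnstile> p"
begin

lemma closed: "ded T \<Gamma> p \<Longrightarrow> p \<in> \<Gamma>"
  using henkin by (simp add: henkin_def)

lemma thm_mem: "T \<turnstile> p \<Longrightarrow> p \<in> \<Gamma>"
  by (intro closed ded.base)

lemma mp_mem: "Imp p q \<in> \<Gamma> \<Longrightarrow> p \<in> \<Gamma> \<Longrightarrow> q \<in> \<Gamma>"
  by (rule closed[OF ded.mp[OF ded.hyp ded.hyp]])

lemma Neg_mem: "Neg p \<in> \<Gamma> \<longleftrightarrow> p \<notin> \<Gamma>"
  using henkin by (simp add: henkin_def)

lemma Imp_mem: "Imp p q \<in> \<Gamma> \<longleftrightarrow> (p \<in> \<Gamma> \<longrightarrow> q \<in> \<Gamma>)"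
proof
  assume "p \<in> \<Gamma> \<longrightarrow> q \<in> \<Gamma>"
  then consider "q \<in> \<Gamma>" | "Neg p \<in> \<Gamma>" using Neg_mem[of p] by auto
  then show "Imp p q \<in> \<Gamma>"
  proof cases
    case 1
    then show ?thesis using closed[OF ded_weaken[OF ded.hyp]] by blast
  next
    case 2
    then have "ded T (insert p \<Gamma>) q" by (auto intro: ded_ex_falso[OF ded.hyp[of p] ded.hyp])
    then show ?thesis by (rule closed[OF deduction])
  qed
qed (use mp_mem in blast)

lemma And_mem: "And p q \<in> \<Gamma> \<longleftrightarrow> p \<in> \<Gamma> \<and> q \<in> \<Gamma>"
  using thm_mem[OF prv.AndI[of T p q]] thm_mem[OF prv.AndE1[of T p q]] thm_mem[OF prv.AndE2[of T p q]]
  by (auto simp: Imp_mem)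

lemma Or_mem: "Or p q \<in> \<Gamma> \<longleftrightarrow> p \<in> \<Gamma> \<or> q \<in> \<Gamma>"
proof
  assume *: "Or p q \<in> \<Gamma>"
  have "Imp (Imp p Ff) (Imp (Imp q Ff) (Imp (Or p q) Ff)) \<in> \<Gamma>" by (rule thm_mem[OF prv.OrE])
  moreover have "Ff \<notin> \<Gamma>" using thm_mem[OF prv.EqRefl] Neg_mem by (auto simp: Ff_def)
  ultimately show "p \<in> \<Gamma> \<or> q \<in> \<Gamma>" using * by (auto simp: Imp_mem)
qed (use thm_mem[OF prv.OrI1[of T p q]] thm_mem[OF prv.OrI2[of T q p]] in \<open>auto simp: Imp_mem\<close>)

lemma Exists_mem: "Exists p \<in> \<Gamma> \<longleftrightarrow> (\<exists>t. subst p t 0 \<in> \<Gamma>)"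
  using henkin thm_mem[OF prv.ExistsI[of T p]] by (auto simp: henkin_def Imp_mem)

text \<open>\<open>henkin\<close> has a witness condition for \<open>Exists\<close> only; the case
  of \<open>Forall\<close> is reduced to it by deriving
  \<open>Imp (Neg (Exists (Neg p))) (Forall p)\<close>.\<close>

lemma Forall_mem: "Forall p \<in> \<Gamma> \<longleftrightarrow> (\<forall>t. subst p t 0 \<in> \<Gamma>)"
proof
  assume all: "\<forall>t. subst p t 0 \<in> \<Gamma>"
  have "T \<turnstile> Imp (subst (lift (Neg p) (Suc 0)) (Var 0) 0) (lift (Exists (Neg p)) 0)"
    using prv.ExistsI[of T "lift (Neg p) (Suc 0)" "Var 0"] by simp
  then have "T \<turnstile> Imp (Neg p) (lift (Exists (Neg p)) 0)" by (simp only: subst_lift_Suc_Var)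
  then have "ded T {Neg p, lift (Neg (Exists (Neg p))) 0} (lift (Exists (Neg p)) 0)"
    by (rule ded.mp[OF ded.base ded.hyp]) simp
  moreover have "ded T {Neg p, lift (Neg (Exists (Neg p))) 0} (Neg (lift (Exists (Neg p)) 0))"
    by (rule ded.hyp) simp
  ultimately have "ded T {lift (Neg (Exists (Neg p))) 0} p"
    by (rule ded_contr[OF ded_ex_falso])
  then have "T \<turnstile> Imp (lift (Neg (Exists (Neg p))) 0) p" by (intro ded_empty deduction)
  then have "T \<turnstile> Imp (Neg (Exists (Neg p))) (Forall p)" by (intro prv.MP[OF prv.ForallI] prv.Gen)
  then have "Neg (Exists (Neg p)) \<in> \<Gamma> \<longrightarrow> Forall p \<in> \<Gamma>" by (auto dest: thm_mem simp: Imp_mem)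
  then show "Forall p \<in> \<Gamma>" using all by (auto simp: Neg_mem Exists_mem)
qed (use thm_mem[OF prv.ForallE[of T p]] in \<open>auto simp: Imp_mem\<close>)

lemma Eq_mem_subst: "Eq s t \<in> \<Gamma> \<Longrightarrow> subst p s 0 \<in> \<Gamma> \<Longrightarrow> subst p t 0 \<in> \<Gamma>"
  using thm_mem[OF prv.EqSubst[of T s t p]] by (simp add: Imp_mem)

lemma Eq_refl_mem: "Eq t t \<in> \<Gamma>"
  by (rule thm_mem[OF prv.EqRefl])

lemma Eq_sym_mem: "Eq s t \<in> \<Gamma> \<Longrightarrow> Eq t s \<in> \<Gamma>"
  using Eq_mem_subst[of s t "Eq (Var 0) (liftt s 0)"] Eq_refl_mem by simp

lemma Eq_trans_mem: "Eq s t \<in> \<Gamma> \<Longrightarrow> Eq t u \<in> \<Gamma> \<Longrightarrow> Eq s u \<in> \<Gamma>"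
  using Eq_mem_subst[of t u "Eq (liftt s 0) (Var 0)"] by simp

lemma Succ_cong_mem: "Eq s t \<in> \<Gamma> \<Longrightarrow> Eq (Succ s) (Succ t) \<in> \<Gamma>"
  using Eq_mem_subst[of s t "Eq (Succ (liftt s 0)) (Succ (Var 0))"] Eq_refl_mem by simp

lemma Add_cong_mem: "Eq s s' \<in> \<Gamma> \<Longrightarrow> Eq t t' \<in> \<Gamma> \<Longrightarrow> Eq (Add s t) (Add s' t') \<in> \<Gamma>"
  using Eq_mem_subst[of s s' "Eq (Add (liftt s 0) (liftt t 0)) (Add (Var 0) (liftt t 0))"]
    Eq_mem_subst[of t t' "Eq (Add (liftt s 0) (liftt t 0)) (Add (liftt s' 0) (Var 0))"] Eq_refl_mem
  by simp

lemma Mult_cong_mem: "Eq s s' \<in> \<Gamma> \<Longrightarrow> Eq t t' \<in> \<Gamma> \<Longrightarrow> Eq (Mult s t) (Mult s' t') \<in> \<Gamma>"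
  using Eq_mem_subst[of s s' "Eq (Mult (liftt s 0) (liftt t 0)) (Mult (Var 0) (liftt t 0))"]
    Eq_mem_subst[of t t' "Eq (Mult (liftt s 0) (liftt t 0)) (Mult (liftt s' 0) (Var 0))"] Eq_refl_mem
  by simp

lemma Less_cong_mem: "Eq s s' \<in> \<Gamma> \<Longrightarrow> Eq t t' \<in> \<Gamma> \<Longrightarrow> Less s t \<in> \<Gamma> \<Longrightarrow> Less s' t' \<in> \<Gamma>"
  using Eq_mem_subst[of s s' "Less (Var 0) (liftt t 0)"]
    Eq_mem_subst[of t t' "Less (liftt s' 0) (Var 0)"] by simp

text \<open>Distinctness of the numerals makes the set of classes of terms infinite; this is where
  the axioms of PA enter the completeness proof.\<close>

lemma num_mem: "Eq (num m) (num n) \<in> \<Gamma> \<longleftrightarrow> m = n"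
proof
  have inj: "Eq s t \<in> \<Gamma>" if "Eq (Succ s) (Succ t) \<in> \<Gamma>" for s t
  proof -
    have "Forall (Forall (Imp (Eq (Succ (Var 1)) (Succ (Var 0))) (Eq (Var 1) (Var 0)))) \<in> \<Gamma>"
      by (rule thm_mem[OF PA]) (simp add: PA_def)
    then have "subst (subst (Imp (Eq (Succ (Var 1)) (Succ (Var 0))) (Eq (Var 1) (Var 0))) (liftt s 0) 1) t 0
      \<in> \<Gamma>" by (simp add: Forall_mem)
    then show ?thesis using that by (simp add: Imp_mem)
  qed
  have nz: "Eq (Succ s) Zero \<notin> \<Gamma>" for s
  proof -
    have "Forall (Neg (Eq (Succ (Var 0)) Zero)) \<in> \<Gamma>"
      by (rule thm_mem[OF PA]) (simp add: PA_def)
    then have "subst (Neg (Eq (Succ (Var 0)) Zero)) s 0 \<in> \<Gamma>" by (simp only: Forall_mem)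
    then show ?thesis by (simp add: Neg_mem)
  qed
  show "Eq (num m) (num n) \<in> \<Gamma> \<Longrightarrow> m = n"
  proof (induction m arbitrary: n)
    case 0
    then show ?case using nz Eq_sym_mem by (cases n) (auto simp: num_def)
  next
    case (Suc m)
    then show ?case using nz inj by (cases n) (auto simp: num_def)
  qed
qed (simp add: Eq_refl_mem)

text \<open>The quotient is countably infinite and can therefore be numbered by all of
  \<open>nat\<close>, the fixed domain of the type \<open>model\<close>.\<close>

lemma term_classes:
  obtains c :: "tm \<Rightarrow> nat" where "surj c" "\<And>s t. c s = c t \<longleftrightarrow> Eq s t \<in> \<Gamma>"
proof -
  define g where "g t = {u. Eq t u \<in> \<Gamma>}" for t
  have g: "g s = g t \<longleftrightarrow> Eq s t \<in> \<Gamma>" for s t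
    using Eq_refl_mem Eq_sym_mem Eq_trans_mem unfolding g_def by blast
  have "inj (\<lambda>n. g (num n))" by (simp add: inj_def g num_mem)
  then have "infinite (range (\<lambda>n. g (num n)))" by (simp add: finite_image_iff)
  moreover have "range (\<lambda>n. g (num n)) \<subseteq> range g" by auto
  ultimately have "infinite (range g)" using finite_subset by blast
  moreover have "countable (UNIV :: tm set)"
    by (rule countableI[of gnt]) (simp add: inj_on_def gnt_inject)
  ultimately obtain h :: "tm set \<Rightarrow> nat" where h: "bij_betw h (range g) UNIV"
    using countableE_infinite by (metis countable_image)
  have "surj (h \<circ> g)" using h by (auto simp: bij_betw_def image_comp)
  moreover have "(h \<circ> g) s = (h \<circ> g) t \<longleftrightarrow> Eq s t \<in> \<Gamma>" for s t
    using h g[of s t] by (auto simp: bij_betw_def inj_on_eq_iff)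
  ultimately show ?thesis using that by blast
qed

lemma term_model: "\<exists>M e. \<forall>p. sat M e p \<longleftrightarrow> p \<in> \<Gamma>"
proof -
  obtain c :: "tm \<Rightarrow> nat" where surj: "surj c" and c: "\<And>s t. c s = c t \<longleftrightarrow> Eq s t \<in> \<Gamma>"
    using term_classes by blast
  define r where "r = inv c"
  have cr: "c (r n) = n" for n using surj by (simp add: r_def surj_f_inv_f)
  have rc: "Eq (r (c t)) t \<in> \<Gamma>" for t using cr[of "c t"] c[of "r (c t)" t] by simp
  define M where "M = Model (c Zero) (\<lambda>n. c (Succ (r n))) (\<lambda>m n. c (Add (r m) (r n)))
    (\<lambda>m n. c (Mult (r m) (r n))) (\<lambda>m n. Less (r m) (r n) \<in> \<Gamma>)"
  define e where "e = (\<lambda>i. c (Var i))"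
  have ev: "evt M e t = c t" for t
    by (induction t) (simp_all add: M_def e_def c rc Succ_cong_mem Add_cong_mem Mult_cong_mem)
  have sub: "sat M (case_nat (c t) e) p = sat M e (subst p t 0)" for p t
    by (simp add: sat_subst ev)
  have ex: "(\<exists>x. sat M (case_nat x e) p) \<longleftrightarrow> (\<exists>t. sat M e (subst p t 0))" for p
  proof
    assume "\<exists>x. sat M (case_nat x e) p"
    then obtain x where "sat M (case_nat x e) p" ..
    then have "sat M e (subst p (r x) 0)" using sub[of "r x" p] by (simp add: cr)
    then show "\<exists>t. sat M e (subst p t 0)" ..
  qed (auto simp: sub[symmetric])
  have all: "(\<forall>x. sat M (case_nat x e) p) \<longleftrightarrow> (\<forall>t. sat M e (subst p t 0))" for p
    using ex[of "Neg p"] unfolding subst.simps sat.simps by meson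
  have "sat M e p \<longleftrightarrow> p \<in> \<Gamma>" for p
  \<comment> \<open>Instances of the body of a quantifier are not subformulas, but they have the
    same size as the body.\<close>
  proof (induction p rule: measure_induct_rule[of size])
    case (less p)
    have IH: "sat M e (subst q t 0) \<longleftrightarrow> subst q t 0 \<in> \<Gamma>" if "size q < size p" for q t
      using less that by (simp add: subst_eq)
    show ?case
    proof (cases p)
      case (Less s t)
      have "Less (r (c s)) (r (c t)) \<in> \<Gamma> \<longleftrightarrow> Less s t \<in> \<Gamma>"
        using Less_cong_mem[OF rc[of s] rc[of t]]
          Less_cong_mem[OF Eq_sym_mem[OF rc[of s]] Eq_sym_mem[OF rc[of t]]] by (rule iffI)
      then show ?thesis by (simp add: Less ev) (simp add: M_def)
    next
      case (Forall q)
      then show ?thesis using IH by (simp add: all Forall_mem)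
    next
      case (Exists q)
      then show ?thesis using IH by (simp add: ex Exists_mem)
    qed (use less in \<open>simp_all add: ev c Neg_mem And_mem Or_mem Imp_mem\<close>)
  qed
  then show ?thesis by blast
qed

end

theorem completeness:
  assumes T: "\<forall>p\<in>T. sentence p" and PA: "\<And>p. p \<in> PA \<Longrightarrow> T \<turnstile> p" and p: "\<not> T \<turnstile> p"
  obtains M e where "models M T" "\<not> sat M e p"
proof -
  have "con T {Neg p}" using p ded_empty[OF ded_contr] by (auto simp: con_def)
  then obtain \<Gamma> where \<Gamma>: "Neg p \<in> \<Gamma>" "henkin T \<Gamma>" using henkin_exists[OF T, of "{Neg p}"] by auto
  interpret henkin_set T \<Gamma> by unfold_locales (use \<Gamma> PA in auto)
  obtain M e where M: "\<And>q. sat M e q \<longleftrightarrow> q \<in> \<Gamma>" using term_model by blast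
  have "models M T"
    unfolding models_def
  proof (intro ballI allI)
    fix q e' assume q: "q \<in> T"
    then have "sat M e q" using M thm_mem[OF prv.Ax] by simp
    then show "sat M e' q" using T q sat_sentence[of q M e e'] by simp
  qed
  moreover have "\<not> sat M e p" using M \<Gamma> Neg_mem by simp
  ultimately show ?thesis using that by blast
qed

section \<open>Models of Peano arithmetic\<close>

definition NN :: model where
  "NN = Model 0 Suc (+) (*) (<)"

lemma NN_simps [simp]: "zr NN = 0" "su NN = Suc" "ad NN = (+)" "mu NN = (*)" "ls NN = (<)"
  by (simp_all add: NN_def)

definition nu :: "model \<Rightarrow> nat \<Rightarrow> nat" where
  "nu M n = (su M ^^ n) (zr M)"

lemma nu_0: "nu M 0 = zr M" and nu_Suc: "nu M (Suc n) = su M (nu M n)"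
  by (simp_all add: nu_def)

lemma nu_NN [simp]: "nu NN n = n"
  by (induction n) (simp_all add: nu_0 nu_Suc)

lemma evt_num [simp]: "evt M e (num n) = nu M n"
  by (induction n) (simp_all add: num_def nu_def)

lemma case_nat_eta: "case_nat (e 0) (\<lambda>i. e (Suc i)) = e"
  by (rule ext) (simp split: nat.split)

lemma sat_Forall_closure: "(\<forall>e. sat M e ((Forall ^^ n) p)) \<longleftrightarrow> (\<forall>e. sat M e p)"
proof (induction n arbitrary: p)
  case (Suc n)
  have "(\<forall>e. sat M e (Forall p)) \<longleftrightarrow> (\<forall>e. sat M e p)"
    by simp (metis case_nat_eta)
  then show ?case using Suc[of "Forall p"] by (simp only: funpow_Suc_right comp_apply)
qed simp

lemma fv_Forall_closure: "fv ((Forall ^^ n) p) = {i. i + n \<in> fv p}"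
  by (induction n) auto

lemma ind_closure_PA: "\<exists>n. (Forall ^^ n) (ind p) \<in> PA"
proof -
  obtain n where "\<forall>i\<in>fv (ind p). i < n" using finite_nat_set_iff_bounded[of "fv (ind p)"] by auto
  then have "sentence ((Forall ^^ n) (ind p))" by (auto simp: sentence_def fv_Forall_closure)
  then show ?thesis by (auto simp: PA_def)
qed

lemma sat_ind:
  "sat M e (ind p) \<longleftrightarrow> (sat M (case_nat (zr M) e) p \<and>
    (\<forall>x. sat M (case_nat x e) p \<longrightarrow> sat M (case_nat (su M x) e) p) \<longrightarrow> (\<forall>x. sat M (case_nat x e) p))"
proof -
  have "(\<lambda>i. evt M (case_nat y (case_nat x e)) (lift_map 1 i)) = case_nat y e" for x y
    by (rule ext) (simp add: lift_map_def split: nat.split)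
  then show ?thesis by (simp add: ind_def sat_subst lift_eq sat_psubst)
qed

lemma NN_models_PA: "models NN PA"
proof -
  have "sat NN e (ind p)" for e p
    unfolding sat_ind by (auto intro: nat_induct[of "\<lambda>x. sat NN (case_nat x e) p" for e])
  then have "sat NN e ((Forall ^^ n) (ind p))" for e n p using sat_Forall_closure by blast
  then show ?thesis by (auto simp: models_def PA_def Iff_def)
qed

locale pa_model =
  fixes M :: model
  assumes models_PA: "models M PA"
begin

lemma axiom: "p \<in> PA \<Longrightarrow> sat M e p"
  using models_PA by (simp add: models_def)

lemma su_neq_zr: "su M x \<noteq> zr M"
  using axiom[of "Forall (Neg (Eq (Succ (Var 0)) Zero))"] by (simp add: PA_def)

lemma ad_zr: "ad M x (zr M) = x"
  using axiom[of "Forall (Eq (Add (Var 0) Zero) (Var 0))"] by (simp add: PA_def)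

lemma ad_su: "ad M x (su M y) = su M (ad M x y)"
  using axiom[of "Forall (Forall (Eq (Add (Var 1) (Succ (Var 0))) (Succ (Add (Var 1) (Var 0)))))"]
  by (simp add: PA_def)

lemma mu_zr: "mu M x (zr M) = zr M"
  using axiom[of "Forall (Eq (Mult (Var 0) Zero) Zero)"] by (simp add: PA_def)

lemma mu_su: "mu M x (su M y) = ad M (mu M x y) x"
  using axiom[of "Forall (Forall (Eq (Mult (Var 1) (Succ (Var 0))) (Add (Mult (Var 1) (Var 0)) (Var 1))))"]
  by (simp add: PA_def)

lemma not_ls_zr: "\<not> ls M x (zr M)"
  using axiom[of "Forall (Neg (Less (Var 0) Zero))"] by (simp add: PA_def)

lemma ls_su: "ls M x (su M y) \<longleftrightarrow> ls M x y \<or> x = y"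
proof -
  let ?p = "Iff (Less (Var 1) (Succ (Var 0))) (Or (Less (Var 1) (Var 0)) (Eq (Var 1) (Var 0)))"
  have "sat M undefined (Forall (Forall ?p))" by (rule axiom) (simp add: PA_def)
  then have "sat M (case_nat y (case_nat x undefined)) ?p" unfolding sat.simps by blast
  then show ?thesis by (auto simp: Iff_def)
qed

text \<open>Parameters enter through the environment \<open>e\<close>.\<close>

definition definable :: "(nat \<Rightarrow> bool) \<Rightarrow> bool" where
  "definable P \<longleftrightarrow> (\<exists>p e. \<forall>x. P x \<longleftrightarrow> sat M (case_nat x e) p)"

lemma induction:
  assumes "definable P" "P (zr M)" "\<And>x. P x \<Longrightarrow> P (su M x)"
  shows "P x"
proof -
  obtain p e where p: "\<And>x. P x \<longleftrightarrow> sat M (case_nat x e) p" using assms(1) by (auto simp: definable_def)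
  obtain n where "(Forall ^^ n) (ind p) \<in> PA" using ind_closure_PA by blast
  then have "sat M e (ind p)" using sat_Forall_closure[of M n "ind p"] axiom by blast
  then have "P (zr M) \<and> (\<forall>x. P x \<longrightarrow> P (su M x)) \<longrightarrow> (\<forall>x. P x)" unfolding sat_ind p .
  then show ?thesis using assms(2,3) by blast
qed

lemma ls_trans: "ls M x y \<Longrightarrow> ls M y z \<Longrightarrow> ls M x z"
proof -
  have "\<forall>x y. ls M x y \<longrightarrow> ls M y z \<longrightarrow> ls M x z"
  proof (rule induction[of "\<lambda>z. \<forall>x y. ls M x y \<longrightarrow> ls M y z \<longrightarrow> ls M x z"])
    show "definable (\<lambda>z. \<forall>x y. ls M x y \<longrightarrow> ls M y z \<longrightarrow> ls M x z)"
      unfolding definable_def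
      by (rule exI[of _ "Forall (Forall (Imp (Less (Var 1) (Var 0))
        (Imp (Less (Var 0) (Var 2)) (Less (Var 1) (Var 2)))))"]) (simp add: numeral_2_eq_2)
    show "\<forall>x y. ls M x y \<longrightarrow> ls M y (su M z) \<longrightarrow> ls M x (su M z)"
      if "\<forall>x y. ls M x y \<longrightarrow> ls M y z \<longrightarrow> ls M x z" for z
      unfolding ls_su using that by blast
  qed (simp add: not_ls_zr)
  then show "ls M x y \<Longrightarrow> ls M y z \<Longrightarrow> ls M x z" by blast
qed

lemma zr_least: "x = zr M \<or> ls M (zr M) x"
proof (rule induction[of "\<lambda>x. x = zr M \<or> ls M (zr M) x"])
  show "definable (\<lambda>x. x = zr M \<or> ls M (zr M) x)"
    unfolding definable_def
    by (rule exI[of _ "Or (Eq (Var 0) Zero) (Less Zero (Var 0))"]) simp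
qed (auto simp: ls_su)

lemma su_le: "ls M y x \<Longrightarrow> ls M (su M y) x \<or> su M y = x"
proof -
  have "ls M y x \<longrightarrow> ls M (su M y) x \<or> su M y = x"
  proof (rule induction[of "\<lambda>x. ls M y x \<longrightarrow> ls M (su M y) x \<or> su M y = x"])
    show "definable (\<lambda>x. ls M y x \<longrightarrow> ls M (su M y) x \<or> su M y = x)"
      unfolding definable_def
      by (rule exI[of _ "Imp (Less (Var 1) (Var 0)) (Or (Less (Succ (Var 1)) (Var 0)) (Eq (Succ (Var 1)) (Var 0)))"],
          rule exI[of _ "\<lambda>_. y"]) simp
  qed (auto simp: not_ls_zr ls_su)
  then show "ls M y x \<Longrightarrow> ls M (su M y) x \<or> su M y = x" by blast
qed

lemma ls_linear: "ls M x y \<or> x = y \<or> ls M y x"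
proof (rule induction[of "\<lambda>y. ls M x y \<or> x = y \<or> ls M y x"])
  show "definable (\<lambda>y. ls M x y \<or> x = y \<or> ls M y x)"
    unfolding definable_def
    by (rule exI[of _ "Or (Less (Var 1) (Var 0)) (Or (Eq (Var 1) (Var 0)) (Less (Var 0) (Var 1)))"],
        rule exI[of _ "\<lambda>_. x"]) simp
  show "ls M x (zr M) \<or> x = zr M \<or> ls M (zr M) x" using zr_least by blast
  show "ls M x (su M y) \<or> x = su M y \<or> ls M (su M y) x" if "ls M x y \<or> x = y \<or> ls M y x" for y
    using that su_le[of y x] by (auto simp: ls_su)
qed

lemma ls_irrefl: "\<not> ls M x x"
proof (rule induction[of "\<lambda>x. \<not> ls M x x"])
  show "definable (\<lambda>x. \<not> ls M x x)"
    unfolding definable_def by (rule exI[of _ "Neg (Less (Var 0) (Var 0))"]) simp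
  show "\<not> ls M (su M x) (su M x)" if "\<not> ls M x x" for x
  proof
    assume "ls M (su M x) (su M x)"
    then have "ls M (su M x) x \<or> su M x = x" by (simp add: ls_su)
    moreover have "ls M x (su M x)" by (simp add: ls_su)
    ultimately show False using that ls_trans by metis
  qed
qed (rule not_ls_zr)

lemma least:
  assumes def: "definable P" and "P x"
  obtains y where "P y" "\<And>z. ls M z y \<Longrightarrow> \<not> P z"
proof (rule ccontr)
  note witness = that
  assume contr: "\<not> thesis"
  have no: "\<exists>z. ls M z y \<and> P z" if "P y" for y using witness[OF that] contr by blast
  obtain p e where p: "\<And>x. P x \<longleftrightarrow> sat M (case_nat x e) p" using def by (auto simp: definable_def)
  \<comment> \<open>Induction on the statement that \<open>P\<close> fails everywhere below
    \<open>y\<close>.\<close>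
  have "\<forall>z. ls M z y \<longrightarrow> \<not> P z" for y
  proof (rule induction[of "\<lambda>y. \<forall>z. ls M z y \<longrightarrow> \<not> P z"])
    have "(\<lambda>i. evt M (case_nat z (case_nat y e)) (lift_map 1 i)) = case_nat z e" for z y
      by (rule ext) (simp add: lift_map_def split: nat.split)
    then show "definable (\<lambda>y. \<forall>z. ls M z y \<longrightarrow> \<not> P z)"
      unfolding definable_def
      by (intro exI[of _ "Forall (Imp (Less (Var 0) (Var 1)) (Neg (lift p 1)))"] exI[of _ e])
        (simp add: lift_eq sat_psubst p)
  qed (use no in \<open>auto simp: not_ls_zr ls_su\<close>)
  then show False using no \<open>P x\<close> by blast
qed

section \<open>Standard elements and absoluteness of bounded formulas\<close>

lemma ls_nu: "ls M x (nu M n) \<longleftrightarrow> (\<exists>m<n. x = nu M m)"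
  by (induction n) (auto simp: nu_0 nu_Suc not_ls_zr ls_su less_Suc_eq)

lemma ls_nu_nu: "ls M (nu M m) (nu M n) \<longleftrightarrow> m < n"
proof
  assume "ls M (nu M m) (nu M n)"
  then show "m < n" using ls_nu ls_irrefl ls_trans by (metis linorder_neqE_nat)
qed (use ls_nu in blast)

lemma nu_inject: "nu M m = nu M n \<longleftrightarrow> m = n"
  using ls_nu_nu ls_irrefl by (metis linorder_neqE_nat)

lemma nu_add: "nu M (m + n) = ad M (nu M m) (nu M n)"
  by (induction n) (simp_all add: nu_0 nu_Suc ad_zr ad_su)

lemma nu_mult: "nu M (m * n) = mu M (nu M m) (nu M n)"
proof (induction n)
  case (Suc n)
  then show ?case using nu_add[of "m * n" m] by (simp add: nu_Suc mu_su add.commute)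
qed (simp add: nu_0 mu_zr)

lemma evt_nu: "evt M (\<lambda>i. nu M (e i)) t = nu M (evt NN e t)"
  by (induction t) (simp_all add: nu_0 nu_Suc nu_add nu_mult)

lemma case_nat_nu: "case_nat (nu M x) (\<lambda>i. nu M (e i)) = (\<lambda>i. nu M (case_nat x e i))"
  by (rule ext) (simp split: nat.split)

text \<open>A bound with standard arguments has a standard value, and below a standard element there
  are only standard ones (\<open>ls_nu\<close>); so both models quantify over the same
  range.\<close>

lemma delta0_absolute: "delta0 p \<Longrightarrow> sat M (\<lambda>i. nu M (e i)) p \<longleftrightarrow> sat NN e p"
proof (induction arbitrary: e rule: delta0.induct)
  case (7 p t)
  have "sat M (\<lambda>i. nu M (e i)) (Forall (Imp (Less (Var 0) (liftt t 0)) p)) \<longleftrightarrow>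
    (\<forall>x<evt NN e t. sat M (case_nat (nu M x) (\<lambda>i. nu M (e i))) p)"
    by (auto simp: evt_liftt evt_nu ls_nu)
  then show ?case by (simp add: evt_liftt case_nat_nu 7)
next
  case (8 p t)
  have "sat M (\<lambda>i. nu M (e i)) (Exists (And (Less (Var 0) (liftt t 0)) p)) \<longleftrightarrow>
    (\<exists>x<evt NN e t. sat M (case_nat (nu M x) (\<lambda>i. nu M (e i))) p)"
    by (auto simp: evt_liftt evt_nu ls_nu)
  then show ?case by (simp add: evt_liftt case_nat_nu 8)
qed (simp_all add: evt_nu nu_inject ls_nu_nu)

end

section \<open>Uniform bounded definability\<close>

definition Tm :: "nat \<Rightarrow> (model \<Rightarrow> (nat \<Rightarrow> nat) \<Rightarrow> nat) \<Rightarrow> bool" where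
  "Tm n F \<longleftrightarrow> (\<exists>t. fvt t \<subseteq> {..<n} \<and> (\<forall>M e. evt M e t = F M e))"

text \<open>One formula has to work in all models at once. This makes a fact about \<open>NN\<close>
  transferable to standard arguments in any model of PA, and it makes the least number principle
  applicable to \<open>P\<close> in each of them.\<close>

definition Del :: "nat \<Rightarrow> (model \<Rightarrow> (nat \<Rightarrow> nat) \<Rightarrow> bool) \<Rightarrow> bool" where
  "Del n P \<longleftrightarrow> (\<exists>p. delta0 p \<and> fv p \<subseteq> {..<n} \<and> (\<forall>M e. sat M e p \<longleftrightarrow> P M e))"

named_theorems Del_intros

lemma Tm_var [Del_intros]: "i < n \<Longrightarrow> Tm n (\<lambda>M e. e i)"
  unfolding Tm_def by (rule exI[of _ "Var i"]) simp

lemma Tm_zr [Del_intros]: "Tm n (\<lambda>M e. zr M)"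
  unfolding Tm_def by (rule exI[of _ Zero]) simp

lemma Tm_nu [Del_intros]: "Tm n (\<lambda>M e. nu M c)"
  unfolding Tm_def by (rule exI[of _ "num c"]) simp

lemma Tm_su [Del_intros]: "Tm n F \<Longrightarrow> Tm n (\<lambda>M e. su M (F M e))"
  unfolding Tm_def by (elim exE, rule_tac x = "Succ t" in exI) simp

lemma Tm_ad [Del_intros]: "Tm n F \<Longrightarrow> Tm n G \<Longrightarrow> Tm n (\<lambda>M e. ad M (F M e) (G M e))"
  unfolding Tm_def by (elim exE, rule_tac x = "Add t ta" in exI) simp

lemma Tm_mu [Del_intros]: "Tm n F \<Longrightarrow> Tm n G \<Longrightarrow> Tm n (\<lambda>M e. mu M (F M e) (G M e))"
  unfolding Tm_def by (elim exE, rule_tac x = "Mult t ta" in exI) simp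

lemma Del_eq [Del_intros]: "Tm n F \<Longrightarrow> Tm n G \<Longrightarrow> Del n (\<lambda>M e. F M e = G M e)"
  unfolding Tm_def Del_def by (elim exE, rule_tac x = "Eq t ta" in exI) (simp add: delta0.intros)

lemma Del_ls [Del_intros]: "Tm n F \<Longrightarrow> Tm n G \<Longrightarrow> Del n (\<lambda>M e. ls M (F M e) (G M e))"
  unfolding Tm_def Del_def by (elim exE, rule_tac x = "Less t ta" in exI) (simp add: delta0.intros)

lemma Del_not [Del_intros]: "Del n P \<Longrightarrow> Del n (\<lambda>M e. \<not> P M e)"
  unfolding Del_def by (elim exE, rule_tac x = "Neg p" in exI) (simp add: delta0.intros)

lemma Del_conj [Del_intros]: "Del n P \<Longrightarrow> Del n Q \<Longrightarrow> Del n (\<lambda>M e. P M e \<and> Q M e)"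
  unfolding Del_def by (elim exE, rule_tac x = "And p pa" in exI) (simp add: delta0.intros)

lemma Del_disj [Del_intros]: "Del n P \<Longrightarrow> Del n Q \<Longrightarrow> Del n (\<lambda>M e. P M e \<or> Q M e)"
  unfolding Del_def by (elim exE, rule_tac x = "Or p pa" in exI) (simp add: delta0.intros)

lemma Del_imp [Del_intros]: "Del n P \<Longrightarrow> Del n Q \<Longrightarrow> Del n (\<lambda>M e. P M e \<longrightarrow> Q M e)"
  unfolding Del_def by (elim exE, rule_tac x = "Imp p pa" in exI) (simp add: delta0.intros)

lemma Del_iff [Del_intros]: "Del n P \<Longrightarrow> Del n Q \<Longrightarrow> Del n (\<lambda>M e. P M e \<longleftrightarrow> Q M e)"
  unfolding iff_conv_conj_imp by (intro Del_intros)

lemma Del_all [Del_intros]: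
  assumes "Tm n F" "Del (Suc n) (\<lambda>M e. Q M (e 0) (\<lambda>i. e (Suc i)))"
  shows "Del n (\<lambda>M e. \<forall>x. ls M x (F M e) \<longrightarrow> Q M x e)"
proof -
  obtain t where t: "fvt t \<subseteq> {..<n}" "\<And>M e. evt M e t = F M e" using assms(1) by (auto simp: Tm_def)
  obtain p where p: "delta0 p" "fv p \<subseteq> {..<Suc n}"
      "\<And>M e. sat M e p \<longleftrightarrow> Q M (e 0) (\<lambda>i. e (Suc i))" using assms(2) by (auto simp: Del_def)
  let ?q = "Forall (Imp (Less (Var 0) (liftt t 0)) p)"
  have "delta0 ?q" by (rule delta0.intros) (rule p(1))
  moreover have "fv ?q \<subseteq> {..<n}" using t(1) p(2) by (auto simp: fvt_liftt)
  moreover have "sat M e ?q \<longleftrightarrow> (\<forall>x. ls M x (F M e) \<longrightarrow> Q M x e)" for M e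
    by (simp add: p(3) t(2) evt_liftt)
  ultimately show ?thesis unfolding Del_def by blast
qed

lemma Del_ex [Del_intros]:
  assumes "Tm n F" "Del (Suc n) (\<lambda>M e. Q M (e 0) (\<lambda>i. e (Suc i)))"
  shows "Del n (\<lambda>M e. \<exists>x. ls M x (F M e) \<and> Q M x e)"
proof -
  have "Del n (\<lambda>M e. \<not> (\<forall>x. ls M x (F M e) \<longrightarrow> \<not> Q M x e))"
    by (intro Del_not Del_all assms)
  then show ?thesis by simp
qed

lemma delta0_psubst: "delta0 p \<Longrightarrow> delta0 (psubst \<sigma> p)"
proof (induction arbitrary: \<sigma> rule: delta0.induct)
  case (7 p t)
  have "up \<sigma> 0 = Var 0" by (simp add: up_def)
  then show ?case using 7 by (simp add: psubstt_up_liftt delta0.intros)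
next
  case (8 p t)
  have "up \<sigma> 0 = Var 0" by (simp add: up_def)
  then show ?case using 8 by (simp add: psubstt_up_liftt delta0.intros)
qed (simp_all add: delta0.intros)

lemma Del_subst:
  assumes "Del k R" "\<And>i. i < k \<Longrightarrow> Tm n (F i)" "\<And>M e. R' M e \<longleftrightarrow> R M (\<lambda>i. F i M e)"
  shows "Del n R'"
proof -
  obtain p where p: "delta0 p" "fv p \<subseteq> {..<k}" "\<And>M e. sat M e p \<longleftrightarrow> R M e"
    using assms(1) by (auto simp: Del_def)
  have "\<forall>i. \<exists>t. i < k \<longrightarrow> fvt t \<subseteq> {..<n} \<and> (\<forall>M e. evt M e t = F i M e)"
    using assms(2) by (auto simp: Tm_def)
  then obtain t where t: "\<And>i. i < k \<Longrightarrow> fvt (t i) \<subseteq> {..<n} \<and> (\<forall>M e. evt M e (t i) = F i M e)"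
    by metis
  have "sat M e (psubst t p) \<longleftrightarrow> R' M e" for M e
  proof -
    have "sat M e (psubst t p) = sat M (\<lambda>i. F i M e) p"
      unfolding sat_psubst by (rule sat_cong) (use p(2) t in auto)
    then show ?thesis by (simp add: p(3) assms(3))
  qed
  moreover have "fv (psubst t p) \<subseteq> {..<n}" using p(2) t unfolding fv_psubst by blast
  ultimately show ?thesis unfolding Del_def using delta0_psubst[OF p(1)] by blast
qed

lemma Del_ren:
  assumes "Del k R" "\<And>i. i < k \<Longrightarrow> \<pi> i < n" "\<And>M e. R' M e \<longleftrightarrow> R M (\<lambda>i. e (\<pi> i))"
  shows "Del n R'"
  by (rule Del_subst[OF assms(1), where F = "\<lambda>i M e. e (\<pi> i)"]) (use assms(2,3) in \<open>auto intro: Tm_var\<close>)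

lemma Del_app1: "Del 1 (\<lambda>M e. R M (e 0)) \<Longrightarrow> Tm n F \<Longrightarrow> Del n (\<lambda>M e. R M (F M e))"
  by (rule Del_subst[where F = "\<lambda>i. F"]) auto

lemma Del_app2:
  "Del 2 (\<lambda>M e. R M (e 0) (e 1)) \<Longrightarrow> Tm n F \<Longrightarrow> Tm n G \<Longrightarrow> Del n (\<lambda>M e. R M (F M e) (G M e))"
  by (rule Del_subst[where F = "\<lambda>i. if i = 0 then F else G"]) auto

lemma Del_app3:
  "Del 3 (\<lambda>M e. R M (e 0) (e 1) (e 2)) \<Longrightarrow> Tm n F \<Longrightarrow> Tm n G \<Longrightarrow> Tm n H \<Longrightarrow>
    Del n (\<lambda>M e. R M (F M e) (G M e) (H M e))"
  by (rule Del_subst[where F = "\<lambda>i. if i = 0 then F else if i = 1 then G else H"]) auto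

lemma Del_app4:
  "Del 4 (\<lambda>M e. R M (e 0) (e 1) (e 2) (e 3)) \<Longrightarrow> Tm n F \<Longrightarrow> Tm n G \<Longrightarrow> Tm n H \<Longrightarrow> Tm n K \<Longrightarrow>
    Del n (\<lambda>M e. R M (F M e) (G M e) (H M e) (K M e))"
  by (rule Del_subst[where F = "\<lambda>i. if i = 0 then F else if i = 1 then G else if i = 2 then H else K"])
    auto

context pa_model begin

lemma Del_absolute: "Del n P \<Longrightarrow> P M (\<lambda>i. nu M (e i)) \<longleftrightarrow> P NN e"
  unfolding Del_def using delta0_absolute by metis

lemma Del_definable: "Del n P \<Longrightarrow> definable (\<lambda>x. P M (case_nat x e))"
  unfolding Del_def definable_def by blast

end

section \<open>Codes of finite sets\<close>

text \<open>As with Goedel's beta function, a number codes the set of those \<open>x\<close> for which the modulus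
  \<open>1 + (x + 1) b\<close> divides \<open>a\<close>; below \<open>k\<close> the moduli are pairwise coprime if \<open>1, \<dots>, k\<close> divide \<open>b\<close>.\<close>

definition mem :: "nat \<Rightarrow> nat \<Rightarrow> bool" where
  "mem x s \<longleftrightarrow> (\<exists>a b. s = prod_encode (a, b) \<and> Suc (Suc x * b) dvd a)"

text \<open>Cantor's pairing equation multiplied by two, which avoids a division.\<close>

definition peM :: "model \<Rightarrow> nat \<Rightarrow> nat \<Rightarrow> nat \<Rightarrow> bool" where
  "peM M z a b \<longleftrightarrow> ad M z z = ad M (mu M (ad M a b) (su M (ad M a b))) (ad M a a)"

definition dvdM :: "model \<Rightarrow> nat \<Rightarrow> nat \<Rightarrow> bool" where
  "dvdM M m a \<longleftrightarrow> (\<exists>q. ls M q (su M a) \<and> mu M q m = a)"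

definition memM :: "model \<Rightarrow> nat \<Rightarrow> nat \<Rightarrow> bool" where
  "memM M x s \<longleftrightarrow> (\<exists>a. ls M a (su M s) \<and> (\<exists>b. ls M b (su M s) \<and> peM M s a b \<and>
    dvdM M (su M (mu M (su M x) b)) a))"

text \<open>In the standard model, \<open>fullM NN k w\<close> implies that every subset of \<open>{..<k}\<close> has a code
  below \<open>w\<close>.\<close>

definition fullM :: "model \<Rightarrow> nat \<Rightarrow> nat \<Rightarrow> bool" where
  "fullM M k w \<longleftrightarrow> (\<exists>c. ls M c w \<and> (\<exists>a. ls M a (su M c) \<and> (\<exists>b. ls M b (su M c) \<and> peM M c a b \<and>
    ls M (zr M) a \<and> ls M (zr M) b \<and>
    (\<forall>i. ls M i k \<longrightarrow> dvdM M (su M i) b \<and> dvdM M (su M (mu M (su M i) b)) a))))"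

lemma Del_peM [Del_intros]:
  "Tm n F \<Longrightarrow> Tm n G \<Longrightarrow> Tm n H \<Longrightarrow> Del n (\<lambda>M e. peM M (F M e) (G M e) (H M e))"
  unfolding peM_def by (intro Del_intros)

lemma Del_dvdM [Del_intros]: "Tm n F \<Longrightarrow> Tm n G \<Longrightarrow> Del n (\<lambda>M e. dvdM M (F M e) (G M e))"
  by (rule Del_app2) (unfold dvdM_def, intro Del_intros, simp_all)

lemma Del_memM [Del_intros]: "Tm n F \<Longrightarrow> Tm n G \<Longrightarrow> Del n (\<lambda>M e. memM M (F M e) (G M e))"
  by (rule Del_app2) (unfold memM_def, intro Del_intros, simp_all)

lemma Del_fullM [Del_intros]: "Tm n F \<Longrightarrow> Tm n G \<Longrightarrow> Del n (\<lambda>M e. fullM M (F M e) (G M e))"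
  by (rule Del_app2) (unfold fullM_def, intro Del_intros, simp_all)

lemma peM_NN: "peM NN z a b \<longleftrightarrow> z = prod_encode (a, b)"
proof -
  have "2 * prod_encode (a, b) = (a + b) * Suc (a + b) + (a + a)"
    by (simp add: prod_encode_def triangle_def)
  then show ?thesis unfolding peM_def NN_simps by linarith
qed

lemma dvdM_NN: "dvdM NN m a \<longleftrightarrow> m dvd a" if "m > 0"
proof
  assume "m dvd a"
  then obtain q where "a = m * q" ..
  then have "q < Suc a \<and> q * m = a" using that by (simp add: less_Suc_eq_le)
  then show "dvdM NN m a" by (auto simp: dvdM_def)
qed (auto simp: dvdM_def)

lemma memM_NN [simp]: "memM NN x s \<longleftrightarrow> mem x s"
  unfolding memM_def mem_def
  by (auto simp: peM_NN dvdM_NN less_Suc_eq_le intro: le_prod_encode_1 le_prod_encode_2)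

lemma fullM_NN: "fullM NN k w \<longleftrightarrow> (\<exists>a b. prod_encode (a, b) < w \<and> 0 < a \<and> 0 < b \<and>
  (\<forall>i<k. Suc i dvd b \<and> Suc (Suc i * b) dvd a))"
  unfolding fullM_def
  by (auto simp: peM_NN dvdM_NN less_Suc_eq_le intro: le_prod_encode_1 le_prod_encode_2)

text \<open>A common divisor \<open>d\<close> divides \<open>j - i\<close>, by cross-multiplying
  with \<open>Suc j\<close> and \<open>Suc i\<close>. As \<open>j - i\<close> is among the assumed
  divisors of \<open>b\<close>, \<open>d\<close> divides \<open>Suc i * b\<close> and hence
  1.\<close>

lemma moduli_coprime:
  fixes b i j :: nat
  assumes "\<And>i. i < k \<Longrightarrow> Suc i dvd b" "i < j" "j < k"
  shows "coprime (Suc (Suc i * b)) (Suc (Suc j * b))"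
proof (rule coprimeI)
  fix d assume d: "d dvd Suc (Suc i * b)" "d dvd Suc (Suc j * b)"
  have "Suc j * Suc (Suc i * b) = Suc i * Suc (Suc j * b) + (j - i)"
    using \<open>i < j\<close> by (simp add: algebra_simps)
  then have "d dvd j - i" using d by (metis dvd_add_right_iff dvd_mult)
  moreover have "j - i dvd b" using assms(1)[of "j - Suc i"] assms(2,3) by (simp add: Suc_diff_Suc)
  ultimately have "d dvd Suc i * b" by (meson dvd_mult dvd_trans)
  then show "is_unit d" using d(1) by (metis Suc_eq_plus1 dvd_add_right_iff)
qed

lemma prod_coprime_dvd:
  fixes m :: "nat \<Rightarrow> nat"
  assumes "finite S" "\<And>i. i \<in> S \<Longrightarrow> m i dvd a" "\<And>i j. i \<in> S \<Longrightarrow> j \<in> S \<Longrightarrow> i \<noteq> j \<Longrightarrow> coprime (m i) (m j)"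
  shows "prod m S dvd a"
  using assms
proof (induction rule: finite_induct)
  case (insert i S)
  have "coprime (m i) (prod m S)" using insert by (intro prod_coprime_right) auto
  then show ?case using insert by (auto intro: divides_mult)
qed simp

text \<open>With \<open>b\<close> fixed, a subset is coded by the product of its moduli. By
  coprimality this product divides \<open>a\<close>, so the code is at most that of
  \<open>(a, b)\<close>, which lies below \<open>w\<close>.\<close>

lemma full_code:
  assumes "fullM NN k w"
  shows "\<exists>v<w. \<forall>x<k. mem x v \<longleftrightarrow> x \<in> X"
proof -
  obtain a b where ab: "prod_encode (a, b) < w" "0 < a" "0 < b"
      "\<And>i. i < k \<Longrightarrow> Suc i dvd b" "\<And>i. i < k \<Longrightarrow> Suc (Suc i * b) dvd a"
    using assms by (auto simp: fullM_NN)
  define m where "m i = Suc (Suc i * b)" for i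
  define S where "S = X \<inter> {..<k}"
  have cop: "coprime (m i) (m j)" if "i < k" "j < k" "i \<noteq> j" for i j
  proof (cases "i < j")
    case True
    then show ?thesis unfolding m_def using that ab(4) by (intro moduli_coprime)
  next
    case False
    then have "coprime (m j) (m i)" unfolding m_def using that ab(4) by (intro moduli_coprime) auto
    then show ?thesis by (simp add: coprime_commute)
  qed
  have "prod m S dvd a"
    by (rule prod_coprime_dvd) (use ab(5) cop in \<open>auto simp: S_def m_def\<close>)
  then have le: "prod m S \<le> a" using ab(2) by (simp add: dvd_imp_le)
  have pe: "prod_encode (c, b) \<le> prod_encode (a, b)" if "c \<le> a" for c
  proof -
    have "2 * prod_encode (c, b) = (c + b) * Suc (c + b) + (c + c)" for c
      by (simp add: prod_encode_def triangle_def)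
    moreover have "(c + b) * Suc (c + b) \<le> (a + b) * Suc (a + b)" using that by (intro mult_mono) auto
    ultimately show ?thesis using that by (metis add_mono mult_le_cancel1 zero_less_numeral)
  qed
  have "mem x (prod_encode (prod m S, b)) \<longleftrightarrow> x \<in> X" if "x < k" for x
  proof -
    have "mem x (prod_encode (prod m S, b)) \<longleftrightarrow> m x dvd prod m S" by (auto simp: mem_def m_def)
    also have "\<dots> \<longleftrightarrow> x \<in> S"
    proof
      assume dv: "m x dvd prod m S"
      show "x \<in> S"
      proof (rule ccontr)
        assume "x \<notin> S"
        \<comment> \<open>A modulus with index outside \<open>S\<close> would be a unit, but moduli
          exceed 1 because \<open>b\<close> is positive.\<close>
        then have "coprime (m x) (prod m S)" using that cop by (intro prod_coprime_right) (auto simp: S_def)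
        then have "is_unit (m x)" using dv by (meson coprime_absorb_left)
        then show False using ab(3) by (simp add: m_def)
      qed
    qed (auto simp: S_def intro: dvd_prodI)
    finally show ?thesis using that by (simp add: S_def)
  qed
  moreover have "prod_encode (prod m S, b) < w" using pe[OF le] ab(1) by simp
  ultimately show ?thesis by blast
qed

lemma full_ex: "\<exists>w. fullM NN k w"
proof -
  define b where "b = (fact k :: nat)"
  define a where "a = (\<Prod>i<k. Suc (Suc i * b))"
  have "Suc i dvd b" if "i < k" for i using that by (simp add: b_def dvd_fact)
  moreover have "Suc (Suc i * b) dvd a" if "i < k" for i
    unfolding a_def by (rule dvd_prodI) (use that in auto)
  moreover have "0 < a" "0 < b" by (simp_all add: a_def b_def)
  ultimately show ?thesis unfolding fullM_NN
    by (intro exI[of _ "Suc (prod_encode (a, b))"] exI[of _ a] exI[of _ b]) simp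
qed

lemma code_ex: "\<exists>s. \<forall>x<k. mem x s \<longleftrightarrow> x \<in> X"
  using full_ex full_code by blast

section \<open>\<open>\<Sigma>\<^sub>1\<close>-definability in the standard model\<close>

text \<open>Unlike \<open>Del\<close>, this concerns \<open>NN\<close> alone: the race needs bounded
  matrices for provability and refutation whose standard meaning is right, and asks nothing of them
  in other models. Variable 0 of \<open>P\<close> is the witness.\<close>

definition Sig :: "nat \<Rightarrow> ((nat \<Rightarrow> nat) \<Rightarrow> bool) \<Rightarrow> bool" where
  "Sig n Q \<longleftrightarrow> (\<exists>P. Del (Suc n) P \<and> (\<forall>e. Q e \<longleftrightarrow> (\<exists>u. P NN (case_nat u e))))"

definition SigF :: "nat \<Rightarrow> ((nat \<Rightarrow> nat) \<Rightarrow> nat) \<Rightarrow> bool" where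
  "SigF n F \<longleftrightarrow> Sig (Suc n) (\<lambda>e. e 0 = F (\<lambda>i. e (Suc i)))"

named_theorems Sig_intros

lemma env_case: "(\<lambda>i. e (case_nat a f i)) = case_nat (e a) (\<lambda>i. e (f i))"
  by (rule ext) (simp split: nat.split)

lemma env_case2:
  "(\<lambda>i. e (case_nat a (case_nat b f) i)) = case_nat (e a) (case_nat (e b) (\<lambda>i. e (f i)))"
  by (rule ext) (simp split: nat.split)

text \<open>Asking for a witness below \<open>u\<close> makes the matrix monotone in
  \<open>u\<close>. One number can then serve several conditions, as conjunctions and bounded
  quantifiers require.\<close>

lemma Sig_mono_witness:
  assumes "Sig n Q"
  obtains P where "Del (Suc n) P" "\<And>e. Q e \<longleftrightarrow> (\<exists>u. P NN (case_nat u e))"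
    "\<And>e u v. P NN (case_nat u e) \<Longrightarrow> u \<le> v \<Longrightarrow> P NN (case_nat v e)"
proof -
  obtain P where P: "Del (Suc n) P" "\<And>e. Q e \<longleftrightarrow> (\<exists>u. P NN (case_nat u e))"
    using assms by (auto simp: Sig_def)
  let ?P = "\<lambda>M e. \<exists>v. ls M v (e 0) \<and> P M (case_nat v (\<lambda>i. e (Suc i)))"
  have "Del (Suc n) ?P"
  proof (rule Del_ex)
    show "Del (Suc (Suc n)) (\<lambda>M e. P M (case_nat (e 0) (\<lambda>i. e (Suc (Suc i)))))"
      by (rule Del_ren[OF P(1), where \<pi> = "case_nat 0 (\<lambda>i. Suc (Suc i))"])
        (auto simp: env_case split: nat.split)
  qed (simp add: Tm_var)
  moreover have "Q e \<longleftrightarrow> (\<exists>u. ?P NN (case_nat u e))" for e by (auto simp: P(2))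
  moreover have "?P NN (case_nat v e)" if "?P NN (case_nat u e)" "u \<le> v" for e u v
    using that by (auto intro: less_le_trans)
  ultimately show ?thesis by (rule that)
qed

lemma Sig_cong: "Sig n Q \<Longrightarrow> (\<And>e. Q' e \<longleftrightarrow> Q e) \<Longrightarrow> Sig n Q'"
  by (simp add: Sig_def)

lemma Sig_ren:
  assumes "Sig k Q" "\<And>i. i < k \<Longrightarrow> \<pi> i < n" "\<And>e. Q' e \<longleftrightarrow> Q (\<lambda>i. e (\<pi> i))"
  shows "Sig n Q'"
proof -
  obtain P where P: "Del (Suc k) P" "\<And>e. Q e \<longleftrightarrow> (\<exists>u. P NN (case_nat u e))"
    using assms by (auto simp: Sig_def)
  have "Del (Suc n) (\<lambda>M e. P M (case_nat (e 0) (\<lambda>i. e (Suc (\<pi> i)))))"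
    by (rule Del_ren[OF P(1), where \<pi> = "case_nat 0 (\<lambda>i. Suc (\<pi> i))"])
      (use assms(2) in \<open>auto simp: env_case split: nat.split\<close>)
  then show ?thesis unfolding Sig_def by (intro exI conjI) (auto simp: assms(3) P(2))
qed

lemma Sig_Del:
  assumes "Del n P" "\<And>e. Q e \<longleftrightarrow> P NN e"
  shows "Sig n Q"
proof -
  have "Del (Suc n) (\<lambda>M e. P M (\<lambda>i. e (Suc i)))"
    by (rule Del_ren[OF assms(1), where \<pi> = Suc]) auto
  then show ?thesis unfolding Sig_def by (intro exI conjI) (auto simp: assms(2))
qed

lemma Sig_conj [Sig_intros]:
  assumes "Sig n Q" "Sig n R"
  shows "Sig n (\<lambda>e. Q e \<and> R e)"
proof -
  obtain P where P: "Del (Suc n) P" "\<And>e. Q e \<longleftrightarrow> (\<exists>u. P NN (case_nat u e))"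
    "\<And>e u v. P NN (case_nat u e) \<Longrightarrow> u \<le> v \<Longrightarrow> P NN (case_nat v e)"
    using Sig_mono_witness[OF assms(1)] by blast
  obtain P' where P': "Del (Suc n) P'" "\<And>e. R e \<longleftrightarrow> (\<exists>u. P' NN (case_nat u e))"
    "\<And>e u v. P' NN (case_nat u e) \<Longrightarrow> u \<le> v \<Longrightarrow> P' NN (case_nat v e)"
    using Sig_mono_witness[OF assms(2)] by blast
  have "Q e \<and> R e \<longleftrightarrow> (\<exists>u. P NN (case_nat u e) \<and> P' NN (case_nat u e))" for e
    unfolding P(2) P'(2) by (meson P(3) P'(3) max.cobounded1 max.cobounded2)
  then show ?thesis unfolding Sig_def using Del_conj[OF P(1) P'(1)] by blast
qed

lemma Sig_disj [Sig_intros]: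
  assumes "Sig n Q" "Sig n R"
  shows "Sig n (\<lambda>e. Q e \<or> R e)"
proof -
  obtain P where P: "Del (Suc n) P" "\<And>e. Q e \<longleftrightarrow> (\<exists>u. P NN (case_nat u e))"
    using assms by (auto simp: Sig_def)
  obtain P' where P': "Del (Suc n) P'" "\<And>e. R e \<longleftrightarrow> (\<exists>u. P' NN (case_nat u e))"
    using assms by (auto simp: Sig_def)
  have "Q e \<or> R e \<longleftrightarrow> (\<exists>u. P NN (case_nat u e) \<or> P' NN (case_nat u e))" for e
    unfolding P(2) P'(2) by blast
  then show ?thesis unfolding Sig_def using Del_disj[OF P(1) P'(1)] by blast
qed

lemma Sig_ex [Sig_intros]:
  assumes "Sig (Suc n) (\<lambda>e. Q (e 0) (\<lambda>i. e (Suc i)))"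
  shows "Sig n (\<lambda>e. \<exists>x. Q x e)"
proof -
  obtain P where P: "Del (Suc (Suc n)) P" "\<And>e. Q (e 0) (\<lambda>i. e (Suc i)) \<longleftrightarrow> (\<exists>u. P NN (case_nat u e))"
    "\<And>e u v. P NN (case_nat u e) \<Longrightarrow> u \<le> v \<Longrightarrow> P NN (case_nat v e)"
    using Sig_mono_witness[OF assms] by blast
  have Q: "Q x e \<longleftrightarrow> (\<exists>u. P NN (case_nat u (case_nat x e)))" for x e
    using P(2)[of "case_nat x e"] by simp
  let ?P = "\<lambda>M e. \<exists>x. ls M x (e 0) \<and> P M (case_nat (e 0) (case_nat x (\<lambda>i. e (Suc i))))"
  have "Del (Suc n) ?P"
  proof (rule Del_ex)
    show "Del (Suc (Suc n)) (\<lambda>M e. P M (case_nat (e (Suc 0)) (case_nat (e 0) (\<lambda>i. e (Suc (Suc i))))))"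
      by (rule Del_ren[OF P(1), where \<pi> = "case_nat (Suc 0) (case_nat 0 (\<lambda>i. Suc (Suc i)))"])
        (simp_all add: env_case2 split: nat.split)
  qed (simp add: Tm_var)
  moreover have "(\<exists>x. Q x e) \<longleftrightarrow> (\<exists>u. ?P NN (case_nat u e))" for e
  proof
    assume "\<exists>x. Q x e"
    then obtain x u where "P NN (case_nat u (case_nat x e))" by (auto simp: Q)
    then have "P NN (case_nat (max u (Suc x)) (case_nat x e))" using P(3) max.cobounded1 by blast
    then show "\<exists>u. ?P NN (case_nat u e)" by (intro exI[of _ "max u (Suc x)"] exI[of _ x]) simp
  qed (auto simp: Q)
  ultimately show ?thesis unfolding Sig_def by blast
qed

lemma Sig_all_var:
  assumes "Sig (Suc n) (\<lambda>e. Q (e 0) (\<lambda>i. e (Suc i)))" "i < n"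
  shows "Sig n (\<lambda>e. \<forall>x<e i. Q x e)"
proof -
  obtain P where P: "Del (Suc (Suc n)) P" "\<And>e. Q (e 0) (\<lambda>i. e (Suc i)) \<longleftrightarrow> (\<exists>u. P NN (case_nat u e))"
    "\<And>e u v. P NN (case_nat u e) \<Longrightarrow> u \<le> v \<Longrightarrow> P NN (case_nat v e)"
    using Sig_mono_witness[OF assms(1)] by blast
  have Q: "Q x e \<longleftrightarrow> (\<exists>u. P NN (case_nat u (case_nat x e)))" for x e
    using P(2)[of "case_nat x e"] by simp
  let ?P = "\<lambda>M e. \<forall>x. ls M x (e (Suc i)) \<longrightarrow> P M (case_nat (e 0) (case_nat x (\<lambda>i. e (Suc i))))"
  have "Del (Suc n) ?P"
  proof (rule Del_all)
    show "Del (Suc (Suc n)) (\<lambda>M e. P M (case_nat (e (Suc 0)) (case_nat (e 0) (\<lambda>i. e (Suc (Suc i))))))"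
      by (rule Del_ren[OF P(1), where \<pi> = "case_nat (Suc 0) (case_nat 0 (\<lambda>i. Suc (Suc i)))"])
        (simp_all add: env_case2 split: nat.split)
  qed (simp add: Tm_var assms(2))
  moreover have "(\<forall>x<e i. Q x e) \<longleftrightarrow> (\<exists>u. ?P NN (case_nat u e))" for e
  proof
    assume all: "\<forall>x<e i. Q x e"
    \<comment> \<open>Collection: finitely many witnesses are replaced by their maximum.\<close>
    have "\<exists>u. \<forall>x<m. P NN (case_nat u (case_nat x e))" if "m \<le> e i" for m
      using that
    proof (induction m)
      case (Suc m)
      then obtain u v where "\<forall>x<m. P NN (case_nat u (case_nat x e))" "P NN (case_nat v (case_nat m e))"
        using all by (auto simp: Q Suc_le_eq)
      then have "\<forall>x<Suc m. P NN (case_nat (max u v) (case_nat x e))"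
        using P(3) by (metis less_Suc_eq max.cobounded1 max.cobounded2)
      then show ?case by blast
    qed simp
    then show "\<exists>u. ?P NN (case_nat u e)" by auto
  qed (auto simp: Q)
  ultimately show ?thesis unfolding Sig_def by blast
qed

text \<open>Composition goes through the graph of \<open>F\<close>: its value is pushed onto the
  environment as a new variable 0.\<close>

lemma Sig_let:
  assumes "SigF n F" "Sig (Suc n) (\<lambda>e. Q (e 0) (\<lambda>i. e (Suc i)))"
  shows "Sig n (\<lambda>e. Q (F e) e)"
proof -
  have "Sig n (\<lambda>e. \<exists>y. y = F e \<and> Q y e)"
    by (rule Sig_ex, rule Sig_conj) (use assms in \<open>simp_all add: SigF_def\<close>)
  then show ?thesis by simp
qed

lemma SigF_ren:
  assumes "SigF k F" "\<And>i. i < k \<Longrightarrow> \<pi> i < n" "\<And>e. F' e = F (\<lambda>i. e (\<pi> i))"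
  shows "SigF n F'"
  unfolding SigF_def
  by (rule Sig_ren[OF assms(1)[unfolded SigF_def], where \<pi> = "case_nat 0 (\<lambda>i. Suc (\<pi> i))"])
    (use assms(2,3) in \<open>auto split: nat.split\<close>)

lemma SigF_Suc_env: "SigF n F \<Longrightarrow> SigF (Suc n) (\<lambda>e. F (\<lambda>i. e (Suc i)))"
  by (rule SigF_ren[where \<pi> = Suc]) auto

lemma Sig_all [Sig_intros]:
  assumes "SigF n F" "Sig (Suc n) (\<lambda>e. Q (e 0) (\<lambda>i. e (Suc i)))"
  shows "Sig n (\<lambda>e. \<forall>x<F e. Q x e)"
proof (rule Sig_let[OF assms(1)], rule Sig_all_var)
  show "Sig (Suc (Suc n)) (\<lambda>e. Q (e 0) (\<lambda>i. e (Suc (Suc i))))"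
    by (rule Sig_ren[OF assms(2), where \<pi> = "case_nat 0 (\<lambda>i. Suc (Suc i))"]) (auto split: nat.split)
qed simp

lemma Sig_app1: "Sig 1 (\<lambda>e. R (e 0)) \<Longrightarrow> SigF n F \<Longrightarrow> Sig n (\<lambda>e. R (F e))"
  by (rule Sig_let, assumption, erule Sig_ren[where \<pi> = "\<lambda>i. i"]) auto

lemma Sig_app2:
  assumes "Sig 2 (\<lambda>e. R (e 0) (e 1))" "SigF n F" "SigF n G"
  shows "Sig n (\<lambda>e. R (F e) (G e))"
  \<comment> \<open>\<open>G\<close> is pushed after \<open>F\<close> and so gets index 0; the
    renaming swaps the two indices.\<close>
  by (rule Sig_let[OF assms(2)], rule Sig_let[OF SigF_Suc_env[OF assms(3)]],
      rule Sig_ren[OF assms(1), where \<pi> = "\<lambda>i. 1 - i"]) auto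

lemma Sig_app3:
  assumes "Sig 3 (\<lambda>e. R (e 0) (e 1) (e 2))" "SigF n F" "SigF n G" "SigF n H"
  shows "Sig n (\<lambda>e. R (F e) (G e) (H e))"
  by (rule Sig_let[OF assms(2)], rule Sig_let[OF SigF_Suc_env[OF assms(3)]],
      rule Sig_let[OF SigF_Suc_env[OF SigF_Suc_env[OF assms(4)]]],
      rule Sig_ren[OF assms(1), where \<pi> = "\<lambda>i. 2 - i"]) (auto simp: numeral_2_eq_2)

lemma SigF_var [Sig_intros]: "i < n \<Longrightarrow> SigF n (\<lambda>e. e i)"
  unfolding SigF_def by (rule Sig_Del[where P = "\<lambda>M e. e 0 = e (Suc i)"]) (auto intro!: Del_intros)

lemma SigF_const [Sig_intros]: "SigF n (\<lambda>e. c)"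
  unfolding SigF_def by (rule Sig_Del[where P = "\<lambda>M e. e 0 = nu M c"]) (auto intro!: Del_intros)

lemma SigF_app1:
  assumes "SigF 1 (\<lambda>e. f (e 0))" "SigF n F"
  shows "SigF n (\<lambda>e. f (F e))"
proof -
  have "Sig 2 (\<lambda>e. e 0 = f (e 1))" using assms(1) by (simp add: SigF_def numeral_2_eq_2)
  from Sig_app2[of "\<lambda>x y. x = f y", OF this SigF_var SigF_Suc_env[OF assms(2)], of 0]
  show ?thesis by (simp add: SigF_def)
qed

lemma SigF_app2:
  assumes "SigF 2 (\<lambda>e. f (e 0) (e 1))" "SigF n F" "SigF n G"
  shows "SigF n (\<lambda>e. f (F e) (G e))"
proof -
  have "Sig 3 (\<lambda>e. e 0 = f (e 1) (e 2))" using assms(1) by (simp add: SigF_def eval_nat_numeral)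
  from Sig_app3[of "\<lambda>x y z. x = f y z", OF this SigF_var SigF_Suc_env[OF assms(2)] SigF_Suc_env[OF assms(3)], of 0]
  show ?thesis by (simp add: SigF_def)
qed

lemma SigF_Suc [Sig_intros]: "SigF n F \<Longrightarrow> SigF n (\<lambda>e. Suc (F e))"
  by (rule SigF_app1, unfold SigF_def, rule Sig_Del[where P = "\<lambda>M e. e 0 = su M (e 1)"])
    (auto intro!: Del_intros)

lemma SigF_prod_encode [Sig_intros]:
  "SigF n F \<Longrightarrow> SigF n G \<Longrightarrow> SigF n (\<lambda>e. prod_encode (F e, G e))"
  by (rule SigF_app2, unfold SigF_def, rule Sig_Del[where P = "\<lambda>M e. peM M (e 0) (e 1) (e 2)"])
    (auto intro!: Del_intros simp: peM_NN eval_nat_numeral)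

lemma Sig_eq [Sig_intros]: "SigF n F \<Longrightarrow> SigF n G \<Longrightarrow> Sig n (\<lambda>e. F e = G e)"
  by (rule Sig_app2, rule Sig_Del[where P = "\<lambda>M e. e 0 = e 1"]) (auto intro!: Del_intros)

lemma Sig_less [Sig_intros]: "SigF n F \<Longrightarrow> SigF n G \<Longrightarrow> Sig n (\<lambda>e. F e < G e)"
  by (rule Sig_app2, rule Sig_Del[where P = "\<lambda>M e. ls M (e 0) (e 1)"]) (auto intro!: Del_intros)

lemma Sig_mem [Sig_intros]: "SigF n F \<Longrightarrow> SigF n G \<Longrightarrow> Sig n (\<lambda>e. mem (F e) (G e))"
  by (rule Sig_app2, rule Sig_Del[where P = "\<lambda>M e. memM M (e 0) (e 1)"]) (auto intro!: Del_intros)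

text \<open>\<open>Sig\<close> is not closed under negation, but membership has a bounded
  definition. The negative case is used for definitions by cases on \<open>mem\<close>.\<close>

lemma Sig_not_mem [Sig_intros]: "SigF n F \<Longrightarrow> SigF n G \<Longrightarrow> Sig n (\<lambda>e. \<not> mem (F e) (G e))"
  by (rule Sig_app2[where R = "\<lambda>x y. \<not> mem x y"], rule Sig_Del[where P = "\<lambda>M e. \<not> memM M (e 0) (e 1)"])
    (auto intro!: Del_intros)

section \<open>Inductive definitions and recursion\<close>

text \<open>Rules with two premises suffice for all the syntax below; a rule with one premise is
  written with \<open>z = y\<close>.\<close>

inductive Ind :: "(nat \<Rightarrow> bool) \<Rightarrow> (nat \<Rightarrow> nat \<Rightarrow> nat \<Rightarrow> bool) \<Rightarrow> nat \<Rightarrow> bool" for A B where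
  base: "A x \<Longrightarrow> Ind A B x"
| step: "B x y z \<Longrightarrow> Ind A B y \<Longrightarrow> Ind A B z \<Longrightarrow> Ind A B x"

text \<open>A derivation is a finite set of pairs \<open>(l, x)\<close> in which the premises of \<open>x\<close> occur with labels
  smaller than \<open>l\<close>.\<close>

definition justified :: "(nat \<Rightarrow> bool) \<Rightarrow> (nat \<Rightarrow> nat \<Rightarrow> nat \<Rightarrow> bool) \<Rightarrow> (nat \<Rightarrow> bool) \<Rightarrow> nat \<Rightarrow> nat \<Rightarrow> bool" where
  "justified A B S l x \<longleftrightarrow> A x \<or> (\<exists>y z j k. j < l \<and> k < l \<and> S (prod_encode (j, y)) \<and>
    S (prod_encode (k, z)) \<and> B x y z)"

lemma Ind_derivation:
  "Ind A B x \<longleftrightarrow> (\<exists>s n l. (prod_encode (l, x) < n \<and> mem (prod_encode (l, x)) s) \<and>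
    (\<forall>z<n. \<not> mem z s \<or> (\<exists>l x. z = prod_encode (l, x) \<and> justified A B (\<lambda>z. z < n \<and> mem z s) l x)))"
  (is "_ \<longleftrightarrow> (\<exists>s n l. ?D s n l)")
proof
  assume "Ind A B x"
  then have "\<exists>S l. finite S \<and> prod_encode (l, x) \<in> S \<and>
    (\<forall>l x. prod_encode (l, x) \<in> S \<longrightarrow> justified A B (\<lambda>z. z \<in> S) l x)"
  proof induction
    case (base x)
    then show ?case by (intro exI[of _ "{prod_encode (0, x)}"] exI[of _ 0]) (auto simp: justified_def)
  next
    case (step x y z)
    obtain S j where S: "finite S" "prod_encode (j, y) \<in> S"
      "\<And>l x. prod_encode (l, x) \<in> S \<Longrightarrow> justified A B (\<lambda>z. z \<in> S) l x" using step.IH(1) by blast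
    obtain S' k where S': "finite S'" "prod_encode (k, z) \<in> S'"
      "\<And>l x. prod_encode (l, x) \<in> S' \<Longrightarrow> justified A B (\<lambda>z. z \<in> S') l x" using step.IH(2) by blast
    \<comment> \<open>Two derivations can be merged without relabelling, since enlarging the set
      preserves justification; only the new label must exceed both old ones.\<close>
    let ?l = "Suc (max j k)"
    let ?U = "insert (prod_encode (?l, x)) (S \<union> S')"
    have mono: "justified A B (\<lambda>z. z \<in> R) l x \<Longrightarrow> R \<subseteq> R' \<Longrightarrow> justified A B (\<lambda>z. z \<in> R') l x" for R R' l x
      unfolding justified_def by blast
    have "justified A B (\<lambda>z. z \<in> ?U) l' x'" if "prod_encode (l', x') \<in> ?U" for l' x'
    proof -
      consider "prod_encode (l', x') \<in> S" | "prod_encode (l', x') \<in> S'" | "l' = ?l" "x' = x"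
        using \<open>prod_encode (l', x') \<in> ?U\<close> by auto
      then show ?thesis
      proof cases
        case 1
        show ?thesis by (rule mono[OF S(3)[OF 1]]) auto
      next
        case 2
        show ?thesis by (rule mono[OF S'(3)[OF 2]]) auto
      next
        case 3
        have "j < ?l" "k < ?l" "prod_encode (j, y) \<in> ?U" "prod_encode (k, z) \<in> ?U"
          using S(2) S'(2) by auto
        then have "\<exists>y z j k. j < l' \<and> k < l' \<and> prod_encode (j, y) \<in> ?U \<and> prod_encode (k, z) \<in> ?U \<and> B x' y z"
          unfolding 3 using step.hyps(1) by (intro exI[of _ y] exI[of _ z] exI[of _ j] exI[of _ k] conjI)
        then show ?thesis unfolding justified_def by (rule disjI2)
      qed
    qed
    then have "\<forall>l x. prod_encode (l, x) \<in> ?U \<longrightarrow> justified A B (\<lambda>z. z \<in> ?U) l x" by (intro allI impI)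
    moreover have "finite ?U" using S(1) S'(1) by simp
    ultimately show ?case by (intro exI[of _ ?U] exI[of _ ?l] conjI insertI1)
  qed
  then obtain S l where S: "finite S" "prod_encode (l, x) \<in> S"
    "\<And>l x. prod_encode (l, x) \<in> S \<Longrightarrow> justified A B (\<lambda>z. z \<in> S) l x" by blast
  \<comment> \<open>A code fixes its set only below some bound and may contain anything above it;
    hence \<open>n\<close> is part of the derivation.\<close>
  obtain n where n: "\<And>z. z \<in> S \<Longrightarrow> z < n" using S(1) by (auto simp: finite_nat_set_iff_bounded)
  obtain s where s: "\<And>z. z < n \<Longrightarrow> mem z s \<longleftrightarrow> z \<in> S" using code_ex[of n S] by blast
  have S_eq: "(\<lambda>z. z < n \<and> mem z s) = (\<lambda>z. z \<in> S)" using n s by auto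
  have "\<exists>l x. z = prod_encode (l, x) \<and> justified A B (\<lambda>z. z < n \<and> mem z s) l x" if "z < n" "mem z s" for z
  proof -
    obtain l x where "z = prod_encode (l, x)" by (metis prod_decode_inverse surj_pair)
    then show ?thesis using S(3)[of l x] that s unfolding S_eq by auto
  qed
  moreover have "prod_encode (l, x) < n" "mem (prod_encode (l, x)) s" using S(2) n s by auto
  ultimately have "?D s n l" by simp
  then show "\<exists>s n l. ?D s n l" by (intro exI)
next
  assume "\<exists>s n l. ?D s n l"
  then obtain s n l where D: "?D s n l" by (elim exE)
  have J: "justified A B (\<lambda>z. z < n \<and> mem z s) l x"
    if lx: "prod_encode (l, x) < n" "mem (prod_encode (l, x)) s" for l x
  proof -
    obtain l' x' where "prod_encode (l, x) = prod_encode (l', x')"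
      "justified A B (\<lambda>z. z < n \<and> mem z s) l' x'" using D lx by blast
    then show ?thesis by simp
  qed
  have "prod_encode (l, x) < n" "mem (prod_encode (l, x)) s" using D by blast+
  then show "Ind A B x"
  \<comment> \<open>The labels exclude circular justification and carry the induction.\<close>
  proof (induction l arbitrary: x rule: less_induct)
    case (less l)
    from J[OF less.prems] consider "A x" | y z j k where "j < l" "k < l" "prod_encode (j, y) < n"
      "mem (prod_encode (j, y)) s" "prod_encode (k, z) < n" "mem (prod_encode (k, z)) s" "B x y z"
      unfolding justified_def by blast
    then show ?case
    proof cases
      case 1
      then show ?thesis by (rule Ind.base)
    next
      case 2
      then show ?thesis by (intro Ind.step[of B x y z] less.IH)
    qed
  qed
qed

lemma Sig_Ind:
  assumes A: "Sig (Suc n) (\<lambda>e. A (\<lambda>i. e (Suc i)) (e 0))"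
    and B: "Sig (Suc (Suc (Suc n))) (\<lambda>e. B (\<lambda>i. e (Suc (Suc (Suc i)))) (e 0) (e (Suc 0)) (e (Suc (Suc 0))))"
  shows "Sig (Suc n) (\<lambda>e. Ind (A (\<lambda>i. e (Suc i))) (B (\<lambda>i. e (Suc i))) (e 0))"
  unfolding Ind_derivation justified_def
  apply (intro Sig_intros)
                      apply simp_all
   \<comment> \<open>Six quantifiers separate the parameters from \<open>A\<close>, ten from
     \<open>B\<close>, and one more place is taken by the argument of \<open>Ind\<close>. The
     indices 4, 3, 2 are those of \<open>x\<close>, \<open>y\<close>, \<open>z\<close> inside the
     innermost block.\<close>
   apply (rule Sig_ren[OF A, where \<pi> = "case_nat 0 (\<lambda>i. Suc (Suc (Suc (Suc (Suc (Suc (Suc i)))))))"];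
      simp split: nat.split)
  apply (rule Sig_ren[OF B, where \<pi> = "case_nat 4 (case_nat 3 (case_nat 2
    (\<lambda>i. Suc (Suc (Suc (Suc (Suc (Suc (Suc (Suc (Suc (Suc (Suc i)))))))))))))"];
      simp add: eval_nat_numeral split: nat.split)
  done

text \<open>The graph is generated as the set of pairs of \<open>k\<close> and the value at
  \<open>k\<close>, by a rule with one premise that leads from \<open>k\<close> to
  \<open>Suc k\<close>.\<close>

lemma SigF_rec:
  assumes F: "SigF n F" and G: "SigF (Suc (Suc n)) (\<lambda>e. G (e 0) (e (Suc 0)) (\<lambda>i. e (Suc (Suc i))))"
    and H: "SigF n H"
  shows "SigF n (\<lambda>e. rec_nat (F e) (\<lambda>k r. G k r e) (H e))"
proof -
  define A where "A e x \<longleftrightarrow> x = prod_encode (0, F e)" for e x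
  define B where "B e x y z \<longleftrightarrow> z = y \<and> (\<exists>k r. y = prod_encode (k, r) \<and> x = prod_encode (Suc k, G k r e))"
    for e x y z
  have Ind: "Ind (A e) (B e) x \<longleftrightarrow> (\<exists>k. x = prod_encode (k, rec_nat (F e) (\<lambda>k r. G k r e) k))" for e x
  proof
    assume "Ind (A e) (B e) x"
    then show "\<exists>k. x = prod_encode (k, rec_nat (F e) (\<lambda>k r. G k r e) k)"
    proof induction
      case (base x)
      then show ?case by (intro exI[of _ 0]) (simp add: A_def)
    next
      case (step x y z)
      then obtain k where k: "x = prod_encode (Suc k, G k (rec_nat (F e) (\<lambda>k r. G k r e) k) e)"
        by (auto simp: B_def)
      show ?case by (intro exI[of _ "Suc k"]) (simp add: k)
    qed
  next
    assume "\<exists>k. x = prod_encode (k, rec_nat (F e) (\<lambda>k r. G k r e) k)"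
    moreover have "Ind (A e) (B e) (prod_encode (k, rec_nat (F e) (\<lambda>k r. G k r e) k))" for k
    proof (induction k)
      case 0
      show ?case by (rule Ind.base) (simp add: A_def)
    next
      case (Suc k)
      show ?case by (rule Ind.step[OF _ Suc Suc]) (auto simp: B_def)
    qed
    ultimately show "Ind (A e) (B e) x" by blast
  qed
  have "Sig (Suc n) (\<lambda>e. A (\<lambda>i. e (Suc i)) (e 0))"
    unfolding A_def by (intro Sig_intros SigF_Suc_env F) simp
  moreover have "Sig (Suc (Suc (Suc n))) (\<lambda>e. B (\<lambda>i. e (Suc (Suc (Suc i)))) (e 0) (e (Suc 0)) (e (Suc (Suc 0))))"
    unfolding B_def
    apply (intro Sig_intros)
             apply simp_all
    apply (rule SigF_ren[OF G, where \<pi> = "case_nat (Suc 0) (case_nat 0 (\<lambda>i. Suc (Suc (Suc (Suc (Suc i))))))"];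
        simp split: nat.split)
    done
  ultimately have I: "Sig (Suc n) (\<lambda>e. Ind (A (\<lambda>i. e (Suc i))) (B (\<lambda>i. e (Suc i))) (e 0))"
    by (rule Sig_Ind)
  have "Sig (Suc n) (\<lambda>e. Ind (A (\<lambda>i. e (Suc i))) (B (\<lambda>i. e (Suc i)))
    (prod_encode (H (\<lambda>i. e (Suc i)), e 0)))"
    apply (rule Sig_let[where F = "\<lambda>e. prod_encode (H (\<lambda>i. e (Suc i)), e 0)"])
     apply (intro Sig_intros SigF_Suc_env H; simp)
    apply (rule Sig_ren[OF I, where \<pi> = "case_nat 0 (\<lambda>i. Suc (Suc i))"]; simp split: nat.split)
    done
  then show ?thesis unfolding SigF_def Ind by simp
qed

definition env_app :: "nat list \<Rightarrow> (nat \<Rightarrow> nat) \<Rightarrow> nat \<Rightarrow> nat" where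
  "env_app ys e i = (if i < length ys then ys ! i else e (i - length ys))"

text \<open>\<open>Sig_let\<close> for a whole list, because composition of primitive recursive
  functions admits any number of inner functions.\<close>

lemma Sig_env_app:
  assumes "\<forall>g\<in>set gs. SigF n g" "Sig (length gs + n) Q"
  shows "Sig n (\<lambda>e. Q (env_app (map (\<lambda>g. g e) gs) e))"
  using assms
proof (induction gs arbitrary: Q)
  case Nil
  then show ?case by (simp add: env_app_def)
next
  case (Cons g gs)
  have g: "SigF (length gs + n) (\<lambda>e. g (\<lambda>i. e (length gs + i)))"
    by (rule SigF_ren[where \<pi> = "\<lambda>i. length gs + i"]) (use Cons.prems in auto)
  have "Sig (length gs + n) (\<lambda>e. Q (case_nat (g (\<lambda>i. e (length gs + i))) e))"
    by (rule Sig_let[OF g]) (use Cons.prems(2) in \<open>simp add: case_nat_eta\<close>)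
  then have "Sig n (\<lambda>e. Q (case_nat (g (\<lambda>i. env_app (map (\<lambda>g. g e) gs) e (length gs + i)))
      (env_app (map (\<lambda>g. g e) gs) e)))"
    using Cons.IH Cons.prems(1) by simp
  moreover have "case_nat (g (\<lambda>i. env_app (map (\<lambda>g. g e) gs) e (length gs + i))) (env_app (map (\<lambda>g. g e) gs) e)
    = env_app (map (\<lambda>g. g e) (g # gs)) e" for e
    by (rule ext) (simp add: env_app_def split: nat.split)
  ultimately show ?case by simp
qed

lemma map_env_app: "map (env_app ys e) [0..<length ys] = ys"
  by (rule nth_equalityI) (simp_all add: env_app_def)

lemma SigF_prim_rec: "prim_rec n f \<Longrightarrow> SigF n (\<lambda>e. f (map e [0..<n]))"
proof (induction rule: prim_rec.induct)
  case (zero n)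
  show ?case by (rule SigF_const)
next
  case succ
  show ?case by (simp add: SigF_Suc SigF_var)
next
  case (proj i n)
  then show ?case by (simp add: SigF_var)
next
  case (comp gs f n)
  let ?k = "length gs"
  let ?gs = "map (\<lambda>g e. g (map (\<lambda>i. e (Suc i)) [0..<n])) gs"
  have "Sig (Suc ?k) (\<lambda>e. e 0 = f (map (\<lambda>i. e (Suc i)) [0..<?k]))"
    using comp.IH(1) by (simp add: SigF_def)
  \<comment> \<open>Behind the \<open>?k\<close> inner values, the variable for the result has index
    \<open>?k\<close>.\<close>
  then have "Sig (length ?gs + Suc n) (\<lambda>e. e ?k = f (map e [0..<?k]))"
    by (rule Sig_ren[where \<pi> = "case_nat ?k (\<lambda>i. i)"]) (auto split: nat.split)
  moreover have "\<forall>g\<in>set ?gs. SigF (Suc n) g"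
    using comp.IH(2) SigF_Suc_env by fastforce
  ultimately have "Sig (Suc n) (\<lambda>e. env_app (map (\<lambda>g. g e) ?gs) e ?k =
      f (map (env_app (map (\<lambda>g. g e) ?gs) e) [0..<?k]))"
    by (intro Sig_env_app)
  moreover have "map (env_app (map (\<lambda>g. g e) ?gs) e) [0..<?k] = map (\<lambda>g. g e) ?gs" for e
    using map_env_app[of "map (\<lambda>g. g e) ?gs" e] by simp
  moreover have "env_app (map (\<lambda>g. g e) ?gs) e ?k = e 0" for e by (simp add: env_app_def)
  ultimately show ?case by (simp add: SigF_def comp_def)
next
  case (rec n f g)
  have "SigF (Suc n) (\<lambda>e. rec_nat (f (map (\<lambda>i. e (Suc i)) [0..<n]))
    (\<lambda>k r. g (k # r # map (\<lambda>i. e (Suc i)) [0..<n])) (e 0))"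
  proof (rule SigF_rec)
    show "SigF (Suc n) (\<lambda>e. f (map (\<lambda>i. e (Suc i)) [0..<n]))" by (rule SigF_Suc_env[OF rec.IH(1)])
    show "SigF (Suc (Suc (Suc n))) (\<lambda>e. g (e 0 # e (Suc 0) # map (\<lambda>i. e (Suc (Suc (Suc i)))) [0..<n]))"
      by (rule SigF_ren[OF rec.IH(2), where \<pi> = "case_nat 0 (case_nat (Suc 0) (\<lambda>i. Suc (Suc (Suc i))))"])
        (auto simp: map_upt_Suc simp del: upt_Suc split: nat.split)
  qed (simp add: SigF_var)
  then show ?case by (simp add: map_upt_Suc del: upt_Suc)
qed

section \<open>Arithmetization\<close>

lemma Sig_Ind0:
  assumes "Sig 1 (\<lambda>e. A (e 0))" "Sig 3 (\<lambda>e. B (e 0) (e (Suc 0)) (e (Suc (Suc 0))))"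
  shows "Sig 1 (\<lambda>e. Ind A B (e 0))"
  using Sig_Ind[of 0 "\<lambda>_. A" "\<lambda>_. B"] assms by (simp add: eval_nat_numeral)

definition cEq :: "nat \<Rightarrow> nat \<Rightarrow> nat" where "cEq a b = prod_encode (0, prod_encode (a, b))"
definition cNeg :: "nat \<Rightarrow> nat" where "cNeg p = prod_encode (2, p)"
definition cAnd :: "nat \<Rightarrow> nat \<Rightarrow> nat" where "cAnd p q = prod_encode (3, prod_encode (p, q))"
definition cOr :: "nat \<Rightarrow> nat \<Rightarrow> nat" where "cOr p q = prod_encode (4, prod_encode (p, q))"
definition cImp :: "nat \<Rightarrow> nat \<Rightarrow> nat" where "cImp p q = prod_encode (5, prod_encode (p, q))"
definition cAll :: "nat \<Rightarrow> nat" where "cAll p = prod_encode (6, p)"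
definition cEx :: "nat \<Rightarrow> nat" where "cEx p = prod_encode (7, p)"

lemmas code_defs = cEq_def cNeg_def cAnd_def cOr_def cImp_def cAll_def cEx_def

lemma code_simps [simp]:
  "cEq (gnt s) (gnt t) = gn (Eq s t)" "cNeg (gn p) = gn (Neg p)"
  "cAnd (gn p) (gn q) = gn (And p q)" "cOr (gn p) (gn q) = gn (Or p q)"
  "cImp (gn p) (gn q) = gn (Imp p q)" "cAll (gn p) = gn (Forall p)" "cEx (gn p) = gn (Exists p)"
  by (simp_all add: code_defs)

lemma SigF_codes [Sig_intros]:
  "SigF n F \<Longrightarrow> SigF n G \<Longrightarrow> SigF n (\<lambda>e. cEq (F e) (G e))"
  "SigF n F \<Longrightarrow> SigF n (\<lambda>e. cNeg (F e))"
  "SigF n F \<Longrightarrow> SigF n G \<Longrightarrow> SigF n (\<lambda>e. cAnd (F e) (G e))"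
  "SigF n F \<Longrightarrow> SigF n G \<Longrightarrow> SigF n (\<lambda>e. cOr (F e) (G e))"
  "SigF n F \<Longrightarrow> SigF n G \<Longrightarrow> SigF n (\<lambda>e. cImp (F e) (G e))"
  "SigF n F \<Longrightarrow> SigF n (\<lambda>e. cAll (F e))"
  "SigF n F \<Longrightarrow> SigF n (\<lambda>e. cEx (F e))"
  unfolding code_defs by (intro Sig_intros; assumption)+

subsection \<open>Terms and formulas\<close>

definition tm_base :: "nat \<Rightarrow> bool" where
  "tm_base x \<longleftrightarrow> (\<exists>i. x = prod_encode (0, i)) \<or> x = prod_encode (1, 0)"

definition tm_step :: "nat \<Rightarrow> nat \<Rightarrow> nat \<Rightarrow> bool" where
  "tm_step x y z \<longleftrightarrow> (x = prod_encode (2, y) \<and> z = y) \<or> x = prod_encode (3, prod_encode (y, z)) \<or>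
    x = prod_encode (4, prod_encode (y, z))"

definition tm_code :: "nat \<Rightarrow> bool" where
  "tm_code = Ind tm_base tm_step"

lemma tm_code_iff: "tm_code x \<longleftrightarrow> (\<exists>t. x = gnt t)"
proof
  assume "tm_code x"
  then show "\<exists>t. x = gnt t" unfolding tm_code_def
  proof induction
    case (base x)
    then show ?case unfolding tm_base_def by (metis gnt.simps(1,2))
  next
    case (step x y z)
    then obtain s t where "y = gnt s" "z = gnt t" by blast
    then show ?case using step.hyps(1) unfolding tm_step_def by (metis gnt.simps(3-5))
  qed
next
  have "Ind tm_base tm_step (gnt t)" for t
  proof (induction t)
    case (Succ t)
    show ?case by (rule Ind.step[OF _ Succ Succ]) (simp add: tm_step_def)
  next
    case (Add s t)
    show ?case by (rule Ind.step[OF _ Add]) (simp add: tm_step_def)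
  next
    case (Mult s t)
    show ?case by (rule Ind.step[OF _ Mult]) (simp add: tm_step_def)
  qed (auto intro!: Ind.base simp: tm_base_def)
  then show "\<exists>t. x = gnt t \<Longrightarrow> tm_code x" by (auto simp: tm_code_def)
qed

lemma Sig_tm_code [Sig_intros]: "SigF n F \<Longrightarrow> Sig n (\<lambda>e. tm_code (F e))"
  by (rule Sig_app1, unfold tm_code_def, rule Sig_Ind0, unfold tm_base_def tm_step_def)
    (intro Sig_intros; simp)+

definition fm_base :: "nat \<Rightarrow> bool" where
  "fm_base x \<longleftrightarrow> (\<exists>a b j. tm_code a \<and> tm_code b \<and> j < 2 \<and> x = prod_encode (j, prod_encode (a, b)))"

definition fm_step :: "nat \<Rightarrow> nat \<Rightarrow> nat \<Rightarrow> bool" where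
  "fm_step x y z \<longleftrightarrow> (x = cNeg y \<and> z = y) \<or> x = cAnd y z \<or> x = cOr y z \<or> x = cImp y z \<or>
    (x = cAll y \<and> z = y) \<or> (x = cEx y \<and> z = y)"

definition fm_code :: "nat \<Rightarrow> bool" where
  "fm_code = Ind fm_base fm_step"

lemma fm_code_iff: "fm_code x \<longleftrightarrow> (\<exists>p. x = gn p)"
proof
  assume "fm_code x"
  then show "\<exists>p. x = gn p" unfolding fm_code_def
  proof induction
    case (base x)
    then obtain s t j where "x = prod_encode (j, prod_encode (gnt s, gnt t))" "j < 2"
      unfolding fm_base_def tm_code_iff by blast
    then have "x = gn (Eq s t) \<or> x = gn (Less s t)" by (auto simp: less_2_cases_iff)
    then show ?case by blast
  next
    case (step x y z)
    then obtain p q where "y = gn p" "z = gn q" by blast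
    then show ?case using step.hyps(1) unfolding fm_step_def by (metis code_simps)
  qed
next
  have "Ind fm_base fm_step (gn p)" for p
  proof (induction p)
    case (Neg p)
    show ?case by (rule Ind.step[OF _ Neg Neg]) (simp add: fm_step_def)
  next
    case (And p q)
    show ?case by (rule Ind.step[OF _ And]) (simp add: fm_step_def)
  next
    case (Or p q)
    show ?case by (rule Ind.step[OF _ Or]) (simp add: fm_step_def)
  next
    case (Imp p q)
    show ?case by (rule Ind.step[OF _ Imp]) (simp add: fm_step_def)
  next
    case (Forall p)
    show ?case by (rule Ind.step[OF _ Forall Forall]) (simp add: fm_step_def)
  next
    case (Exists p)
    show ?case by (rule Ind.step[OF _ Exists Exists]) (simp add: fm_step_def)
  next
    case (Eq s t)
    show ?case by (rule Ind.base) (auto simp: fm_base_def tm_code_iff)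
  next
    case (Less s t)
    show ?case by (rule Ind.base) (auto simp: fm_base_def tm_code_iff)
  qed
  then show "\<exists>p. x = gn p \<Longrightarrow> fm_code x" by (auto simp: fm_code_def)
qed

lemma Sig_fm_code [Sig_intros]: "SigF n F \<Longrightarrow> Sig n (\<lambda>e. fm_code (F e))"
  by (rule Sig_app1, unfold fm_code_def, rule Sig_Ind0, unfold fm_base_def fm_step_def)
    (intro Sig_intros; simp)+

subsection \<open>Lifting and substitution\<close>

text \<open>Both operations are handled at once: \<open>None\<close> stands for lifting, \<open>Some s\<close> for substituting
  \<open>s\<close>. A tuple \<open>(m, k, c, d)\<close> says that the operation \<open>m\<close> at index \<open>k\<close> takes \<open>c\<close> to \<open>d\<close>.\<close>

definition opt :: "tm option \<Rightarrow> tm \<Rightarrow> nat \<Rightarrow> tm" where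
  "opt m t k = (case m of None \<Rightarrow> liftt t k | Some s \<Rightarrow> substt t s k)"

definition opf :: "tm option \<Rightarrow> fm \<Rightarrow> nat \<Rightarrow> fm" where
  "opf m p k = (case m of None \<Rightarrow> lift p k | Some s \<Rightarrow> subst p s k)"

definition ocode :: "tm option \<Rightarrow> nat" where
  "ocode m = (case m of None \<Rightarrow> 0 | Some s \<Rightarrow> Suc (gnt s))"

definition tup :: "nat \<Rightarrow> nat \<Rightarrow> nat \<Rightarrow> nat \<Rightarrow> nat" where
  "tup m k c d = prod_encode (m, prod_encode (k, prod_encode (c, d)))"

lemma tup_eq [simp]: "tup m k c d = tup m' k' c' d' \<longleftrightarrow> m = m' \<and> k = k' \<and> c = c' \<and> d = d'"
  by (simp add: tup_def)

lemma SigF_tup [Sig_intros]: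
  "SigF n F \<Longrightarrow> SigF n G \<Longrightarrow> SigF n H \<Longrightarrow> SigF n K \<Longrightarrow> SigF n (\<lambda>e. tup (F e) (G e) (H e) (K e))"
  unfolding tup_def by (intro Sig_intros)

text \<open>The clauses treat a variable below \<open>k\<close>, a lifted variable, the replaced
  variable (\<open>m = Suc d\<close> says that \<open>d\<close> codes the substituted term), a
  variable above \<open>k\<close> whose index drops, and zero.\<close>

definition opt_base :: "nat \<Rightarrow> bool" where
  "opt_base x \<longleftrightarrow> (\<exists>m k c d. x = tup m k c d \<and>
    ((\<exists>i. c = prod_encode (0, i) \<and> i < k \<and> d = c) \<or>
     (\<exists>i. c = prod_encode (0, i) \<and> m = 0 \<and> k < Suc i \<and> d = prod_encode (0, Suc i)) \<or>
     (c = prod_encode (0, k) \<and> m = Suc d) \<or>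
     (\<exists>i s. c = prod_encode (0, Suc i) \<and> m = Suc s \<and> k < Suc i \<and> d = prod_encode (0, i)) \<or>
     (c = prod_encode (1, 0) \<and> d = c)))"

definition opt_step :: "nat \<Rightarrow> nat \<Rightarrow> nat \<Rightarrow> bool" where
  "opt_step x y z \<longleftrightarrow> (\<exists>m k a a' b b'. y = tup m k a a' \<and> z = tup m k b b' \<and>
    ((z = y \<and> x = tup m k (prod_encode (2, a)) (prod_encode (2, a'))) \<or>
     x = tup m k (prod_encode (3, prod_encode (a, b))) (prod_encode (3, prod_encode (a', b'))) \<or>
     x = tup m k (prod_encode (4, prod_encode (a, b))) (prod_encode (4, prod_encode (a', b')))))"

definition opt_code :: "nat \<Rightarrow> bool" where
  "opt_code = Ind opt_base opt_step"

text \<open>The recursion equations are read off by inverting \<open>Ind\<close> at the code of each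
  kind of term; as \<open>d\<close> is arbitrary, this includes uniqueness of the result.\<close>

lemma opt_code_iff: "opt_code (tup (ocode m) k (gnt t) d) \<longleftrightarrow> d = gnt (opt m t k)"
proof (induction t arbitrary: d)
  case (Var i)
  show ?case unfolding opt_code_def
    by (subst Ind.simps, cases i)
      (auto simp: opt_base_def opt_step_def opt_def ocode_def split: option.splits)
next
  case Zero
  show ?case unfolding opt_code_def
    by (subst Ind.simps) (auto simp: opt_base_def opt_step_def opt_def split: option.splits)
next
  case (Succ t)
  have "opt_code (tup (ocode m) k (gnt (Succ t)) d) \<longleftrightarrow>
    (\<exists>a'. opt_code (tup (ocode m) k (gnt t) a') \<and> d = prod_encode (2, a'))"
    unfolding opt_code_def by (subst Ind.simps) (auto simp: opt_base_def opt_step_def)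
  then show ?case by (simp add: Succ opt_def split: option.splits)
next
  case (Add s t)
  have "opt_code (tup (ocode m) k (gnt (Add s t)) d) \<longleftrightarrow>
    (\<exists>a' b'. opt_code (tup (ocode m) k (gnt s) a') \<and> opt_code (tup (ocode m) k (gnt t) b') \<and>
      d = prod_encode (3, prod_encode (a', b')))"
    unfolding opt_code_def by (subst Ind.simps) (auto simp: opt_base_def opt_step_def)
  then show ?case by (simp add: Add opt_def split: option.splits)
next
  case (Mult s t)
  have "opt_code (tup (ocode m) k (gnt (Mult s t)) d) \<longleftrightarrow>
    (\<exists>a' b'. opt_code (tup (ocode m) k (gnt s) a') \<and> opt_code (tup (ocode m) k (gnt t) b') \<and>
      d = prod_encode (4, prod_encode (a', b')))"
    unfolding opt_code_def by (subst Ind.simps) (auto simp: opt_base_def opt_step_def)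
  then show ?case by (simp add: Mult opt_def split: option.splits)
qed

lemma Sig_opt_code [Sig_intros]: "SigF n F \<Longrightarrow> Sig n (\<lambda>e. opt_code (F e))"
  by (rule Sig_app1, unfold opt_code_def, rule Sig_Ind0, unfold opt_base_def opt_step_def)
    (intro Sig_intros; simp)+

definition opf_base :: "nat \<Rightarrow> bool" where
  "opf_base x \<longleftrightarrow> (\<exists>m k a a' b b' j. opt_code (tup m k a a') \<and> opt_code (tup m k b b') \<and> j < 2 \<and>
    x = tup m k (prod_encode (j, prod_encode (a, b))) (prod_encode (j, prod_encode (a', b'))))"

text \<open>In the quantifier clause the premise \<open>y\<close> concerns the scope: its index is
  \<open>Suc l\<close>, and the term \<open>s'\<close> of its operation \<open>m\<close> is the
  lifting of the term \<open>s\<close> of the outer operation \<open>n\<close>. Having the operation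
  in the tuple allows it to change in this way.\<close>

definition opf_step :: "nat \<Rightarrow> nat \<Rightarrow> nat \<Rightarrow> bool" where
  "opf_step x y z \<longleftrightarrow> (\<exists>m k a a' b b'. y = tup m k a a' \<and> z = tup m k b b' \<and>
    ((z = y \<and> x = tup m k (cNeg a) (cNeg a')) \<or> x = tup m k (cAnd a b) (cAnd a' b') \<or>
     x = tup m k (cOr a b) (cOr a' b') \<or> x = tup m k (cImp a b) (cImp a' b') \<or>
     (\<exists>l n. k = Suc l \<and> z = y \<and>
       ((n = 0 \<and> m = 0) \<or> (\<exists>s s'. n = Suc s \<and> m = Suc s' \<and> opt_code (tup 0 0 s s'))) \<and>
       (x = tup n l (cAll a) (cAll a') \<or> x = tup n l (cEx a) (cEx a')))))"

definition opf_code :: "nat \<Rightarrow> bool" where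
  "opf_code = Ind opf_base opf_step"

definition lift_opt :: "tm option \<Rightarrow> tm option" where
  "lift_opt m = map_option (\<lambda>s. liftt s 0) m"

lemma lift_opt_code:
  "(ocode m = 0 \<and> n = 0) \<or> (\<exists>s s'. ocode m = Suc s \<and> n = Suc s' \<and> opt_code (tup 0 0 s s'))
    \<longleftrightarrow> n = ocode (lift_opt m)"
  using opt_code_iff[of None 0] by (auto simp: ocode_def lift_opt_def opt_def split: option.splits)

lemma opf_code_binary:
  assumes "d \<in> {cAnd, cOr, cImp}"
  shows "opf_code (tup n k (d p q) r) \<longleftrightarrow>
    (\<exists>a' b'. opf_code (tup n k p a') \<and> opf_code (tup n k q b') \<and> r = d a' b')"
  using assms unfolding opf_code_def
  by (subst Ind.simps) (auto simp: opf_base_def opf_step_def code_defs)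

lemma opf_code_unary:
  "opf_code (tup n k (cNeg p) r) \<longleftrightarrow> (\<exists>a'. opf_code (tup n k p a') \<and> r = cNeg a')"
  unfolding opf_code_def by (subst Ind.simps) (auto simp: opf_base_def opf_step_def code_defs)

lemma opf_code_quantifier:
  assumes "d \<in> {cAll, cEx}"
  shows "opf_code (tup (ocode m) k (d p) r) \<longleftrightarrow>
    (\<exists>a'. opf_code (tup (ocode (lift_opt m)) (Suc k) p a') \<and> r = d a')"
proof -
  have "opf_code (tup (ocode m) k (d p) r) \<longleftrightarrow> (\<exists>a' n. opf_code (tup n (Suc k) p a') \<and> r = d a' \<and>
    ((ocode m = 0 \<and> n = 0) \<or> (\<exists>s s'. ocode m = Suc s \<and> n = Suc s' \<and> opt_code (tup 0 0 s s'))))"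
    using assms unfolding opf_code_def
    by (subst Ind.simps, auto simp: opf_base_def opf_step_def code_defs) blast+
  then show ?thesis unfolding lift_opt_code by auto
qed

lemma opf_code_atom:
  assumes "j < 2"
  shows "opf_code (tup (ocode m) k (prod_encode (j, prod_encode (gnt s, gnt t))) r) \<longleftrightarrow>
    r = prod_encode (j, prod_encode (gnt (opt m s k), gnt (opt m t k)))"
  unfolding opf_code_def opt_code_iff[symmetric]
  using assms by (subst Ind.simps) (auto simp: opf_base_def opf_step_def code_defs opt_code_iff)

lemma opf_code_iff: "opf_code (tup (ocode m) k (gn p) d) \<longleftrightarrow> d = gn (opf m p k)"
proof (induction p arbitrary: m k d)
  case (Eq s t)
  show ?case using opf_code_atom[of 0] by (simp add: opf_def opt_def split: option.splits)
next
  case (Less s t)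
  show ?case using opf_code_atom[of 1] by (simp add: opf_def opt_def split: option.splits)
next
  case (Neg p)
  show ?case using opf_code_unary[of "ocode m" k "gn p" d]
    by (simp add: Neg) (simp add: opf_def split: option.splits)
next
  case (And p q)
  show ?case using opf_code_binary[of cAnd "ocode m" k "gn p" "gn q" d]
    by (simp add: And) (simp add: opf_def split: option.splits)
next
  case (Or p q)
  show ?case using opf_code_binary[of cOr "ocode m" k "gn p" "gn q" d]
    by (simp add: Or) (simp add: opf_def split: option.splits)
next
  case (Imp p q)
  show ?case using opf_code_binary[of cImp "ocode m" k "gn p" "gn q" d]
    by (simp add: Imp) (simp add: opf_def split: option.splits)
next
  case (Forall p)
  show ?case using opf_code_quantifier[of cAll m k "gn p" d]
    by (simp add: Forall) (simp add: opf_def lift_opt_def split: option.splits)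
next
  case (Exists p)
  show ?case using opf_code_quantifier[of cEx m k "gn p" d]
    by (simp add: Exists) (simp add: opf_def lift_opt_def split: option.splits)
qed

lemma Sig_opf_code [Sig_intros]: "SigF n F \<Longrightarrow> Sig n (\<lambda>e. opf_code (F e))"
  by (rule Sig_app1, unfold opf_code_def, rule Sig_Ind0, unfold opf_base_def opf_step_def)
    (intro Sig_intros; simp)+

lemma lift_code_iff: "opf_code (tup 0 0 (gn p) d) \<longleftrightarrow> d = gn (lift p 0)"
  using opf_code_iff[of None] by (simp add: ocode_def opf_def)

lemma subst_code_iff: "opf_code (tup (Suc (gnt s)) 0 (gn p) d) \<longleftrightarrow> d = gn (subst p s 0)"
  using opf_code_iff[of "Some s"] by (simp add: ocode_def opf_def)

subsection \<open>Provability\<close>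

text \<open>The schemata are grouped by the kind of their parameters; \<open>c\<close> and
  \<open>d\<close> are codes of lifted or substituted formulas.\<close>

definition prv_base :: "fm set \<Rightarrow> nat \<Rightarrow> bool" where
  "prv_base T x \<longleftrightarrow> x \<in> gn ` T \<or>
    (\<exists>p q. fm_code p \<and> fm_code q \<and> (x = cImp p (cImp q p) \<or> x = cImp p (cImp q (cAnd p q)) \<or>
      x = cImp (cAnd p q) p \<or> x = cImp (cAnd p q) q \<or> x = cImp p (cOr p q) \<or> x = cImp q (cOr p q) \<or>
      x = cImp (cImp p q) (cImp (cImp p (cNeg q)) (cNeg p)) \<or> x = cImp (cNeg (cNeg p)) p)) \<or>
    (\<exists>p q r. fm_code p \<and> fm_code q \<and> fm_code r \<and>
      (x = cImp (cImp p (cImp q r)) (cImp (cImp p q) (cImp p r)) \<or>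
       x = cImp (cImp p r) (cImp (cImp q r) (cImp (cOr p q) r)))) \<or>
    (\<exists>p t c. fm_code p \<and> tm_code t \<and> opf_code (tup (Suc t) 0 p c) \<and>
      (x = cImp (cAll p) c \<or> x = cImp c (cEx p))) \<or>
    (\<exists>p q c. fm_code p \<and> fm_code q \<and> opf_code (tup 0 0 p c) \<and>
      (x = cImp (cAll (cImp c q)) (cImp p (cAll q)) \<or> x = cImp (cAll (cImp q c)) (cImp (cEx q) p))) \<or>
    (\<exists>t. tm_code t \<and> x = cEq t t) \<or>
    (\<exists>s t p c d. tm_code s \<and> tm_code t \<and> fm_code p \<and> opf_code (tup (Suc s) 0 p c) \<and>
      opf_code (tup (Suc t) 0 p d) \<and> x = cImp (cEq s t) (cImp c d))"

definition prv_step :: "nat \<Rightarrow> nat \<Rightarrow> nat \<Rightarrow> bool" where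
  "prv_step x y z \<longleftrightarrow> y = cImp z x \<or> (x = cAll y \<and> z = y)"

definition prv_code :: "fm set \<Rightarrow> nat \<Rightarrow> bool" where
  "prv_code T = Ind (prv_base T) prv_step"

lemma prv_base_sound: "prv_base T x \<Longrightarrow> \<exists>p. x = gn p \<and> T \<turnstile> p"
  unfolding prv_base_def fm_code_iff tm_code_iff
  by (elim disjE exE conjE imageE; hypsubst_thin?;
      (simp only: code_simps lift_code_iff subst_code_iff)?; hypsubst_thin?;
      (simp only: code_simps)?; rule exI, rule conjI, rule refl;
      (rule prv.Ax, assumption | rule prv.intros(4-19)))

lemma prv_base_complete:
  "p \<in> T \<Longrightarrow> prv_base T (gn p)"
  "prv_base T (gn (Imp p (Imp q p)))"
  "prv_base T (gn (Imp p (Imp q (And p q))))"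
  "prv_base T (gn (Imp (And p q) p))" "prv_base T (gn (Imp (And p q) q))"
  "prv_base T (gn (Imp p (Or p q)))" "prv_base T (gn (Imp q (Or p q)))"
  "prv_base T (gn (Imp (Imp p q) (Imp (Imp p (Neg q)) (Neg p))))" "prv_base T (gn (Imp (Neg (Neg p)) p))"
  "prv_base T (gn (Imp (Imp p (Imp q r)) (Imp (Imp p q) (Imp p r))))"
  "prv_base T (gn (Imp (Imp p r) (Imp (Imp q r) (Imp (Or p q) r))))"
  "prv_base T (gn (Imp (Forall p) (subst p t 0)))"
  "prv_base T (gn (Imp (subst p t 0) (Exists p)))"
  "prv_base T (gn (Imp (Forall (Imp (lift p 0) q)) (Imp p (Forall q))))"
  "prv_base T (gn (Imp (Forall (Imp p (lift q 0))) (Imp (Exists p) q)))"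
  "prv_base T (gn (Eq t t))" "prv_base T (gn (Imp (Eq s t) (Imp (subst p s 0) (subst p t 0))))"
proof -
  show "p \<in> T \<Longrightarrow> prv_base T (gn p)" by (simp add: prv_base_def)
  show "prv_base T (gn (Imp p (Imp q p)))"
    "prv_base T (gn (Imp p (Imp q (And p q))))"
    "prv_base T (gn (Imp (And p q) p))" "prv_base T (gn (Imp (And p q) q))"
    "prv_base T (gn (Imp p (Or p q)))" "prv_base T (gn (Imp q (Or p q)))"
    "prv_base T (gn (Imp (Imp p q) (Imp (Imp p (Neg q)) (Neg p))))"
    "prv_base T (gn (Imp (Neg (Neg p)) p))"
    unfolding prv_base_def fm_code_iff
    by (rule disjI2, rule disjI1, rule exI[of _ "gn p"], rule exI[of _ "gn q"], simp add: gn_inject code_defs)+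
  show "prv_base T (gn (Imp (Imp p (Imp q r)) (Imp (Imp p q) (Imp p r))))"
    "prv_base T (gn (Imp (Imp p r) (Imp (Imp q r) (Imp (Or p q) r))))"
    unfolding prv_base_def fm_code_iff
    by (rule disjI2, rule disjI2, rule disjI1, rule exI[of _ "gn p"], rule exI[of _ "gn q"],
        rule exI[of _ "gn r"], simp add: gn_inject code_defs)+
  show "prv_base T (gn (Imp (Forall p) (subst p t 0)))" "prv_base T (gn (Imp (subst p t 0) (Exists p)))"
    unfolding prv_base_def fm_code_iff tm_code_iff
    by (rule disjI2, rule disjI2, rule disjI2, rule disjI1, rule exI[of _ "gn p"], rule exI[of _ "gnt t"],
        rule exI[of _ "gn (subst p t 0)"], simp add: subst_code_iff gn_inject gnt_inject code_defs)+
  show "prv_base T (gn (Imp (Forall (Imp (lift p 0) q)) (Imp p (Forall q))))"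
    unfolding prv_base_def fm_code_iff tm_code_iff
    by (rule disjI2, rule disjI2, rule disjI2, rule disjI2, rule disjI1, rule exI[of _ "gn p"],
        rule exI[of _ "gn q"], rule exI[of _ "gn (lift p 0)"], simp add: lift_code_iff gn_inject code_defs)
  show "prv_base T (gn (Imp (Forall (Imp p (lift q 0))) (Imp (Exists p) q)))"
    unfolding prv_base_def fm_code_iff tm_code_iff
    by (rule disjI2, rule disjI2, rule disjI2, rule disjI2, rule disjI1, rule exI[of _ "gn q"],
        rule exI[of _ "gn p"], rule exI[of _ "gn (lift q 0)"], simp add: lift_code_iff gn_inject code_defs)
  show "prv_base T (gn (Eq t t))"
    unfolding prv_base_def fm_code_iff tm_code_iff
    by (rule disjI2, rule disjI2, rule disjI2, rule disjI2, rule disjI2, rule disjI1,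
        rule exI[of _ "gnt t"], simp add: gnt_inject code_defs)
  show "prv_base T (gn (Imp (Eq s t) (Imp (subst p s 0) (subst p t 0))))"
    unfolding prv_base_def fm_code_iff tm_code_iff
    by (rule disjI2, rule disjI2, rule disjI2, rule disjI2, rule disjI2, rule disjI2,
        rule exI[of _ "gnt s"], rule exI[of _ "gnt t"], rule exI[of _ "gn p"],
        rule exI[of _ "gn (subst p s 0)"], rule exI[of _ "gn (subst p t 0)"],
        simp add: subst_code_iff gn_inject gnt_inject code_defs)
qed

lemma prv_code_iff: "prv_code T x \<longleftrightarrow> (\<exists>p. x = gn p \<and> T \<turnstile> p)"
proof
  assume "prv_code T x"
  then show "\<exists>p. x = gn p \<and> T \<turnstile> p" unfolding prv_code_def
  proof induction
    case (base x)
    then show ?case by (rule prv_base_sound)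
  next
    case (step x y z)
    then obtain p q where pq: "y = gn p" "T \<turnstile> p" "z = gn q" "T \<turnstile> q" by blast
    from step.hyps(1) show ?case unfolding prv_step_def
    proof
      assume "y = cImp z x"
      \<comment> \<open>The tag 5 forces \<open>p\<close> to be an implication, so \<open>x\<close>
        is the code of a formula.\<close>
      then have "gn p = prod_encode (5, prod_encode (gn q, x))" by (simp add: pq cImp_def)
      then obtain r where "p = Imp q r" "x = gn r" by (cases p) (auto simp: gn_inject)
      then show ?thesis using pq prv.MP by blast
    next
      assume "x = cAll y \<and> z = y"
      then have "x = gn (Forall p)" using pq by simp
      then show ?thesis using pq prv.Gen by blast
    qed
  qed
next
  have "Ind (prv_base T) prv_step (gn p)" if "T \<turnstile> p" for p
    using that
  proof induction
    case (MP p q)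
    show ?case by (rule Ind.step[OF _ MP.IH]) (simp add: prv_step_def)
  next
    case (Gen p)
    show ?case by (rule Ind.step[OF _ Gen.IH Gen.IH]) (simp add: prv_step_def)
  qed (rule Ind.base, rule prv_base_complete, assumption?)+
  then show "\<exists>p. x = gn p \<and> T \<turnstile> p \<Longrightarrow> prv_code T x" by (auto simp: prv_code_def)
qed

lemma Sig_axioms:
  assumes "prim_rec_theory T" "SigF n F"
  shows "Sig n (\<lambda>e. F e \<in> gn ` T)"
proof -
  obtain f where f: "prim_rec 1 f" "\<And>n. f [n] = (if n \<in> gn ` T then 1 else 0)"
    using assms(1) by (auto simp: prim_rec_theory_def prim_rec_set_def)
  have "SigF 1 (\<lambda>e. f [e 0])" using SigF_prim_rec[OF f(1)] by simp
  then have "Sig 1 (\<lambda>e. f [e 0] = 1)" by (intro Sig_intros)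
  then have "Sig n (\<lambda>e. f [F e] = 1)" by (rule Sig_app1[OF _ assms(2), where R = "\<lambda>x. f [x] = 1"])
  then show ?thesis by (rule Sig_cong) (simp add: f(2))
qed

lemma Sig_prv_code:
  assumes "prim_rec_theory T" "SigF n F"
  shows "Sig n (\<lambda>e. prv_code T (F e))"
  by (rule Sig_app1[OF _ assms(2)], unfold prv_code_def, rule Sig_Ind0, unfold prv_base_def prv_step_def)
    (intro Sig_intros Sig_axioms[OF assms(1)]; simp)+

subsection \<open>Refuting a finite approximation of a set\<close>

text \<open>The first free variable of \<open>\<theta>\<close> is set to the code of \<open>\<theta>\<close> itself.\<close>

definition inst :: "fm \<Rightarrow> nat \<Rightarrow> fm" where
  "inst \<theta> x = Exists (Exists (And (Eq (Var 0) (num (gn \<theta>))) (And (Eq (Var 1) (num x)) \<theta>)))"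

text \<open>\<open>chain \<theta> s k\<close> says that \<open>inst \<theta>\<close> and the set coded by \<open>s\<close> differ below \<open>k\<close>.\<close>

primrec chain :: "fm \<Rightarrow> nat \<Rightarrow> nat \<Rightarrow> fm" where
  "chain \<theta> s 0 = Eq Zero (Succ Zero)"
| "chain \<theta> s (Suc x) = Imp (if mem x s then inst \<theta> x else Neg (inst \<theta> x)) (chain \<theta> s x)"

text \<open>Because \<open>inst\<close> fixes its variables by equations instead of substituting,
  its code is assembled from the code of \<open>\<theta>\<close> by pairings and codes of numerals.
  The pairs \<open>(0, 0)\<close> and \<open>(0, 1)\<close> code the two variables.\<close>

definition cInst :: "nat \<Rightarrow> nat \<Rightarrow> nat" where
  "cInst i x = cEx (cEx (cAnd (cEq (prod_encode (0, 0)) (gnt (num i)))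
    (cAnd (cEq (prod_encode (0, 1)) (gnt (num x))) i)))"

definition cChain :: "nat \<Rightarrow> nat \<Rightarrow> nat \<Rightarrow> nat" where
  "cChain i s k = rec_nat (gn (Eq Zero (Succ Zero)))
    (\<lambda>x r. cImp (if mem x s then cInst i x else cNeg (cInst i x)) r) k"

lemma cInst: "cInst (gn \<theta>) x = gn (inst \<theta> x)"
  by (simp add: cInst_def inst_def code_defs)

lemma cChain: "cChain (gn \<theta>) s k = gn (chain \<theta> s k)"
  by (induction k) (simp_all add: cChain_def cInst code_defs)

lemma SigF_num [Sig_intros]: "SigF n F \<Longrightarrow> SigF n (\<lambda>e. gnt (num (F e)))"
proof -
  have "gnt (num k) = rec_nat (prod_encode (1, 0)) (\<lambda>_ r. prod_encode (2, r)) k" for k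
    by (induction k) (simp_all add: num_def)
  moreover have "SigF 1 (\<lambda>e. rec_nat (prod_encode (1, 0)) (\<lambda>_ r. prod_encode (2, r)) (e 0))"
    by (rule SigF_rec) (intro Sig_intros; simp)+
  ultimately have "SigF 1 (\<lambda>e. gnt (num (e 0)))" by simp
  then show "SigF n F \<Longrightarrow> SigF n (\<lambda>e. gnt (num (F e)))" by (rule SigF_app1)
qed

lemma SigF_if_mem:
  assumes "SigF n X" "SigF n S" "SigF n F" "SigF n G"
  shows "SigF n (\<lambda>e. if mem (X e) (S e) then F e else G e)"
proof -
  have "Sig (Suc n) (\<lambda>e. (mem (X (\<lambda>i. e (Suc i))) (S (\<lambda>i. e (Suc i))) \<and> e 0 = F (\<lambda>i. e (Suc i))) \<or>
    (\<not> mem (X (\<lambda>i. e (Suc i))) (S (\<lambda>i. e (Suc i))) \<and> e 0 = G (\<lambda>i. e (Suc i))))"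
    by (intro Sig_intros SigF_Suc_env assms) simp_all
  then show ?thesis unfolding SigF_def by (rule Sig_cong) auto
qed

lemma SigF_cChain: "SigF 3 (\<lambda>e. cChain (e 0) (e 1) (e 2))"
  unfolding cChain_def cInst_def
  by (rule SigF_rec; intro Sig_intros SigF_if_mem; simp)

lemma Sig_refutes: "prim_rec_theory T \<Longrightarrow> Sig 3 (\<lambda>e. prv_code T (cChain (e 0) (e 1) (e 2)))"
  by (rule Sig_prv_code[OF _ SigF_cChain])

section \<open>The provability predicate\<close>

text \<open>The small numbers at stage \<open>w\<close> form an initial segment so short that, in
  \<open>NN\<close>, each of its subsets has a code below \<open>w\<close>. This turns
  quantification over sets into bounded quantification.\<close>

definition smallM :: "model \<Rightarrow> nat \<Rightarrow> nat \<Rightarrow> bool" where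
  "smallM M x w \<longleftrightarrow> (\<exists>y. ls M y w \<and> ls M x y \<and> (\<exists>z. ls M z w \<and> fullM M y z))"

text \<open>The graph of \<open>cImp\<close>, for use in any model; 5 is the tag of implications in
  \<open>gn\<close>.\<close>

definition impM :: "model \<Rightarrow> nat \<Rightarrow> nat \<Rightarrow> nat \<Rightarrow> bool" where
  "impM M a b c \<longleftrightarrow> (\<exists>d. ls M d (su M c) \<and> peM M d a b \<and> peM M c (nu M 5) d)"

definition agreeM :: "model \<Rightarrow> nat \<Rightarrow> nat \<Rightarrow> nat \<Rightarrow> bool" where
  "agreeM M w v v' \<longleftrightarrow> (\<forall>x. ls M x w \<longrightarrow> smallM M x w \<longrightarrow> (memM M x v \<longleftrightarrow> memM M x v'))"

text \<open>In the standard model every set agrees at stage \<open>w\<close> with one coded below \<open>w\<close>, so that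
  \<open>failM\<close> never holds there.\<close>

definition failM :: "model \<Rightarrow> nat \<Rightarrow> bool" where
  "failM M w \<longleftrightarrow> (\<exists>w1. ls M w1 w \<and> (\<exists>x. ls M x w1 \<and> smallM M x w1) \<and>
    (\<exists>v. ls M v w \<and> (\<forall>v'. ls M v' w1 \<longrightarrow> \<not> agreeM M w1 v' v)))"

lemma Del_smallM [Del_intros]: "Tm n F \<Longrightarrow> Tm n G \<Longrightarrow> Del n (\<lambda>M e. smallM M (F M e) (G M e))"
  by (rule Del_app2) (unfold smallM_def, intro Del_intros, simp_all)

lemma Del_impM [Del_intros]:
  "Tm n F \<Longrightarrow> Tm n G \<Longrightarrow> Tm n H \<Longrightarrow> Del n (\<lambda>M e. impM M (F M e) (G M e) (H M e))"
  by (rule Del_app3) (unfold impM_def, intro Del_intros, simp_all)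

lemma Del_agreeM [Del_intros]:
  "Tm n F \<Longrightarrow> Tm n G \<Longrightarrow> Tm n H \<Longrightarrow> Del n (\<lambda>M e. agreeM M (F M e) (G M e) (H M e))"
  by (rule Del_app3) (unfold agreeM_def, intro Del_intros, simp_all)

lemma Del_failM [Del_intros]: "Tm n F \<Longrightarrow> Del n (\<lambda>M e. failM M (F M e))"
  by (rule Del_app1) (unfold failM_def, intro Del_intros, simp_all)

lemma impM_NN: "impM NN a b c \<longleftrightarrow> c = cImp a b"
  by (auto simp: impM_def peM_NN cImp_def less_Suc_eq_le intro: le_prod_encode_2)

context pa_model begin

lemma abs2: "Del 2 (\<lambda>M e. R M (e 0) (e 1)) \<Longrightarrow> R M (nu M a) (nu M b) \<longleftrightarrow> R NN a b"
  using Del_absolute[of 2 "\<lambda>M e. R M (e 0) (e 1)" "case_nat a (\<lambda>_. b)"] by simp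

lemma abs3: "Del 3 (\<lambda>M e. R M (e 0) (e 1) (e 2)) \<Longrightarrow> R M (nu M a) (nu M b) (nu M c) \<longleftrightarrow> R NN a b c"
  using Del_absolute[of 3 "\<lambda>M e. R M (e 0) (e 1) (e 2)" "case_nat a (case_nat b (\<lambda>_. c))"]
  by (simp add: numeral_2_eq_2)

lemma small_nu: "smallM M (nu M x) (nu M w) \<longleftrightarrow> smallM NN x w"
  by (rule abs2) (intro Del_intros; simp)

lemma mem_nu: "memM M (nu M x) (nu M s) \<longleftrightarrow> mem x s"
  using abs2[of memM] by (simp add: Del_intros)

lemma imp_nu: "impM M (nu M a) (nu M b) (nu M (cImp a b))"
  by (subst abs3[of impM]) (simp_all add: Del_intros impM_NN)

lemma small_ls: "smallM M x w \<Longrightarrow> ls M x w"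
  unfolding smallM_def using ls_trans by blast

lemma small_mono: "smallM M x w \<Longrightarrow> ls M w w' \<Longrightarrow> smallM M x w'"
  unfolding smallM_def using ls_trans by blast

lemma small_antimono: "smallM M x w \<Longrightarrow> ls M y x \<Longrightarrow> smallM M y w"
  unfolding smallM_def using ls_trans by blast

lemma fail_mono: "failM M w \<Longrightarrow> ls M w w' \<Longrightarrow> failM M w'"
  unfolding failM_def using ls_trans by blast

lemma agree_iff: "agreeM M w v v' \<Longrightarrow> smallM M x w \<Longrightarrow> memM M x v \<longleftrightarrow> memM M x v'"
  unfolding agreeM_def using small_ls by blast

lemma not_failM:
  assumes "\<not> failM M w" "ls M w1 w" "ls M v w" "smallM M x w1"
  obtains v' where "ls M v' w1" "agreeM M w1 v' v"
  using assms small_ls[OF assms(4)] unfolding failM_def by blast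

end

interpretation NN: pa_model NN
  by unfold_locales (rule NN_models_PA)

lemma small_NN_ex: "\<exists>w. smallM NN n w"
proof -
  obtain z where "fullM NN (Suc n) z" using full_ex by blast
  then show ?thesis unfolding smallM_def
    by (intro exI[of _ "Suc (Suc (n + z))"] exI[of _ "Suc n"] conjI exI[of _ z]) auto
qed

text \<open>All small numbers lie below the largest element of \<open>?K\<close>, and a code for
  that bound serves them all. The existence of a small number makes \<open>?K\<close> nonempty;
  without it there might be no code below \<open>w\<close> at all, as for
  \<open>w = 0\<close>.\<close>

lemma small_NN_code:
  assumes "smallM NN x w"
  shows "\<exists>v<w. \<forall>x. smallM NN x w \<longrightarrow> (mem x v \<longleftrightarrow> x \<in> X)"
proof -
  let ?K = "{y. y < w \<and> (\<exists>z<w. fullM NN y z)}"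
  have fin: "finite ?K" by simp
  have "?K \<noteq> {}" using assms by (auto simp: smallM_def)
  then have "Max ?K \<in> ?K" by (rule Max_in[OF fin])
  then obtain z where z: "z < w" "fullM NN (Max ?K) z" by blast
  obtain v where v: "v < z" "\<And>x. x < Max ?K \<Longrightarrow> mem x v \<longleftrightarrow> x \<in> X" using full_code[OF z(2)] by blast
  have "x < Max ?K" if small: "smallM NN x w" for x
  proof -
    obtain y where "y \<in> ?K" "x < y" using small by (auto simp: smallM_def)
    then show ?thesis using Max_ge[OF fin, of y] by linarith
  qed
  then show ?thesis using v z(1) by (intro exI[of _ v]) simp
qed

lemma not_failM_NN: "\<not> failM NN w"
proof
  assume "failM NN w"
  then obtain w1 x v where *: "smallM NN x w1" "\<And>v'. v' < w1 \<Longrightarrow> \<not> agreeM NN w1 v' v"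
    by (auto simp: failM_def)
  show False using small_NN_code[OF *(1), of "{x. mem x v}"] *(2) by (auto simp: agreeM_def)
qed

text \<open>\<open>dl\<close> and \<open>rh\<close> are bounded matrices: \<open>u\<close> witnesses
  that \<open>x\<close> codes a theorem of \<open>T\<close>, or that \<open>T\<close> refutes the
  agreement below \<open>k\<close> of a formula, given by its code, with the set \<open>s\<close>.
  Only their standard meaning is prescribed; in other models there may be nonstandard
  witnesses.\<close>

locale race =
  fixes T :: "fm set" and dl :: "model \<Rightarrow> nat \<Rightarrow> nat \<Rightarrow> bool"
    and rh :: "model \<Rightarrow> nat \<Rightarrow> nat \<Rightarrow> nat \<Rightarrow> nat \<Rightarrow> bool"
  assumes T_sentence: "\<forall>p\<in>T. sentence p" and T_PA: "\<And>p. PA \<turnstile> p \<Longrightarrow> T \<turnstile> p"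
    and T_consistent: "consistent T"
    and Del_dl: "Del 2 (\<lambda>M e. dl M (e 0) (e 1))"
    and Del_rh: "Del 4 (\<lambda>M e. rh M (e 0) (e 1) (e 2) (e 3))"
    and dl_NN: "(\<exists>u. dl NN x u) \<longleftrightarrow> (\<exists>p. x = gn p \<and> T \<turnstile> p)"
    and rh_NN: "(\<exists>u. rh NN (gn \<theta>) s k u) \<longleftrightarrow> T \<turnstile> chain \<theta> s k"
begin

text \<open>Both conditions are limited to small numbers, since codes are trusted only there. The
  \<open>ls\<close> guards follow from smallness in models of PA and are there to make the
  quantifiers bounded.\<close>

definition good :: "model \<Rightarrow> nat \<Rightarrow> nat \<Rightarrow> bool" where
  "good M w v \<longleftrightarrow>
    (\<forall>x. ls M x w \<longrightarrow> (\<forall>u. ls M u w \<longrightarrow> smallM M x w \<longrightarrow> smallM M u w \<longrightarrow> dl M x u \<longrightarrow> memM M x v)) \<and>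
    (\<forall>x. ls M x w \<longrightarrow> (\<forall>y. ls M y w \<longrightarrow> (\<forall>z. ls M z w \<longrightarrow> smallM M x w \<longrightarrow> smallM M y w \<longrightarrow>
      smallM M z w \<longrightarrow> impM M x y z \<longrightarrow> memM M z v \<longrightarrow> memM M x v \<longrightarrow> memM M y v)))"

text \<open>\<open>s\<close> carries the refutation and matters only below \<open>k\<close>, whereas
  \<open>e\<close> is the set to stop with and has to be good on all that is small at
  \<open>w\<close>. As \<open>k\<close> is small, stopping with \<open>e\<close> settles
  \<open>Pr\<close> below \<open>k\<close>.\<close>

definition wit :: "model \<Rightarrow> nat \<Rightarrow> nat \<Rightarrow> nat \<Rightarrow> bool" where
  "wit M i w e \<longleftrightarrow> good M w e \<and> (\<exists>k. ls M k w \<and> (\<exists>s. ls M s w \<and> (\<exists>u. ls M u w \<and>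
    smallM M k w \<and> smallM M s w \<and> smallM M u w \<and> rh M i s k u \<and>
    (\<forall>x. ls M x k \<longrightarrow> (memM M x e \<longleftrightarrow> memM M x s)))))"

definition nowit :: "model \<Rightarrow> nat \<Rightarrow> nat \<Rightarrow> bool" where
  "nowit M i w \<longleftrightarrow> (\<forall>w'. ls M w' w \<longrightarrow> (\<forall>e. ls M e w' \<longrightarrow> \<not> wit M i w' e))"

text \<open>Taking the least \<open>e\<close> makes the stopped set unique. A failure at the same
  stage has precedence over the stop.\<close>

definition first :: "model \<Rightarrow> nat \<Rightarrow> nat \<Rightarrow> nat \<Rightarrow> bool" where
  "first M i w e \<longleftrightarrow> wit M i w e \<and> (\<forall>e'. ls M e' e \<longrightarrow> \<not> wit M i w e') \<and> nowit M i w \<and> \<not> failM M w"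

text \<open>The disjuncts are a normal stage, a failure and the stop. In the first, the modus ponens
  closure of the theorems found so far appears as the intersection of all good sets coded below
  \<open>w\<close>, which keeps the condition bounded.\<close>

definition prM_body :: "model \<Rightarrow> nat \<Rightarrow> nat \<Rightarrow> nat \<Rightarrow> bool" where
  "prM_body M w i x \<longleftrightarrow>
    (smallM M x w \<and> (\<forall>v. ls M v w \<longrightarrow> good M w v \<longrightarrow> memM M x v) \<and> nowit M i w \<and>
      (\<forall>e. ls M e w \<longrightarrow> \<not> wit M i w e)) \<or>
    (failM M w \<and> nowit M i w) \<or>
    (\<exists>e. ls M e w \<and> first M i w e \<and> memM M x e)"

definition prM :: "model \<Rightarrow> nat \<Rightarrow> nat \<Rightarrow> bool" where
  "prM M i x \<longleftrightarrow> (\<exists>w. prM_body M w i x)"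

lemma Del_good [Del_intros]: "Tm n F \<Longrightarrow> Tm n G \<Longrightarrow> Del n (\<lambda>M e. good M (F M e) (G M e))"
  by (rule Del_app2) (unfold good_def, intro Del_intros Del_app2[OF Del_dl], simp_all)

lemma Del_wit [Del_intros]:
  "Tm n F \<Longrightarrow> Tm n G \<Longrightarrow> Tm n H \<Longrightarrow> Del n (\<lambda>M e. wit M (F M e) (G M e) (H M e))"
  by (rule Del_app3) (unfold wit_def, intro Del_intros Del_app4[OF Del_rh], simp_all)

lemma Del_nowit [Del_intros]: "Tm n F \<Longrightarrow> Tm n G \<Longrightarrow> Del n (\<lambda>M e. nowit M (F M e) (G M e))"
  by (rule Del_app2) (unfold nowit_def, intro Del_intros, simp_all)

lemma Del_first [Del_intros]:
  "Tm n F \<Longrightarrow> Tm n G \<Longrightarrow> Tm n H \<Longrightarrow> Del n (\<lambda>M e. first M (F M e) (G M e) (H M e))"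
  by (rule Del_app3) (unfold first_def, intro Del_intros, simp_all)

lemma Del_prM_body: "Del 3 (\<lambda>M e. prM_body M (e 0) (e 1) (e 2))"
  unfolding prM_body_def by (intro Del_intros; simp)

definition body :: fm where
  "body = (SOME p. delta0 p \<and> fv p \<subseteq> {..<3} \<and> (\<forall>M e. sat M e p \<longleftrightarrow> prM_body M (e 0) (e 1) (e 2)))"

lemma body: "delta0 body" "fv body \<subseteq> {..<3}" "sat M e body \<longleftrightarrow> prM_body M (e 0) (e 1) (e 2)"
proof -
  have "\<exists>p. delta0 p \<and> fv p \<subseteq> {..<3} \<and> (\<forall>M e. sat M e p \<longleftrightarrow> prM_body M (e 0) (e 1) (e 2))"
    using Del_prM_body by (simp add: Del_def)
  from someI_ex[OF this, folded body_def]
  show "delta0 body" "fv body \<subseteq> {..<3}" "sat M e body \<longleftrightarrow> prM_body M (e 0) (e 1) (e 2)" by blast+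
qed

text \<open>Setting the parameter \<open>i\<close> of \<open>body\<close> to the code of
  \<open>Exists body\<close> closes the self-reference: \<open>rh\<close> at \<open>h\<close> speaks
  about the predicate that is being defined.\<close>

definition h :: nat where
  "h = gn (Exists body)"

text \<open>Its instances have the same truth values as those of \<open>inst (Exists body)\<close>,
  but here all unbounded quantifiers stand in front, as \<open>sigma1\<close> demands;
  \<open>inst\<close> has the form whose code is easily computed.\<close>

definition Pr :: fm where
  "Pr = Exists (Exists (And (Eq (Var 1) (num h)) body))"

lemma sigma1_Pr: "sigma1 Pr"
  unfolding Pr_def by (intro sigma1.intros delta0.intros body)

lemma fv_Pr: "fv Pr \<subseteq> {0}"
proof -
  have "Suc (Suc i) \<in> fv body \<Longrightarrow> i = 0" for i using body(2) by auto
  then show ?thesis by (auto simp: Pr_def)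
qed

lemma sat_Pr: "sat M e (subst Pr (num x) 0) \<longleftrightarrow> prM M (nu M h) (nu M x)"
  by (subst sat_subst) (simp add: Pr_def body(3) prM_def numeral_2_eq_2)

lemma sat_inst: "sat M e (inst (Exists body) x) \<longleftrightarrow> prM M (nu M h) (nu M x)"
  by (simp add: inst_def body(3) prM_def numeral_2_eq_2 h_def)

lemma rh_h: "(\<exists>u. rh NN h s k u) \<longleftrightarrow> T \<turnstile> chain (Exists body) s k"
  unfolding h_def by (rule rh_NN)

lemma sat_chain:
  assumes "pa_model M"
  shows "sat M e (chain (Exists body) s k) \<longleftrightarrow> \<not> (\<forall>x<k. prM M (nu M h) (nu M x) \<longleftrightarrow> mem x s)"
proof -
  interpret pa_model M by fact
  show ?thesis
  proof (induction k)
    case 0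
    show ?case using su_neq_zr[of "zr M"] by (simp add: eq_commute)
  next
    case (Suc k)
    then show ?case by (auto simp: sat_inst less_Suc_eq)
  qed
qed

lemma T_models: "models M T \<Longrightarrow> pa_model M"
proof
  assume "models M T"
  then show "models M PA" unfolding models_def using T_PA[OF prv.Ax] soundness[of T _ M]
    by (simp add: models_def)
qed

lemma T_complete: "\<not> T \<turnstile> p \<Longrightarrow> \<exists>M e. models M T \<and> \<not> sat M e p"
  using completeness[OF T_sentence T_PA[OF prv.Ax]] by metis

lemma T_model: "\<exists>M. models M T"
proof -
  obtain p where "\<not> T \<turnstile> p" using T_consistent by (auto simp: consistent_def)
  then show ?thesis using T_complete by blast
qed

section \<open>Good sets and the stopping stage\<close>

lemma good_thm:
  assumes "pa_model M" "good M w v" "smallM M x w" "smallM M u w" "dl M x u"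
  shows "memM M x v"
  using assms(2-) pa_model.small_ls[OF assms(1,3)] pa_model.small_ls[OF assms(1,4)]
  unfolding good_def by simp

lemma good_mp:
  assumes "pa_model M" "good M w v" "smallM M x w" "smallM M y w" "smallM M z w" "impM M x y z"
    "memM M z v" "memM M x v"
  shows "memM M y v"
proof -
  have "ls M x w" "ls M y w" "ls M z w" using pa_model.small_ls[OF assms(1)] assms(3-5) by simp_all
  then show ?thesis using assms(2-) unfolding good_def by blast
qed

text \<open>Numbers small at \<open>w1\<close> are small at \<open>w\<close>, and goodness depends
  only on the small members; so it passes to an approximation at an earlier stage.\<close>

lemma good_agree:
  assumes "pa_model M" "good M w e" "ls M w1 w" "agreeM M w1 v e"
  shows "good M w1 v"
proof -
  interpret pa_model M by fact
  have mono: "smallM M x w" if "smallM M x w1" for x by (rule small_mono[OF that assms(3)])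
  note agree = agree_iff[OF assms(4)]
  show ?thesis unfolding good_def
  proof (intro conjI allI impI)
    fix x u assume "smallM M x w1" "smallM M u w1" "dl M x u"
    then show "memM M x v" using good_thm[OF assms(1,2) mono mono, of x u] agree[of x] by simp
  next
    fix x y z assume "smallM M x w1" "smallM M y w1" "smallM M z w1" "impM M x y z"
      "memM M z v" "memM M x v"
    then show "memM M y v"
      using good_mp[OF assms(1,2) mono mono mono, of x y z] agree[of x] agree[of y] agree[of z] by simp
  qed
qed

text \<open>From \<open>w\<close> on, normal stages are blocked by the witness at \<open>w\<close>,
  and so are failures after \<open>w\<close>. A failure at or before \<open>w\<close> would give one
  at \<open>w\<close>. An earlier normal stage accepts only what is in all its good sets, and as
  there is no failure, one of these agrees there with \<open>e\<close>.\<close>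

lemma prM_first:
  assumes "pa_model M" "first M i w e" "ls M e w" "smallM M x w"
  shows "prM M i x \<longleftrightarrow> memM M x e"
proof
  interpret pa_model M by fact
  have wit: "wit M i w e" and nowit: "nowit M i w" and nofail: "\<not> failM M w"
    using assms(2) by (auto simp: first_def)
  assume "prM M i x"
  then obtain w1 where "prM_body M w1 i x" by (auto simp: prM_def)
  then consider
    (stage) "smallM M x w1" "\<And>v. ls M v w1 \<Longrightarrow> good M w1 v \<Longrightarrow> memM M x v" "nowit M i w1"
      "\<And>e. ls M e w1 \<Longrightarrow> \<not> wit M i w1 e"
    | (fail) "failM M w1" "nowit M i w1"
    | (first) e1 where "ls M e1 w1" "first M i w1 e1" "memM M x e1"
    unfolding prM_body_def by blast
  then show "memM M x e"
  proof cases
    case stage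
    have "\<not> ls M w w1" using stage(3) wit assms(3) unfolding nowit_def by blast
    moreover have "w \<noteq> w1" using stage(4) wit assms(3) by blast
    ultimately have "ls M w1 w" using ls_linear by blast
    moreover obtain v where v: "ls M v w1" "agreeM M w1 v e"
      using not_failM[OF nofail \<open>ls M w1 w\<close> assms(3) stage(1)] .
    ultimately have "good M w1 v" using good_agree[OF assms(1)] wit unfolding wit_def by blast
    then show ?thesis using stage(1,2) v agree_iff by blast
  next
    case fail
    have "\<not> ls M w w1" using fail(2) wit assms(3) unfolding nowit_def by blast
    then have "failM M w" using ls_linear[of w w1] fail(1) fail_mono by blast
    then show ?thesis using nofail by blast
  next
    case first
    have 1: "wit M i w1 e1" "nowit M i w1" using first(2) by (auto simp: first_def)
    have "\<not> ls M w w1" using 1(2) wit assms(3) unfolding nowit_def by blast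
    moreover have "\<not> ls M w1 w" using 1(1) nowit first(1) unfolding nowit_def by blast
    ultimately have w: "w1 = w" using ls_linear by blast
    have "\<not> ls M e1 e" using assms(2) 1(1) unfolding first_def w by blast
    moreover have "\<not> ls M e e1" using first(2) wit unfolding first_def w by blast
    ultimately have "e1 = e" using ls_linear by blast
    then show ?thesis using first(3) by simp
  qed
qed (use assms in \<open>auto simp: prM_def prM_body_def\<close>)

text \<open>The least number principle inside \<open>M\<close>, first for the stage and then for
  \<open>e\<close>; both properties are bounded and hence definable.\<close>

lemma first_exists:
  assumes "pa_model M" "wit M i w e" "ls M e w"
  obtains w0 where "nowit M i w0" "\<exists>e. ls M e w0 \<and> wit M i w0 e"
    "failM M w0 \<or> (\<exists>e. ls M e w0 \<and> first M i w0 e)"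
proof -
  interpret pa_model M by fact
  have "Del 2 (\<lambda>M f. \<exists>e. ls M e (f 0) \<and> wit M (f 1) (f 0) e)"
    by (intro Del_intros; simp)
  from Del_definable[OF this, of "\<lambda>_. i"] have "definable (\<lambda>w. \<exists>e. ls M e w \<and> wit M i w e)" by simp
  then obtain w0 where w0: "\<exists>e. ls M e w0 \<and> wit M i w0 e"
    "\<And>w. ls M w w0 \<Longrightarrow> \<not> (\<exists>e. ls M e w \<and> wit M i w e)"
    using least[of "\<lambda>w. \<exists>e. ls M e w \<and> wit M i w e" w] assms(2,3) by blast
  have nowit: "nowit M i w0" using w0(2) unfolding nowit_def by blast
  have "Del 3 (\<lambda>M f. ls M (f 0) (f 2) \<and> wit M (f 1) (f 2) (f 0))"
    by (intro Del_intros; simp)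
  from Del_definable[OF this, of "case_nat i (\<lambda>_. w0)"]
  have "definable (\<lambda>e. ls M e w0 \<and> wit M i w0 e)" by (simp add: numeral_2_eq_2)
  then obtain e0 where e0: "ls M e0 w0" "wit M i w0 e0"
    "\<And>e. ls M e e0 \<Longrightarrow> \<not> (ls M e w0 \<and> wit M i w0 e)"
    using least[of "\<lambda>e. ls M e w0 \<and> wit M i w0 e"] w0(1) by blast
  have "first M i w0 e0" if "\<not> failM M w0"
    unfolding first_def using e0 nowit that ls_trans by blast
  then show ?thesis using that[OF nowit w0(1)] e0(1) by blast
qed

text \<open>A witness would make \<open>T\<close> refute that \<open>Pr\<close> agrees with the set \<open>e\<close> below \<open>k\<close>, although by
  construction \<open>Pr\<close> is then equal to \<open>e\<close> in all models of PA.\<close>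

lemma no_wit_NN:
  assumes "e < w"
  shows "\<not> wit NN h w e"
proof
  assume "wit NN h w e"
  moreover have "ls NN e w" using assms by simp
  ultimately obtain w0 where "failM NN w0 \<or> (\<exists>e. ls NN e w0 \<and> first NN h w0 e)"
    by (rule first_exists[OF NN.pa_model_axioms])
  then obtain e0 where first: "e0 < w0" "first NN h w0 e0" using not_failM_NN by auto
  then obtain k s u where ks: "smallM NN k w0" "rh NN h s k u" "\<And>x. x < k \<Longrightarrow> mem x e0 \<longleftrightarrow> mem x s"
    unfolding first_def wit_def by auto
  then have prv: "T \<turnstile> chain (Exists body) s k" using rh_h by blast
  obtain M where M: "models M T" using T_model by blast
  interpret pa_model M by (rule T_models[OF M])
  \<comment> \<open>Being first is a bounded property and so transfers from \<open>NN\<close> to the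
    standard elements of \<open>M\<close>.\<close>
  have "first M (nu M h) (nu M w0) (nu M e0)"
    by (subst abs3[of first]) (use first(2) in \<open>simp_all add: Del_intros\<close>)
  moreover have "ls M (nu M e0) (nu M w0)" using first(1) by (simp add: ls_nu_nu)
  moreover have "smallM M (nu M x) (nu M w0)" if "x < k" for x
    using ks(1) NN.small_antimono that small_nu by auto
  ultimately have "prM M (nu M h) (nu M x) \<longleftrightarrow> mem x s" if "x < k" for x
    using prM_first[OF pa_model_axioms, of "nu M h" "nu M w0" "nu M e0" "nu M x"] that ks(3)
    by (simp add: mem_nu)
  then have "\<not> sat M (\<lambda>_. 0) (chain (Exists body) s k)" by (simp add: sat_chain[OF pa_model_axioms])
  then show False using soundness[OF prv M] by blast
qed

section \<open>Behaviour in the standard model\<close>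

lemma prM_NN: "prM NN h x \<longleftrightarrow> (\<exists>p. x = gn p \<and> T \<turnstile> p)"
proof
  assume "prM NN h x"
  then obtain w where w: "smallM NN x w" "\<And>v. v < w \<Longrightarrow> good NN w v \<Longrightarrow> mem x v"
    unfolding prM_def prM_body_def using not_failM_NN no_wit_NN by (auto simp: first_def)
  \<comment> \<open>The set of theorems, cut down to small numbers, has a code below
    \<open>w\<close> and is good; so whatever lies in all good sets is a theorem.\<close>
  obtain v where v: "v < w" "\<And>x. smallM NN x w \<Longrightarrow> mem x v \<longleftrightarrow> (\<exists>p. x = gn p \<and> T \<turnstile> p)"
    using small_NN_code[OF w(1), of "{x. \<exists>p. x = gn p \<and> T \<turnstile> p}"] by auto
  have "good NN w v" unfolding good_def
  proof (intro conjI allI impI)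
    fix x u assume "smallM NN x w" "dl NN x u"
    then show "memM NN x v" using v(2)[of x] dl_NN[of x] by auto
  next
    fix x y z assume *: "smallM NN x w" "smallM NN y w" "smallM NN z w" "impM NN x y z" "memM NN z v" "memM NN x v"
    then obtain p q where p: "x = gn p" "T \<turnstile> p" "z = gn q" "T \<turnstile> q" using v(2) by auto
    have "gn q = prod_encode (5, prod_encode (gn p, y))" using * p by (simp add: impM_NN cImp_def)
    then obtain r where "q = Imp p r" "y = gn r" by (cases q) (auto simp: gn_inject)
    then show "memM NN y v" using v(2)[OF *(2)] p prv.MP by auto
  qed
  then show "\<exists>p. x = gn p \<and> T \<turnstile> p" using w v by blast
next
  assume "\<exists>p. x = gn p \<and> T \<turnstile> p"
  then obtain u where u: "dl NN x u" using dl_NN by blast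
  obtain w where w: "smallM NN (Suc (max x u)) w" using small_NN_ex by blast
  then have small: "smallM NN x w" "smallM NN u w" using NN.small_antimono by fastforce+
  have "memM NN x v" if "good NN w v" for v
    by (rule good_thm[OF NN.pa_model_axioms that small u])
  then have "prM_body NN w h x" unfolding prM_body_def nowit_def by (simp add: no_wit_NN small)
  then show "prM NN h x" by (auto simp: prM_def)
qed

lemma prM_nu:
  assumes "pa_model M" "prM NN h x"
  shows "prM M (nu M h) (nu M x)"
proof -
  interpret pa_model M by fact
  obtain w where "prM_body NN w h x" using assms(2) by (auto simp: prM_def)
  then have "prM_body M (nu M w) (nu M h) (nu M x)" using abs3[OF Del_prM_body] by blast
  then show ?thesis by (auto simp: prM_def)
qed

section \<open>Modus ponens in arbitrary models of PA\<close>

lemma wit_nonstandard: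
  assumes "pa_model M" "wit M (nu M h) w e" "ls M e w"
  shows "ls M (nu M n) w"
proof (rule ccontr)
  interpret pa_model M by fact
  \<comment> \<open>Then \<open>w\<close>, and with it \<open>e\<close>, is standard, and
    absoluteness yields a witness in \<open>NN\<close>.\<close>
  assume "\<not> ls M (nu M n) w"
  then have "ls M w (nu M (Suc n))" using ls_linear by (auto simp: nu_Suc ls_su)
  then obtain m where m: "w = nu M m" using ls_nu by blast
  then obtain l where l: "e = nu M l" "l < m" using assms(3) ls_nu by blast
  have "wit NN h m l" using assms(2) abs3[of wit h m l] by (simp add: m l Del_intros)
  then show False using no_wit_NN l(2) by blast
qed

lemma small_nonstandard:
  assumes "pa_model M" "\<And>n. ls M (nu M n) w"
  shows "smallM M (nu M n) w"
proof -
  interpret pa_model M by fact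
  obtain m where "smallM NN n m" using small_NN_ex by blast
  then show ?thesis using small_nu small_mono assms(2) by blast
qed

text \<open>If there is a witness, then at the first stage with one either a failure makes
  \<open>Pr\<close> hold of everything, or \<open>Pr\<close> coincides on standard numbers with a
  good set. With neither witness nor failure, acceptance persists to later stages, and a common
  later stage has both premises.\<close>

lemma prM_mp:
  assumes "pa_model M" and ab: "prM M (nu M h) (nu M (cImp a b))" and a: "prM M (nu M h) (nu M a)"
  shows "prM M (nu M h) (nu M b)"
proof -
  interpret pa_model M by fact
  show ?thesis
  proof (cases "\<exists>w e. wit M (nu M h) w e \<and> ls M e w")
    case True
    then obtain w0 where w0: "nowit M (nu M h) w0" "\<exists>e. ls M e w0 \<and> wit M (nu M h) w0 e"
      "failM M w0 \<or> (\<exists>e. ls M e w0 \<and> first M (nu M h) w0 e)"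
      using first_exists[OF assms(1)] by blast
    show ?thesis
    proof (cases "failM M w0")
      case True
      then show ?thesis using w0(1) unfolding prM_def prM_body_def by blast
    next
      case False
      then obtain e where e: "ls M e w0" "first M (nu M h) w0 e" using w0(3) by blast
      \<comment> \<open>Witnesses occur only at nonstandard stages, where all standard numbers are
        small.\<close>
      have small: "smallM M (nu M n) w0" for n
        using small_nonstandard[OF assms(1)] wit_nonstandard[OF assms(1)] w0(2) by blast
      have mem: "prM M (nu M h) (nu M n) \<longleftrightarrow> memM M (nu M n) e" for n
        by (rule prM_first[OF assms(1) e(2,1) small])
      have "good M w0 e" using e(2) by (simp add: first_def wit_def)
      then have "memM M (nu M b) e" by (rule good_mp[OF assms(1) _ small small small imp_nu[of a b]]) (use ab a mem in auto)
      then show ?thesis by (simp add: mem)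
    qed
  next
    case False
    then have no: "\<And>w e. ls M e w \<Longrightarrow> \<not> wit M (nu M h) w e" and nowit: "\<And>w. nowit M (nu M h) w"
      by (auto simp: nowit_def)
    show ?thesis
    proof (cases "\<exists>w. failM M w")
      case True
      then show ?thesis using nowit unfolding prM_def prM_body_def by blast
    next
      case nofail: False
      have stage: "\<exists>w. smallM M x w \<and> (\<forall>v. ls M v w \<longrightarrow> good M w v \<longrightarrow> memM M x v)"
        if "prM M (nu M h) x" for x
        using that nofail no unfolding prM_def prM_body_def first_def by blast
      obtain w1 where w1: "smallM M (nu M (cImp a b)) w1"
        "\<And>v. ls M v w1 \<Longrightarrow> good M w1 v \<Longrightarrow> memM M (nu M (cImp a b)) v" using stage[OF ab] by blast
      obtain w2 where w2: "smallM M (nu M a) w2"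
        "\<And>v. ls M v w2 \<Longrightarrow> good M w2 v \<Longrightarrow> memM M (nu M a) v" using stage[OF a] by blast
      obtain m where m: "smallM NN b m" using small_NN_ex by blast
      have ub: "\<exists>z. ls M x z \<and> ls M y z" for x y
      proof -
        have "ls M x (su M x)" "ls M y (su M y)" by (simp_all add: ls_su)
        then show ?thesis using ls_linear[of x y] ls_trans by blast
      qed
      obtain w3 where w3: "ls M w1 w3" "ls M w2 w3" "ls M (nu M m) w3" using ub ls_trans by meson
      have small: "smallM M (nu M (cImp a b)) w3" "smallM M (nu M a) w3" "smallM M (nu M b) w3"
        using w1(1) w2(1) m w3 small_mono small_nu by blast+
      \<comment> \<open>A good set of the later stage \<open>w3\<close> agrees at \<open>w\<close>
        with some code below \<open>w\<close>, which is good there and therefore contains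
        \<open>x\<close>.\<close>
      have approx: "memM M x v" if v: "ls M v w3" "good M w3 v" and w: "ls M w w3" "smallM M x w"
        "\<And>v. ls M v w \<Longrightarrow> good M w v \<Longrightarrow> memM M x v" for x v w
      proof -
        obtain z where z: "ls M w z" "ls M v z" using ub by blast
        obtain v' where v': "ls M v' w" "agreeM M w v' v"
          using not_failM[of z w v x] nofail z w(2) by blast
        then have "good M w v'" using good_agree[OF assms(1) v(2)] w(1) by blast
        then show ?thesis using w(2,3) v' agree_iff by blast
      qed
      have "memM M (nu M b) v" if v: "ls M v w3" "good M w3 v" for v
      proof -
        have "memM M (nu M (cImp a b)) v" "memM M (nu M a) v"
          using approx[OF v w3(1) w1] approx[OF v w3(2) w2] by blast+
        then show ?thesis by (rule good_mp[OF assms(1) v(2) small(2,3,1) imp_nu])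
      qed
      then have "prM_body M w3 (nu M h) (nu M b)"
        unfolding prM_body_def using small(3) nowit no by blast
      then show ?thesis unfolding prM_def by blast
    qed
  qed
qed

text \<open>If \<open>T\<close> refuted the agreement with \<open>X\<close> below \<open>k\<close>,
  a code of \<open>X\<close> would be a witness at a standard stage, against
  \<open>no_wit_NN\<close>. So the refutation is unprovable, and completeness yields
  \<open>M\<close>.\<close>

lemma flexible:
  assumes thms: "\<And>p. T \<turnstile> p \<Longrightarrow> gn p \<in> X" and mp: "\<And>a b. cImp a b \<in> X \<Longrightarrow> a \<in> X \<Longrightarrow> b \<in> X"
  shows "\<exists>M. models M T \<and> (\<forall>x<k. prM M (nu M h) (nu M x) \<longleftrightarrow> x \<in> X)"
proof -
  obtain s where s: "\<And>x. x < k \<Longrightarrow> mem x s \<longleftrightarrow> x \<in> X" using code_ex[of k X] by blast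
  have "\<not> T \<turnstile> chain (Exists body) s k"
  proof
    assume "T \<turnstile> chain (Exists body) s k"
    then obtain u where u: "rh NN h s k u" using rh_h by blast
    obtain w where w: "smallM NN (Suc (max k (max s u))) w" using small_NN_ex by blast
    then have small: "smallM NN k w" "smallM NN s w" "smallM NN u w"
      using NN.small_antimono by fastforce+
    \<comment> \<open>\<open>s\<close> is known to be right only below \<open>k\<close>; the stop
      needs a code that is right for all small numbers.\<close>
    obtain e where e: "e < w" "\<And>x. smallM NN x w \<Longrightarrow> mem x e \<longleftrightarrow> x \<in> X"
      using small_NN_code[OF small(1)] by blast
    have "good NN w e" unfolding good_def
    proof (intro conjI allI impI)
      fix x u assume "smallM NN x w" "dl NN x u"
      then show "memM NN x e" using e(2)[of x] dl_NN[of x] thms by auto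
    next
      fix x y z assume "smallM NN x w" "smallM NN y w" "smallM NN z w" "impM NN x y z"
        "memM NN z e" "memM NN x e"
      then show "memM NN y e" using e(2) mp by (auto simp: impM_NN)
    qed
    moreover have "mem x e \<longleftrightarrow> mem x s" if "x < k" for x
      using e(2)[of x] s[OF that] NN.small_antimono[OF small(1), of x] that by simp
    ultimately have "wit NN h w e" unfolding wit_def
      using small u small[THEN NN.small_ls]
      by (intro conjI exI[of _ k] exI[of _ s] exI[of _ u] allI impI) simp_all
    then show False using no_wit_NN e(1) by blast
  qed
  then obtain M e where M: "models M T" "\<not> sat M e (chain (Exists body) s k)" using T_complete by blast
  then show ?thesis using sat_chain[OF T_models[OF M(1)]] s by auto
qed

end

section \<open>Worlds of the modal logic K\<close>

text \<open>By Zorn's lemma \<open>\<Gamma>\<close> has a maximal finitely satisfiable extension; it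
  decides every formula, and membership in it is the valuation.\<close>

lemma prop_compactness:
  assumes fs: "\<And>F. F \<subseteq> \<Gamma> \<Longrightarrow> finite F \<Longrightarrow> \<exists>v. \<forall>B\<in>F. mval v B"
  shows "\<exists>v. \<forall>B\<in>\<Gamma>. mval v B"
proof -
  define fsat where "fsat \<Delta> \<longleftrightarrow> (\<forall>F\<subseteq>\<Delta>. finite F \<longrightarrow> (\<exists>v. \<forall>B\<in>F. mval v B))" for \<Delta>
  define \<A> where "\<A> = {\<Delta>. fsat (\<Gamma> \<union> \<Delta>)}"
  have "\<Union>C \<in> \<A>" if C: "subset.chain \<A> C" for C
  proof (cases "C = {}")
    case True
    then show ?thesis using fs by (simp add: \<A>_def fsat_def)
  next
    case False
    have "\<exists>v. \<forall>B\<in>F. mval v B" if F: "F \<subseteq> \<Gamma> \<union> \<Union>C" "finite F" for F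
    proof -
      have "F - \<Gamma> \<subseteq> \<Union>C" "finite (F - \<Gamma>)" using F by auto
      then obtain \<Delta> where \<Delta>: "\<Delta> \<in> C" "F - \<Gamma> \<subseteq> \<Delta>"
        using finite_subset_Union_chain[OF _ _ False C] by metis
      then have "fsat (\<Gamma> \<union> \<Delta>)" using C by (auto simp: subset.chain_def \<A>_def)
      moreover have "F \<subseteq> \<Gamma> \<union> \<Delta>" using \<Delta> by blast
      ultimately show ?thesis using F(2) unfolding fsat_def by blast
    qed
    then show ?thesis by (simp add: \<A>_def fsat_def)
  qed
  then obtain \<Delta> where \<Delta>: "\<Delta> \<in> \<A>" "\<And>X. X \<in> \<A> \<Longrightarrow> \<Delta> \<subseteq> X \<Longrightarrow> X = \<Delta>"
    using subset_Zorn'[of \<A>] by metis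
  let ?D = "\<Gamma> \<union> \<Delta>"
  have D: "\<exists>v. \<forall>B\<in>F. mval v B" if "F \<subseteq> ?D" "finite F" for F
    using \<Delta>(1) that by (simp add: \<A>_def fsat_def)
  have unsat: "\<exists>F\<subseteq>?D. finite F \<and> (\<forall>v. (\<forall>C\<in>F. mval v C) \<longrightarrow> \<not> mval v B)" if B: "B \<notin> ?D" for B
  proof -
    have "insert B \<Delta> \<notin> \<A>" using \<Delta>(2)[of "insert B \<Delta>"] B by blast
    then obtain F where F: "F \<subseteq> insert B ?D" "finite F" "\<And>v. \<not> (\<forall>C\<in>F. mval v C)"
      by (auto simp: \<A>_def fsat_def)
    have "\<not> mval v B" if "\<forall>C\<in>F - {B}. mval v C" for v using F(3)[of v] that by blast
    then show ?thesis using F by (intro exI[of _ "F - {B}"]) auto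
  qed
  have ent: "C \<in> ?D" if F: "F \<subseteq> ?D" "finite F" "\<And>v. \<forall>B\<in>F. mval v B \<Longrightarrow> mval v C" for F C
  proof (rule ccontr)
    assume "C \<notin> ?D"
    from unsat[OF this] obtain G where G: "G \<subseteq> ?D" "finite G" "\<And>v. \<forall>B\<in>G. mval v B \<Longrightarrow> \<not> mval v C" by blast
    obtain v where "\<forall>B\<in>F \<union> G. mval v B" using D[of "F \<union> G"] F(1,2) G(1,2) by auto
    then show False using F(3)[of v] G(3)[of v] by blast
  qed
  have neg: "MNeg C \<in> ?D \<longleftrightarrow> C \<notin> ?D" for C
  proof
    assume "MNeg C \<in> ?D"
    then show "C \<notin> ?D" using D[of "{C, MNeg C}"] by auto
  next
    assume "C \<notin> ?D"
    from unsat[OF this] obtain G where "G \<subseteq> ?D" "finite G" "\<And>v. \<forall>B\<in>G. mval v B \<Longrightarrow> \<not> mval v C" by blast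
    then show "MNeg C \<in> ?D" by (intro ent[of G]) simp_all
  qed
  have "mval (\<lambda>B. B \<in> ?D) B \<longleftrightarrow> B \<in> ?D" for B
  proof (induction B)
    case MBot
    show ?case using D[of "{MBot}"] by auto
  next
    case (MNeg A)
    then show ?case using neg by simp
  next
    case (MAnd A B)
    have "MAnd A B \<in> ?D \<Longrightarrow> A \<in> ?D" by (rule ent[of "{MAnd A B}"]) auto
    moreover have "MAnd A B \<in> ?D \<Longrightarrow> B \<in> ?D" by (rule ent[of "{MAnd A B}"]) auto
    moreover have "A \<in> ?D \<Longrightarrow> B \<in> ?D \<Longrightarrow> MAnd A B \<in> ?D" by (rule ent[of "{A, B}"]) auto
    ultimately show ?case unfolding mval.simps MAnd.IH by blast
  next
    case (MOr A B)
    have "MOr A B \<in> ?D \<Longrightarrow> A \<notin> ?D \<Longrightarrow> B \<in> ?D"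
      using ent[of "{MOr A B, MNeg A}" B] neg by auto
    then show ?case using ent[of "{A}" "MOr A B"] ent[of "{B}" "MOr A B"] MOr by auto
  next
    case (MImp A B)
    have "A \<notin> ?D \<Longrightarrow> MImp A B \<in> ?D"
      using ent[of "{MNeg A}" "MImp A B"] neg by auto
    then show ?case using ent[of "{B}" "MImp A B"] ent[of "{MImp A B, A}" B] MImp by auto
  qed simp_all
  then show ?thesis by (intro exI[of _ "\<lambda>B. B \<in> ?D"]) auto
qed

text \<open>The worlds of the canonical model: a maximal consistent set is represented by its
  valuation of variables and boxed formulas.\<close>

definition kworld :: "(modal \<Rightarrow> bool) \<Rightarrow> bool" where
  "kworld v \<longleftrightarrow> (\<forall>B. K_prv B \<longrightarrow> mval v B)"

lemma K_consequence:
  assumes "finite F" "\<And>C. C \<in> F \<Longrightarrow> K_prv C" "\<And>v. \<forall>C\<in>F. mval v C \<Longrightarrow> mval v A"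
  shows "K_prv A"
  using assms
proof (induction arbitrary: A rule: finite_induct)
  case empty
  then show ?case by (intro K_prv.Taut) (simp add: tautology_def)
next
  case (insert C F)
  have "K_prv (MImp C A)" by (rule insert.IH) (use insert.prems in auto)
  then show ?case by (rule K_prv.MP) (simp add: insert.prems)
qed

lemma K_complete:
  assumes "\<And>v. kworld v \<Longrightarrow> mval v A"
  shows "K_prv A"
proof (rule ccontr)
  assume A: "\<not> K_prv A"
  have "\<exists>v. \<forall>B\<in>insert (MNeg A) {B. K_prv B}. mval v B"
  proof (rule prop_compactness)
    fix F assume F: "F \<subseteq> insert (MNeg A) {B. K_prv B}" "finite F"
    show "\<exists>v. \<forall>B\<in>F. mval v B"
    proof (rule ccontr)
      assume no: "\<not> ?thesis"
      have "K_prv A"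
      proof (rule K_consequence[of "F - {MNeg A}"])
        fix v assume v: "\<forall>C\<in>F - {MNeg A}. mval v C"
        show "mval v A"
        proof (rule ccontr)
          assume "\<not> mval v A"
          then have "\<forall>B\<in>F. mval v B" using v by auto
          then show False using no by blast
        qed
      qed (use F in auto)
      then show False using A by blast
    qed
  qed
  then show False using assms by (auto simp: kworld_def)
qed

text \<open>The premises are moved into implications \<open>MImp C B\<close> one by one, and the box
  is distributed. With no premises left, \<open>B\<close> is true in all worlds, hence provable by
  \<open>K_complete\<close>, and necessitation applies.\<close>

lemma kworld_box_mono:
  assumes v: "kworld v" and "finite F" "\<And>C. C \<in> F \<Longrightarrow> v (MBox C)"
    "\<And>v'. kworld v' \<Longrightarrow> \<forall>C\<in>F. mval v' C \<Longrightarrow> mval v' B"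
  shows "v (MBox B)"
  using assms(2-)
proof (induction arbitrary: B rule: finite_induct)
  case empty
  then have "K_prv (MBox B)" by (intro K_prv.Nec K_complete) simp
  then have "mval v (MBox B)" using v unfolding kworld_def by blast
  then show ?case by simp
next
  case (insert C F)
  have "v (MBox (MImp C B))" by (rule insert.IH) (use insert.prems in auto)
  moreover have "mval v (MImp (MBox (MImp C B)) (MImp (MBox C) (MBox B)))"
    using v K_prv.Dist unfolding kworld_def by blast
  ultimately show ?case using insert.prems(1) by simp
qed

text \<open>The existence lemma of the canonical model: an unsatisfiable finite part would involve
  only finitely many boxed formulas of \<open>v\<close>, and \<open>kworld_box_mono\<close> would
  give \<open>v (MBox B)\<close>.\<close>

lemma kworld_successor:
  assumes "kworld v" "\<not> v (MBox B)"
  obtains v' where "kworld v'" "\<And>C. v (MBox C) \<Longrightarrow> mval v' C" "\<not> mval v' B"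
proof -
  have "\<exists>v'. \<forall>C\<in>insert (MNeg B) ({C. K_prv C} \<union> {C. v (MBox C)}). mval v' C"
  proof (rule prop_compactness)
    fix F assume F: "F \<subseteq> insert (MNeg B) ({C. K_prv C} \<union> {C. v (MBox C)})" "finite F"
    show "\<exists>v. \<forall>B\<in>F. mval v B"
    proof (rule ccontr)
      assume no: "\<not> ?thesis"
      have "v (MBox B)"
      proof (rule kworld_box_mono[OF assms(1), of "{C \<in> F. v (MBox C)}"])
        fix v' assume v': "kworld v'" "\<forall>C\<in>{C \<in> F. v (MBox C)}. mval v' C"
        show "mval v' B"
        proof (rule ccontr)
          assume "\<not> mval v' B"
          then have "\<forall>B\<in>F. mval v' B" using v' F(1) unfolding kworld_def by auto
          then show False using no by blast
        qed
      qed (use F in auto)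
      then show False using assms(2) by blast
    qed
  qed
  then obtain v' where "\<forall>C\<in>insert (MNeg B) ({C. K_prv C} \<union> {C. v (MBox C)}). mval v' C" by blast
  then show ?thesis using that[of v'] by (auto simp: kworld_def)
qed

section \<open>Arithmetical completeness\<close>

lemma prv_mono: "T \<turnstile> p \<Longrightarrow> T \<subseteq> T' \<Longrightarrow> T' \<turnstile> p"
proof (induction rule: prv.induct)
  case (Ax p)
  then show ?case by (auto intro: prv.Ax)
next
  case (MP p q)
  show ?case by (rule prv.MP[OF MP.IH(1)[OF MP.prems] MP.IH(2)[OF MP.prems]])
qed (simp_all add: prv.intros(3-19))

lemma prv_finite: "T \<turnstile> p \<Longrightarrow> \<exists>F\<subseteq>T. finite F \<and> F \<turnstile> p"
proof (induction rule: prv.induct)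
  case (Ax p)
  then show ?case by (intro exI[of _ "{p}"]) (auto intro: prv.Ax)
next
  case (MP p q)
  then obtain F G where FG: "F \<subseteq> T" "finite F" "F \<turnstile> Imp p q" "G \<subseteq> T" "finite G" "G \<turnstile> p" by blast
  have "F \<union> G \<turnstile> q" by (rule prv.MP[OF prv_mono[OF FG(3)] prv_mono[OF FG(6)]]) auto
  then show ?case using FG by (intro exI[of _ "F \<union> G"]) auto
next
  case (Gen p)
  then show ?case using prv.Gen by blast
qed (rule exI[of _ "{}"], simp add: prv.intros(4-19))+

lemma PA_sentence: "\<forall>p\<in>PA. sentence p"
  by (auto simp: PA_def sentence_def Iff_def)

lemma PA_complete: "(\<And>M e. pa_model M \<Longrightarrow> sat M e p) \<Longrightarrow> PA \<turnstile> p"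
  using completeness[OF PA_sentence prv.Ax] by (metis pa_model.intro)

primrec mdepth :: "modal \<Rightarrow> nat" where
  "mdepth (MVar i) = 0"
| "mdepth MBot = 0"
| "mdepth (MNeg A) = mdepth A"
| "mdepth (MAnd A B) = max (mdepth A) (mdepth B)"
| "mdepth (MOr A B) = max (mdepth A) (mdepth B)"
| "mdepth (MImp A B) = max (mdepth A) (mdepth B)"
| "mdepth (MBox A) = Suc (mdepth A)"

context race begin

lemma sentence_Pr: "sentence (subst Pr (num x) 0)"
  using fv_Pr by (auto simp: sentence_def subst_eq fv_psubst subst_map_def)

text \<open>\<open>flexible\<close> prescribes only finitely many values. A contradiction derived
  from \<open>T\<close> and all literals \<open>lit x\<close> would use finitely many of
  them.\<close>

lemma flexible_full:
  assumes thms: "\<And>p. T \<turnstile> p \<Longrightarrow> gn p \<in> X" and mp: "\<And>a b. cImp a b \<in> X \<Longrightarrow> a \<in> X \<Longrightarrow> b \<in> X"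
  shows "\<exists>M. models M T \<and> (\<forall>x. prM M (nu M h) (nu M x) \<longleftrightarrow> x \<in> X)"
proof -
  define lit where "lit x = (if x \<in> X then subst Pr (num x) 0 else Neg (subst Pr (num x) 0))" for x
  have sat_lit: "sat M e (lit x) \<longleftrightarrow> (prM M (nu M h) (nu M x) \<longleftrightarrow> x \<in> X)" for M e x
    by (simp add: lit_def sat_Pr)
  have sentence: "\<forall>p\<in>T \<union> range lit. sentence p"
    using T_sentence sentence_Pr by (auto simp: lit_def sentence_def)
  have "\<not> (T \<union> range lit) \<turnstile> Ff"
  proof
    assume "(T \<union> range lit) \<turnstile> Ff"
    then obtain F where F: "F \<subseteq> T \<union> range lit" "finite F" "F \<turnstile> Ff" using prv_finite by blast
    have "F - T \<subseteq> range lit" "finite (F - T)" using F by auto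
    then obtain C where C: "finite C" "F - T = lit ` C" using finite_subset_image[of "F - T" lit UNIV] by auto
    obtain k where k: "\<forall>x\<in>C. x < k" using C(1) finite_nat_set_iff_bounded by auto
    obtain M where M: "models M T" "\<And>x. x < k \<Longrightarrow> prM M (nu M h) (nu M x) \<longleftrightarrow> x \<in> X"
      using flexible[of X k, OF thms] mp by blast
    have "sat M e p" if p: "p \<in> F" for p e
    proof (cases "p \<in> T")
      case True
      then show ?thesis using M(1) by (simp add: models_def)
    next
      case False
      then obtain x where "x \<in> C" "p = lit x" using C(2) p by blast
      then show ?thesis using k M(2) by (simp add: sat_lit)
    qed
    then have "models M F" by (simp add: models_def)
    then have "sat M (\<lambda>_. 0) Ff" by (rule soundness[OF F(3)])
    then show False by (simp add: Ff_def)
  qed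
  moreover have "T \<union> range lit \<turnstile> p" if "p \<in> PA" for p
    using prv_mono[OF T_PA[OF prv.Ax[OF that]]] by simp
  ultimately obtain M where "models M (T \<union> range lit)"
    using completeness[OF sentence] by metis
  then show ?thesis using sat_lit unfolding models_def by blast
qed

text \<open>Formula codes have the tags 0 to 7, so the values of \<open>Pr\<close> at numbers with
  tag 8 can be prescribed freely.\<close>

primrec interp :: "modal \<Rightarrow> fm" where
  "interp (MVar j) = subst Pr (num (prod_encode (8, j))) 0"
| "interp MBot = Eq Zero (Succ Zero)"
| "interp (MNeg A) = Neg (interp A)"
| "interp (MAnd A B) = And (interp A) (interp B)"
| "interp (MOr A B) = Or (interp A) (interp B)"
| "interp (MImp A B) = Imp (interp A) (interp B)"
| "interp (MBox A) = at_code Pr (interp A)"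

lemma arith_interp: "arith_interp Pr interp"
proof -
  have "sentence (interp A)" for A
    by (induction A) (use sentence_Pr in \<open>simp_all add: at_code_def\<close>, simp_all add: sentence_def)
  then show ?thesis by (simp add: arith_interp_def)
qed

lemma Pr_provability_predicate: "provability_predicate T Pr"
  unfolding provability_predicate_def
proof (intro conjI allI fv_Pr iffI)
  fix p assume "T \<turnstile> p"
  then have "prM NN h (gn p)" using prM_NN by blast
  then show "PA \<turnstile> at_code Pr p"
    unfolding at_code_def using sat_Pr prM_nu by (intro PA_complete) blast
next
  fix p assume "PA \<turnstile> at_code Pr p"
  then have "sat NN (\<lambda>_. 0) (at_code Pr p)" using soundness NN_models_PA by blast
  then have "prM NN h (gn p)" by (simp add: at_code_def sat_Pr)
  then show "T \<turnstile> p" using prM_NN by (auto simp: gn_inject)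
qed

lemma K_sound:
  assumes "K_prv A" "arith_interp Pr f"
  shows "PA \<turnstile> f A"
  using assms(1)
proof induction
  case (Taut A)
  show ?case
  proof (rule PA_complete)
    fix M e assume "pa_model M"
    then interpret pa_model M .
    \<comment> \<open>Boxed formulas count as atoms in \<open>mval\<close>, so their values may be
      read off from \<open>M\<close>.\<close>
    have "mval (\<lambda>B. sat M e (f B)) B \<longleftrightarrow> sat M e (f B)" for B
      using assms(2) su_neq_zr[of "zr M"] by (induction B) (auto simp: arith_interp_def)
    moreover have "mval (\<lambda>B. sat M e (f B)) A" using Taut by (simp only: tautology_def)
    ultimately show "sat M e (f A)" by simp
  qed
next
  case (Dist A B)
  show ?case
  proof (rule PA_complete)
    fix M e assume M: "pa_model M"
    show "sat M e (f (MImp (MBox (MImp A B)) (MImp (MBox A) (MBox B))))"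
      using assms(2) prM_mp[OF M, of "gn (f A)" "gn (f B)"]
      by (simp add: arith_interp_def at_code_def sat_Pr code_defs)
  qed
next
  case (MP A B)
  then show ?case using assms(2) prv.MP by (simp add: arith_interp_def)
next
  case (Nec A)
  then have "PA \<turnstile> at_code Pr (f A)"
    using T_PA Pr_provability_predicate unfolding provability_predicate_def by blast
  then show ?case using assms(2) by (simp add: arith_interp_def)
qed

text \<open>The accessibility relation of the canonical model is not well-founded, so models cannot
  be assigned to worlds by recursion on successors. The bound \<open>n\<close> breaks the circle: up
  to depth \<open>n\<close>, \<open>Pr\<close> only has to be right about the formulas of smaller
  depth at the successors.\<close>

lemma world_model:
  "kworld v \<Longrightarrow> \<exists>M. models M T \<and> (\<forall>B e. mdepth B < n \<longrightarrow> (sat M e (interp B) \<longleftrightarrow> mval v B))"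
proof (induction n arbitrary: v)
  case 0
  show ?case using T_model by simp
next
  case (Suc n)
  obtain N where N: "\<And>v. kworld v \<Longrightarrow> models (N v) T"
    "\<And>v B e. kworld v \<Longrightarrow> mdepth B < n \<Longrightarrow> sat (N v) e (interp B) \<longleftrightarrow> mval v B"
    using Suc.IH by metis
  define R where "R v' \<longleftrightarrow> kworld v' \<and> (\<forall>C. v (MBox C) \<longrightarrow> mval v' C)" for v'
  define X where "X = {gn q | q. \<forall>v'. R v' \<longrightarrow> (\<forall>e. sat (N v') e q)} \<union> {prod_encode (8, j) | j. v (MVar j)}"
  have gn_neq: "gn q \<noteq> prod_encode (8, j)" for q j by (cases q) auto
  have X_gn: "gn q \<in> X \<longleftrightarrow> (\<forall>v'. R v' \<longrightarrow> (\<forall>e. sat (N v') e q))" for q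
    using gn_neq by (auto simp: X_def gn_inject)
  have X_var: "prod_encode (8, j) \<in> X \<longleftrightarrow> v (MVar j)" for j
    using gn_neq by (auto simp: X_def) (metis gn_neq)
  have mp: "b \<in> X" if ab: "cImp a b \<in> X" and a: "a \<in> X" for a b
  proof -
    \<comment> \<open>An implication in \<open>X\<close> has tag 5 and so codes a formula. Then
      \<open>a\<close> and \<open>b\<close> code formulas as well, and the numbers with tag 8 take
      no part in modus ponens.\<close>
    obtain q where q: "prod_encode (5, prod_encode (a, b)) = gn q" using ab by (auto simp: X_def cImp_def)
    then obtain p r where p: "a = gn p" "b = gn r" by (cases q) auto
    then have "gn (Imp p r) \<in> X" using ab by (simp add: cImp_def)
    then have "\<forall>v'. R v' \<longrightarrow> (\<forall>e. sat (N v') e (Imp p r))" unfolding X_gn .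
    then show ?thesis using a unfolding p X_gn sat.simps by blast
  qed
  have "gn p \<in> X" if "T \<turnstile> p" for p
    unfolding X_gn using soundness[OF that] N(1) by (auto simp: R_def)
  then obtain M where M: "models M T" "\<And>x. prM M (nu M h) (nu M x) \<longleftrightarrow> x \<in> X"
    using flexible_full mp by metis
  interpret pa_model M by (rule T_models[OF M(1)])
  have "sat M e (interp B) \<longleftrightarrow> mval v B" if "mdepth B < Suc n" for B e
    using that
  proof (induction B)
    case (MVar j)
    show ?case by (simp add: sat_Pr M(2) X_var)
  next
    case MBot
    show ?case using su_neq_zr[of "zr M"] by (simp add: eq_commute)
  next
    case (MBox B)
    have "sat M e (interp (MBox B)) \<longleftrightarrow> (\<forall>v'. R v' \<longrightarrow> (\<forall>e. sat (N v') e (interp B)))"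
      by (simp add: at_code_def sat_Pr M(2) X_gn)
    also have "\<dots> \<longleftrightarrow> (\<forall>v'. R v' \<longrightarrow> mval v' B)" using N(2) MBox.prems by (auto simp: R_def)
    also have "\<dots> \<longleftrightarrow> v (MBox B)"
      using kworld_successor[OF Suc.prems, of B] unfolding R_def by metis
    finally show ?case by simp
  qed simp_all
  then show ?case using M(1) by blast
qed

lemma K_iff_interp: "K_prv A \<longleftrightarrow> T \<turnstile> interp A"
proof
  assume "K_prv A"
  then show "T \<turnstile> interp A" by (intro T_PA K_sound[OF _ arith_interp])
next
  assume prv: "T \<turnstile> interp A"
  show "K_prv A"
  proof (rule K_complete)
    fix v assume "kworld v"
    then obtain M where "models M T" "sat M (\<lambda>_. 0) (interp A) \<longleftrightarrow> mval v A"
      using world_model[of v "Suc (mdepth A)"] by blast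
    then show "mval v A" using soundness[OF prv] by blast
  qed
qed

end

theorem theoremA1:
  fixes T :: "fm set"
  assumes "prim_rec_theory T"
    and "consistent T"
    and "\<forall>p. PA \<turnstile> p \<longrightarrow> T \<turnstile> p"
  shows "\<exists>Pr. sigma1 Pr \<and> provability_predicate T Pr \<and>
    (\<forall>A f. arith_interp Pr f \<longrightarrow> K_prv A \<longrightarrow> PA \<turnstile> f A) \<and>
    (\<exists>f. arith_interp Pr f \<and> (\<forall>A. K_prv A \<longleftrightarrow> T \<turnstile> f A))"
proof -
  have "Sig 1 (\<lambda>e. prv_code T (e 0))" by (rule Sig_prv_code[OF assms(1)]) (simp add: SigF_var)
  then obtain P where P: "Del (Suc 1) P" "\<And>e. prv_code T (e 0) \<longleftrightarrow> (\<exists>u. P NN (case_nat u e))"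
    by (auto simp: Sig_def)
  obtain Q where Q: "Del (Suc 3) Q"
    "\<And>e. prv_code T (cChain (e 0) (e 1) (e 2)) \<longleftrightarrow> (\<exists>u. Q NN (case_nat u e))"
    using Sig_refutes[OF assms(1)] by (auto simp: Sig_def)
  \<comment> \<open>In \<open>P\<close> and \<open>Q\<close> the witness is variable 0 and precedes
    the arguments, whereas \<open>dl\<close> and \<open>rh\<close> take it last.\<close>
  define dl where "dl M x u = P M (case_nat u (\<lambda>_. x))" for M x u
  define rh where "rh M i s k u = Q M (case_nat u (case_nat i (case_nat s (\<lambda>_. k))))" for M i s k u
  interpret race T dl rh
  proof
    show "\<forall>p\<in>T. sentence p" using assms(1) by (simp add: prim_rec_theory_def)
    show "T \<turnstile> p" if "PA \<turnstile> p" for p using assms(3) that by blast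
    show "consistent T" by fact
    show "Del 2 (\<lambda>M e. dl M (e 0) (e 1))" unfolding dl_def
      by (rule Del_ren[OF P(1), where \<pi> = "case_nat (Suc 0) (\<lambda>_. 0)"])
        (auto simp: env_case split: nat.split)
    show "Del 4 (\<lambda>M e. rh M (e 0) (e 1) (e 2) (e 3))" unfolding rh_def
    proof (rule Del_ren[OF Q(1), where \<pi> = "case_nat 3 (case_nat 0 (case_nat 1 (\<lambda>_. 2)))"])
      show "Q M (case_nat (e 3) (case_nat (e 0) (case_nat (e 1) (\<lambda>_. e 2)))) \<longleftrightarrow>
        Q M (\<lambda>i. e (case_nat 3 (case_nat 0 (case_nat 1 (\<lambda>_. 2))) i))" for M e
        by (rule arg_cong[where f = "Q M"]) (rule ext, simp split: nat.split)
    qed (auto split: nat.split)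
    show "(\<exists>u. dl NN x u) \<longleftrightarrow> (\<exists>p. x = gn p \<and> T \<turnstile> p)" for x
      using P(2)[of "\<lambda>_. x"] by (simp add: dl_def prv_code_iff)
    show "(\<exists>u. rh NN (gn \<theta>) s k u) \<longleftrightarrow> T \<turnstile> chain \<theta> s k" for \<theta> s k
      using Q(2)[of "case_nat (gn \<theta>) (case_nat s (\<lambda>_. k))"]
      by (simp add: rh_def prv_code_iff cChain gn_inject numeral_2_eq_2)
  qed
  show ?thesis
    using sigma1_Pr Pr_provability_predicate K_sound arith_interp K_iff_interp by blast
qed

end
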